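(* Let $\alpha\in(0,1)$ and suppose that $\sigma(x)^2>0$ for all $x\in\mathbb R$. Let $\{\varphi_j(\cdot),\ j=0,\pm1,\pm2,\ldots\}$ be an orthonormal basis of $\mathcal L_2(0,T)$, put $$ y_{j,\varepsilon}=\int_0^T\frac{\varphi_j(t)}{\varepsilon\,\sigma(X_t)}\left[\mathrm dX_t-S_0(X_t)\,\mathrm dt\right],\qquad \delta^*_\varepsilon=\frac1{\sqrt{4m}}\sum_{|j|<m}\left[y_{j,\varepsilon}^2-1\right], $$ where $m=m(\varepsilon)$ is a positive integer with $m(\varepsilon)\to\infty$ as $\varepsilon\to0$, and let $z_\alpha$ be the $(1-\alpha)$-quantile of the Gaussian law $\mathcal N(0,1)$. Then the test $\psi^*_\varepsilon(X^\varepsilon)=1_{\{\delta^*_\varepsilon>z_\alpha\}}$ belongs to the class $\mathcal K_\alpha$ of tests of asymptotic size $\alpha$; that is, $\mathbf E_0\psi^*_\varepsilon(X^\varepsilon)=\alpha+o(1)$ as $\varepsilon\to0$.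
   Context: Fix $T>0$ and $x_0\in\mathbb R$. For $\varepsilon>0$ one observes the trajectory $X^\varepsilon=\{X_t,\,0\le t\le T\}$ of the solution of $$\mathrm dX_t=S(X_t)\,\mathrm dt+\varepsilon\,\sigma(X_t)\,\mathrm dW_t,\qquad X_0=x_0,\quad 0\le t\le T,$$ where $W$ is a standard Wiener process, $x_0$ is deterministic and $\sigma$ is known. The basic hypothesis is $\mathscr H_0: S(\cdot)=S_0(\cdot)$ with $S_0:\mathbb R\to\mathbb R$ a known function; $\mathbf P_0,\mathbf E_0$ denote probability and expectation under $\mathscr H_0$. Standing assumption: there is $L>0$ such that $|S_0(x)-S_0(y)|+|\sigma(x)-\sigma(y)|\le L|x-y|$ for all $x,y\in\mathbb R$ (so the equation under $\mathscr H_0$ has a unique strong solution). A test is a function $\psi_\varepsilon=\psi_\varepsilon(X^\varepsilon)$ of the observations, and $\mathcal K_\alpha=\{\psi_\varepsilon:\ \mathbf E_0\psi_\varepsilon(X^\varepsilon)=\alpha+o(1)\}$, where $o(1)$ refers to $\varepsilon\to0$. The integral defining $y_{j,\varepsilon}$ is a stochastic (Itô) integral. *)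

theory Defs
  imports "HOL-Probability.Probability"
begin

section \<open>Filtrations and the Wiener process\<close>

text \<open>The sub-\<open>\<sigma>\<close>-algebra of \<open>M\<close> generated by \<open>X s\<close> for \<open>0 \<le> s \<le> t\<close>.\<close>

definition natural_filtration :: "'a measure \<Rightarrow> (real \<Rightarrow> 'a \<Rightarrow> real) \<Rightarrow> real \<Rightarrow> 'a measure" where
  "natural_filtration M X t =
     sigma (space M) {X s -` A \<inter> space M | s A. s \<in> {0..t} \<and> A \<in> sets borel}"

definition wiener_process ::
    "'a measure \<Rightarrow> (real \<Rightarrow> 'a measure) \<Rightarrow> real \<Rightarrow> (real \<Rightarrow> 'a \<Rightarrow> real) \<Rightarrow> bool" where
  "wiener_process M F T W \<longleftrightarrow>
     prob_space M \<and> filtration (space M) F \<and> (\<forall>t. subalgebra M (F t)) \<and>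
     (\<forall>t\<in>{0..T}. W t \<in> borel_measurable (F t)) \<and>
     (AE \<omega> in M. W 0 \<omega> = 0) \<and>
     (AE \<omega> in M. continuous_on {0..T} (\<lambda>t. W t \<omega>)) \<and>
     (\<forall>s t. 0 \<le> s \<and> s < t \<and> t \<le> T \<longrightarrow>
        distributed M lborel (\<lambda>\<omega>. W t \<omega> - W s \<omega>) (normal_density 0 (sqrt (t - s))) \<and>
        prob_space.indep_set M (sets (F s))
          {(\<lambda>\<omega>. W t \<omega> - W s \<omega>) -` A \<inter> space M | A. A \<in> sets borel})"

section \<open>The stochastic integral\<close>

text \<open>
  A simple adapted integrand is given by times \<open>0 \<le> \<tau> 0 \<le> \<dots> \<le> \<tau> n \<le> T\<close> and bounded
  weights, \<open>\<xi> i\<close> being known at time \<open>\<tau> i\<close>; it takes the value \<open>\<xi> i\<close> on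
  \<open>]\<tau> i, \<tau> (i + 1)]\<close>.
\<close>

definition simple_integrand ::
    "(real \<Rightarrow> 'a measure) \<Rightarrow> real \<Rightarrow> nat \<Rightarrow> (nat \<Rightarrow> real) \<Rightarrow> (nat \<Rightarrow> 'a \<Rightarrow> real) \<Rightarrow> bool" where
  "simple_integrand F T n \<tau> \<xi> \<longleftrightarrow>
     0 \<le> \<tau> 0 \<and> (\<forall>i<n. \<tau> i \<le> \<tau> (Suc i)) \<and> \<tau> n \<le> T \<and>
     (\<forall>i<n. \<xi> i \<in> borel_measurable (F (\<tau> i)) \<and> (\<exists>B. \<forall>\<omega>\<in>space (F (\<tau> i)). \<bar>\<xi> i \<omega>\<bar> \<le> B))"

definition simple_process ::
    "nat \<Rightarrow> (nat \<Rightarrow> real) \<Rightarrow> (nat \<Rightarrow> 'a \<Rightarrow> real) \<Rightarrow> real \<Rightarrow> 'a \<Rightarrow> real" where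
  "simple_process n \<tau> \<xi> t \<omega> = (\<Sum>i<n. \<xi> i \<omega> * indicator {\<tau> i<..\<tau> (Suc i)} t)"

definition simple_integral ::
    "(real \<Rightarrow> 'a \<Rightarrow> real) \<Rightarrow> nat \<Rightarrow> (nat \<Rightarrow> real) \<Rightarrow> (nat \<Rightarrow> 'a \<Rightarrow> real) \<Rightarrow> 'a \<Rightarrow> real" where
  "simple_integral Y n \<tau> \<xi> \<omega> = (\<Sum>i<n. \<xi> i \<omega> * (Y (\<tau> (Suc i)) \<omega> - Y (\<tau> i) \<omega>))"

definition null_in_prob :: "'a measure \<Rightarrow> (nat \<Rightarrow> 'a \<Rightarrow> ennreal) \<Rightarrow> bool" where
  "null_in_prob M Z \<longleftrightarrow>
     (\<forall>k. Z k \<in> borel_measurable M) \<and>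
     (\<forall>e>0::real. (\<lambda>k. measure M {\<omega> \<in> space M. Z k \<omega> > ennreal e}) \<longlonglongrightarrow> 0)"

text \<open>
  \<open>I\<close> is a version of the stochastic integral of \<open>H\<close> with respect to \<open>Y\<close> over \<open>[0, T]\<close>.
  Here \<open>Y\<close> is meant to be a continuous local martingale whose quadratic variation is
  \<open>d\<langle>Y\<rangle>\<^sub>t = a\<^sub>t dt\<close>: for a Wiener process \<open>a = 1\<close>, and if \<open>dY\<^sub>t = s\<^sub>t dW\<^sub>t\<close> then
  \<open>a\<^sub>t = s\<^sub>t\<^sup>2\<close>.  The integral is the limit in probability of the integrals of simple adapted
  processes that approximate \<open>H\<close> in the sense that \<open>\<integral> (H\<^sup>k - H)\<^sup>2 d\<langle>Y\<rangle>\<close> tends to \<open>0\<close> in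
  probability.  Adaptedness of \<open>H\<close> is not a separate requirement: being such a limit, \<open>H\<close>
  agrees \<open>d\<langle>Y\<rangle> \<otimes> dP\<close>-almost everywhere with a predictable process.
\<close>

definition has_ito_integral ::
    "'a measure \<Rightarrow> (real \<Rightarrow> 'a measure) \<Rightarrow> (real \<Rightarrow> 'a \<Rightarrow> real) \<Rightarrow> (real \<Rightarrow> 'a \<Rightarrow> real) \<Rightarrow>
     real \<Rightarrow> (real \<Rightarrow> 'a \<Rightarrow> real) \<Rightarrow> ('a \<Rightarrow> real) \<Rightarrow> bool" where
  "has_ito_integral M F Y a T H I \<longleftrightarrow>
     (\<lambda>(t, \<omega>). H t \<omega>) \<in> borel_measurable (lebesgue_on {0..T} \<Otimes>\<^sub>M M) \<and>
     I \<in> borel_measurable (F T) \<and>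
     (\<exists>n \<tau> \<xi>.
        (\<forall>k::nat. simple_integrand F T (n k) (\<tau> k) (\<xi> k)) \<and>
        null_in_prob M (\<lambda>k \<omega>. \<integral>\<^sup>+ t.
          ennreal ((simple_process (n k) (\<tau> k) (\<xi> k) t \<omega> - H t \<omega>)\<^sup>2 * a t \<omega>) \<partial>lebesgue_on {0..T}) \<and>
        null_in_prob M (\<lambda>k \<omega>. ennreal \<bar>simple_integral Y (n k) (\<tau> k) (\<xi> k) \<omega> - I \<omega>\<bar>))"

text \<open>Versions of the integral agree almost surely; one of them is selected.\<close>

definition ito_integral ::
    "'a measure \<Rightarrow> (real \<Rightarrow> 'a measure) \<Rightarrow> (real \<Rightarrow> 'a \<Rightarrow> real) \<Rightarrow> (real \<Rightarrow> 'a \<Rightarrow> real) \<Rightarrow>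
     real \<Rightarrow> (real \<Rightarrow> 'a \<Rightarrow> real) \<Rightarrow> 'a \<Rightarrow> real" where
  "ito_integral M F Y a T H = (SOME I. has_ito_integral M F Y a T H I)"

section \<open>The diffusion equation\<close>

text \<open>\<open>X\<close> with the drift \<open>\<integral> b(X\<^sub>u) du\<close> removed.\<close>

definition drift_removed ::
    "(real \<Rightarrow> real) \<Rightarrow> (real \<Rightarrow> 'a \<Rightarrow> real) \<Rightarrow> real \<Rightarrow> 'a \<Rightarrow> real" where
  "drift_removed b X t \<omega> = X t \<omega> - (LINT u|lebesgue_on {0..t}. b (X u \<omega>))"

text \<open>\<open>dX\<^sub>t = b(X\<^sub>t) dt + s(X\<^sub>t) dW\<^sub>t\<close>, \<open>X\<^sub>0 = x0\<close>, on \<open>[0, T]\<close>.\<close>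

definition sde_solution ::
    "'a measure \<Rightarrow> (real \<Rightarrow> 'a measure) \<Rightarrow> (real \<Rightarrow> 'a \<Rightarrow> real) \<Rightarrow> (real \<Rightarrow> real) \<Rightarrow>
     (real \<Rightarrow> real) \<Rightarrow> real \<Rightarrow> real \<Rightarrow> (real \<Rightarrow> 'a \<Rightarrow> real) \<Rightarrow> bool" where
  "sde_solution M F W b s x0 T X \<longleftrightarrow>
     (\<forall>t\<in>{0..T}. X t \<in> borel_measurable (F t)) \<and>
     (\<forall>\<omega>\<in>space M. continuous_on {0..T} (\<lambda>t. X t \<omega>)) \<and>
     (AE \<omega> in M. X 0 \<omega> = x0) \<and>
     (\<forall>t\<in>{0..T}. has_ito_integral M F W (\<lambda>_ _. 1) t (\<lambda>u \<omega>. s (X u \<omega>))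
                    (\<lambda>\<omega>. drift_removed b X t \<omega> - x0))"

text \<open>
  \<open>\<integral>\<^sub>0\<^sup>T H\<^sub>t [dX\<^sub>t - b(X\<^sub>t) dt]\<close> as a functional of the observed trajectory: the integrator
  is the observed \<open>X\<close> minus its drift, with quadratic variation \<open>s(X\<^sub>t)\<^sup>2 dt\<close>, and both the
  approximating integrands and the integral are measurable with respect to the observations.
\<close>

definition observed_integral ::
    "'a measure \<Rightarrow> (real \<Rightarrow> real) \<Rightarrow> (real \<Rightarrow> real) \<Rightarrow> real \<Rightarrow> (real \<Rightarrow> 'a \<Rightarrow> real) \<Rightarrow>
     (real \<Rightarrow> 'a \<Rightarrow> real) \<Rightarrow> 'a \<Rightarrow> real" where
  "observed_integral M b s T X H =
     ito_integral M (natural_filtration M X) (drift_removed b X) (\<lambda>t \<omega>. (s (X t \<omega>))\<^sup>2) T H"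

section \<open>Orthonormal bases of \<open>L\<^sub>2(0,T)\<close>\<close>

definition L2_fun :: "real \<Rightarrow> (real \<Rightarrow> real) \<Rightarrow> bool" where
  "L2_fun T f \<longleftrightarrow>
     f \<in> borel_measurable (lebesgue_on {0..T}) \<and> integrable (lebesgue_on {0..T}) (\<lambda>t. (f t)\<^sup>2)"

definition orthonormal_basis_L2 :: "real \<Rightarrow> ('i \<Rightarrow> real \<Rightarrow> real) \<Rightarrow> bool" where
  "orthonormal_basis_L2 T \<phi> \<longleftrightarrow>
     (\<forall>j. L2_fun T (\<phi> j)) \<and>
     (\<forall>i j. (LINT t|lebesgue_on {0..T}. \<phi> i t * \<phi> j t) = (if i = j then 1 else 0)) \<and>
     (\<forall>f. L2_fun T f \<longrightarrow> (\<forall>e>0. \<exists>J c. finite J \<and>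
        (LINT t|lebesgue_on {0..T}. (f t - (\<Sum>j\<in>J. c j * \<phi> j t))\<^sup>2) < e))"

section \<open>Tests\<close>

definition quantile :: "real measure \<Rightarrow> real \<Rightarrow> real" where
  "quantile N p = Inf {x. p \<le> cdf N x}"

text \<open>
  The class of tests of asymptotic size \<open>\<alpha>\<close>.  A test is a \<open>[0,1]\<close>-valued function of the
  observations, that is, measurable with respect to the \<open>\<sigma>\<close>-algebra they generate.
\<close>

definition tests_of_asymptotic_size ::
    "real \<Rightarrow> real \<Rightarrow> (real \<Rightarrow> 'a measure) \<Rightarrow> (real \<Rightarrow> real \<Rightarrow> 'a \<Rightarrow> real) \<Rightarrow> (real \<Rightarrow> 'a \<Rightarrow> real) set"
  where
  "tests_of_asymptotic_size \<alpha> T M X = {\<psi>.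
     (\<forall>\<epsilon>>0. \<psi> \<epsilon> \<in> borel_measurable (natural_filtration (M \<epsilon>) (X \<epsilon>) T) \<and>
            (\<forall>\<omega>\<in>space (M \<epsilon>). \<psi> \<epsilon> \<omega> \<in> {0..1})) \<and>
     ((\<lambda>\<epsilon>. LINT \<omega>|M \<epsilon>. \<psi> \<epsilon> \<omega>) \<longlongrightarrow> \<alpha>) (at_right 0)}"

end

theory Submission
  imports Defs "HOL-Real_Asymp.Real_Asymp"
begin

text \<open>
Under the hypothesis, \<open>dX - S0(X) dt = \<epsilon> \<sigma>(X) dW\<close>, so formally
\<open>y j \<epsilon> = \<integral> \<phi> j dW\<close>: the drift, the diffusion coefficient, the noise level and even the random
path \<open>X\<close> cancel.  The integrals of an orthonormal family of deterministic functions against a Wiener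
process are independent standard normal variables.  Hence the law of \<open>\<delta> \<epsilon>\<close> depends on \<open>\<epsilon>\<close> only
through \<open>m \<epsilon>\<close>; it is that of a sum of \<open>2 m - 1\<close> independent centred squares of standard normal
variables, each of variance 2, divided by \<open>sqrt (4 m)\<close>.  By the central limit theorem it tends to
\<open>N(0,1)\<close>, and the statistic exceeds the \<open>(1 - \<alpha>)\<close>-quantile with probability tending to \<open>\<alpha>\<close>.

The work lies in the cancellation.  The integral \<open>y j \<epsilon>\<close> is built from simple processes adapted to
the observations and integrated against the drift-free observed process \<open>Y\<close>, while the equation for
\<open>X\<close> and the Gaussian law refer to integrals against \<open>W\<close> in a larger filtration.  The bridge is one
inequality (\<open>simple_integral_stopped_bound\<close>): if the energy \<open>\<integral> H\<^sup>2 dt\<close> of a simple integrand is small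
in probability, so is its integral against \<open>W\<close>.  It makes the class of pairs (integrand, integral)
closed under limits in probability (\<open>has_W_integral_limit\<close>, \<open>has_W_integral_bound\<close>).  An increment of
\<open>Y\<close> is in this class by the stochastic equation, hence so are all simple integrals against \<open>Y\<close>, with
integrand multiplied by \<open>s(X) = \<epsilon> \<sigma>(X)\<close> (\<open>has_W_integral_of_elementary_Y\<close>).  Since
\<open>(H - f / s(X))\<^sup>2 s(X)\<^sup>2 = (H s(X) - f)\<^sup>2\<close>, every version of the observed integral of \<open>f / s(X)\<close> is a
\<open>W\<close>-integral of \<open>f\<close> (\<open>has_W_integral_observed_integral\<close>).

That such a version exists is a separate matter (\<open>observed_integral_exists\<close>): Riemann-type simple
processes approximate \<open>f / s(X)\<close> for continuous \<open>f\<close>, continuous functions are dense in \<open>L\<^sub>2\<close>, and the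
resulting integrals converge almost surely along a fast sequence, to a limit that is measurable with
respect to the observations.

For the law, the integral of a deterministic step function is a sum of independent normal increments;
passing to the limit, the integral of \<open>f\<close> has characteristic function \<open>exp (- \<integral> f\<^sup>2 / 2)\<close> at 1
(\<open>char_has_W_integral_deterministic\<close>).  Applied to all linear combinations of the \<open>\<phi> j\<close>, this gives
the joint characteristic function of the \<open>y j \<epsilon>\<close>, from which independence is derived by a
conditioning argument (\<open>joint_std_normal_char_imp_product_law\<close>).
\<close>

section \<open>Independence from the joint characteristic function\<close>

text \<open>
Levy's uniqueness theorem compares probability measures, so it can be used under a change of measure
as long as the density is nonnegative: under the normalised weight \<open>h / k\<close> the variable \<open>Z\<close> has
the characteristic function, hence the law, of a standard normal variable.
\<close>

lemma weighted_char_std_normal: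
  assumes "prob_space M" and [measurable]: "Z \<in> borel_measurable M" "h \<in> borel_measurable M"
    and h: "\<And>\<omega>. \<omega> \<in> space M \<Longrightarrow> 0 \<le> h \<omega>" "\<And>\<omega>. \<omega> \<in> space M \<Longrightarrow> h \<omega> \<le> B"
    and k: "(LINT \<omega>|M. h \<omega>) = k" "0 < k"
    and char: "\<And>t. (LINT \<omega>|M. of_real (h \<omega>) * iexp (t * Z \<omega>)) = complex_of_real (k * exp (- t\<^sup>2 / 2))"
    and [measurable]: "A \<in> sets borel"
  shows "(LINT \<omega>|M. h \<omega> * indicator A (Z \<omega>)) = k * measure std_normal_distribution A"
proof -
  interpret prob_space M by fact
  interpret std: real_distribution std_normal_distribution by (rule real_dist_normal_dist)
  have int: "integrable M h"
    by (rule integrable_const_bound[where B=B]) (use h in auto)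
  define N where "N = density M (\<lambda>\<omega>. ennreal (h \<omega> / k))"
  have nn: "AE \<omega> in M. 0 \<le> h \<omega> / k" using h k by auto
  have "emeasure N (space N) = (\<integral>\<^sup>+ \<omega>. ennreal (h \<omega> / k) \<partial>M)"
    by (auto simp: N_def emeasure_density intro!: nn_integral_cong)
  also have "\<dots> = ennreal (LINT \<omega>|M. h \<omega> / k)"
    by (rule nn_integral_eq_integral) (use int nn in auto)
  also have "\<dots> = 1" using k by simp
  finally interpret N: prob_space N by (intro prob_spaceI)
  have [measurable]: "Z \<in> borel_measurable N" "sets N = sets M" by (auto simp: N_def)
  have "char (distr N borel Z) t = char std_normal_distribution t" for t
  proof -
    have "char (distr N borel Z) t = (LINT \<omega>|N. iexp (t * Z \<omega>))"
      by (simp add: char_def integral_distr)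
    also have "\<dots> = (LINT \<omega>|M. (h \<omega> / k) *\<^sub>R iexp (t * Z \<omega>))"
      unfolding N_def by (rule integral_density) (use nn in auto)
    also have "\<dots> = (LINT \<omega>|M. of_real (h \<omega>) * iexp (t * Z \<omega>)) / k"
      by (simp add: scaleR_conv_of_real del: of_real_mult)
    also have "\<dots> = char std_normal_distribution t"
      unfolding char using k by (simp add: char_std_normal_distribution)
    finally show ?thesis .
  qed
  then have law: "distr N borel Z = std_normal_distribution"
    by (intro Levy_uniqueness std.real_distribution_axioms N.real_distribution_distr ext) auto
  have "k * measure std_normal_distribution A = k * (LINT x|distr N borel Z. indicator A x)"
    by (simp add: law)
  also have "(LINT x|distr N borel Z. indicator A x :: real) = (LINT \<omega>|N. indicator A (Z \<omega>))"
    by (rule integral_distr) auto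
  also have "\<dots> = (LINT \<omega>|M. h \<omega> / k * indicator A (Z \<omega>))"
    unfolding N_def by (rule integral_real_density) (use nn in auto)
  also have "k * \<dots> = (LINT \<omega>|M. h \<omega> * indicator A (Z \<omega>))"
    using k by (simp add: field_simps flip: integral_mult_right_zero)
  finally show ?thesis by simp
qed

text \<open>
The complex weight \<open>exp(iY)\<close> is not a density, but \<open>1 + cos (Y - \<theta>)\<close> is nonnegative and a linear
combination of \<open>1\<close>, \<open>exp(iY)\<close> and \<open>exp(-iY)\<close>.  The choices \<open>\<theta> = 0\<close> and \<open>\<theta> = \<pi>/2\<close> yield the real
and the imaginary part.
\<close>

lemma std_normal_char_imp_factor:
  assumes "prob_space M" and [measurable]: "Z \<in> borel_measurable M" "Y \<in> borel_measurable M"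
    and char: "\<And>t s. s \<in> {-1, 0, 1} \<Longrightarrow>
      (LINT \<omega>|M. iexp (t * Z \<omega> + s * Y \<omega>)) = complex_of_real (exp (- t\<^sup>2 / 2) * (if s = 0 then 1 else r))"
    and r: "0 < r" and A[measurable]: "A \<in> sets borel"
  shows "(LINT \<omega>|M. indicator A (Z \<omega>) * iexp (Y \<omega>)) = of_real (measure std_normal_distribution A * r)" (is ?thesis1)
    and "(LINT \<omega>|M. indicator A (Z \<omega>)) = measure std_normal_distribution A" (is ?thesis2)
proof -
  interpret prob_space M by fact
  have ie: "integrable M (\<lambda>\<omega>. iexp (a * Z \<omega> + b * Y \<omega>))" for a b :: real
    by (rule integrable_iexp) auto
  show th2: ?thesis2
    using weighted_char_std_normal[OF assms(1) assms(2), of "\<lambda>_. 1" 1 1 A] char[of 0] by (auto simp: prob_space)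
  have cosexp: "complex_of_real (cos (y - \<theta>)) = (iexp (- \<theta>) * iexp y + iexp \<theta> * iexp (- y)) / 2" for y \<theta> :: real
    by (simp add: cos_of_real[symmetric] cos_exp_eq exp_diff exp_minus exp_add field_simps flip: exp_add)
  (* The mean 1 + r cos \<theta> of the weight must be positive, which r > 0 ensures for both angles in use. *)
  have key: "(LINT \<omega>|M. (1 + cos (Y \<omega> - \<theta>)) * indicator A (Z \<omega>)) = (1 + r * cos \<theta>) * measure std_normal_distribution A"
    if \<theta>: "cos \<theta> = 0 \<or> cos \<theta> = 1" for \<theta>
  proof (rule weighted_char_std_normal[where B=2])
    have c: "(LINT \<omega>|M. of_real (1 + cos (Y \<omega> - \<theta>)) * iexp (t * Z \<omega>)) = complex_of_real ((1 + r * cos \<theta>) * exp (- t\<^sup>2 / 2))" for t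
    proof -
      have "of_real (1 + cos (Y \<omega> - \<theta>)) * iexp (t * Z \<omega>) =
         iexp (t * Z \<omega> + 0 * Y \<omega>) + iexp (- \<theta>) / 2 * iexp (t * Z \<omega> + 1 * Y \<omega>) + iexp \<theta> / 2 * iexp (t * Z \<omega> + (-1) * Y \<omega>)" for \<omega>
        unfolding of_real_add cosexp by (simp add: distrib_left exp_add exp_diff exp_minus field_simps)
      then have "(LINT \<omega>|M. of_real (1 + cos (Y \<omega> - \<theta>)) * iexp (t * Z \<omega>)) =
         (LINT \<omega>|M. iexp (t * Z \<omega> + 0 * Y \<omega>)) + iexp (- \<theta>) / 2 * (LINT \<omega>|M. iexp (t * Z \<omega> + 1 * Y \<omega>))
          + iexp \<theta> / 2 * (LINT \<omega>|M. iexp (t * Z \<omega> + (-1) * Y \<omega>))"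
        by (simp only: Bochner_Integration.integral_add Bochner_Integration.integrable_add ie
             integrable_mult_right integral_mult_right_zero)
      also have "\<dots> = complex_of_real (exp (- t\<^sup>2 / 2)) * (1 + r * ((iexp (- \<theta>) * iexp 0 + iexp \<theta> * iexp (- 0)) / 2))"
        by (subst (1 2 3) char) (auto simp: field_simps)
      also have "\<dots> = complex_of_real ((1 + r * cos \<theta>) * exp (- t\<^sup>2 / 2))"
        unfolding cosexp[of 0 \<theta>, symmetric] by simp
      finally show ?thesis .
    qed
    then show "(LINT \<omega>|M. of_real (1 + cos (Y \<omega> - \<theta>)) * iexp (t * Z \<omega>)) = complex_of_real ((1 + r * cos \<theta>) * exp (- t\<^sup>2 / 2))" for t .
    from c[of 0] have "complex_of_real (LINT \<omega>|M. (1 + cos (Y \<omega> - \<theta>))) = complex_of_real (1 + r * cos \<theta>)"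
      by (simp flip: integral_complex_of_real)
    then show "(LINT \<omega>|M. (1 + cos (Y \<omega> - \<theta>))) = 1 + r * cos \<theta>"
      unfolding of_real_eq_iff .
    show "0 < 1 + r * cos \<theta>" using \<theta> r by auto
    show "0 \<le> 1 + cos (Y \<omega> - \<theta>)" "1 + cos (Y \<omega> - \<theta>) \<le> 2" for \<omega>
      using cos_ge_minus_one[of "Y \<omega> - \<theta>"] cos_le_one[of "Y \<omega> - \<theta>"] by linarith+
  qed (use assms in auto)
  have ib: "integrable M (\<lambda>\<omega>. f (Y \<omega>) * indicator A (Z \<omega>))"
    if "\<And>x. \<bar>f x\<bar> \<le> 1" "f \<in> borel_measurable borel" for f :: "real \<Rightarrow> real"
    by (rule integrable_const_bound[where B=1])
       (use that in \<open>auto simp: indicator_def\<close>)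
  have i1: "integrable M (\<lambda>\<omega>. indicator A (Z \<omega>) :: real)" using ib[of "\<lambda>_. 1"] by simp
  have key': "(LINT \<omega>|M. cos (Y \<omega> - \<theta>) * indicator A (Z \<omega>)) = r * cos \<theta> * measure std_normal_distribution A"
    if \<theta>: "cos \<theta> = 0 \<or> cos \<theta> = 1" for \<theta>
    using key[OF \<theta>] ib[of "\<lambda>y. cos (y - \<theta>)"] i1 th2 by (simp add: distrib_right)
  have s: "(LINT \<omega>|M. sin (Y \<omega>) * indicator A (Z \<omega>)) = 0"
    using key'[of "pi / 2"] by (simp add: cos_diff)
  have c: "(LINT \<omega>|M. cos (Y \<omega>) * indicator A (Z \<omega>)) = r * measure std_normal_distribution A"
    using key'[of 0] by simp
  have "(LINT \<omega>|M. indicator A (Z \<omega>) * iexp (Y \<omega>))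
      = (LINT \<omega>|M. of_real (cos (Y \<omega>) * indicator A (Z \<omega>)) + \<i> * of_real (sin (Y \<omega>) * indicator A (Z \<omega>)))"
    by (rule Bochner_Integration.integral_cong)
       (auto simp: exp_Euler cos_of_real sin_of_real indicator_def)
  also have "\<dots> = of_real (LINT \<omega>|M. cos (Y \<omega>) * indicator A (Z \<omega>)) + \<i> * of_real (LINT \<omega>|M. sin (Y \<omega>) * indicator A (Z \<omega>))"
    using ib[of cos, THEN integrable_of_real[where 'a=complex]] ib[of sin, THEN integrable_of_real[where 'a=complex]]
    by (simp del: of_real_mult add: Bochner_Integration.integral_add[OF _ integrable_mult_right])
  finally show ?thesis1 using s c by (simp add: mult.commute)
qed


text \<open>
The induction removes one variable at a time: by the factorisation above, conditioning on the event
\<open>Z i \<in> A i\<close> leaves the joint characteristic function of the other variables unchanged, so the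
induction hypothesis applies to them under the conditional probability.  In this way the univariate
uniqueness theorem suffices to identify a multivariate normal law.
\<close>

lemma joint_std_normal_char_imp_product_law:
  fixes Z :: "'i \<Rightarrow> 'a \<Rightarrow> real"
  assumes "finite J" "prob_space M" "\<And>j. j \<in> J \<Longrightarrow> Z j \<in> borel_measurable M"
    and "\<And>c. (LINT \<omega>|M. iexp (\<Sum>j\<in>J. c j * Z j \<omega>)) = complex_of_real (exp (- (\<Sum>j\<in>J. (c j)\<^sup>2) / 2))"
    and "\<And>j. j \<in> J \<Longrightarrow> A j \<in> sets borel"
  shows "measure M {\<omega>\<in>space M. \<forall>j\<in>J. Z j \<omega> \<in> A j} = (\<Prod>j\<in>J. measure std_normal_distribution (A j))"
  using assms
proof (induction J arbitrary: M rule: finite_induct)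
  case empty
  then show ?case by (simp add: prob_space.prob_space)
next
  case (insert i J)
  interpret prob_space M by fact
  have [measurable]: "Z i \<in> borel_measurable M" "A i \<in> sets borel"
      "\<And>j. j \<in> J \<Longrightarrow> Z j \<in> borel_measurable M" "\<And>j. j \<in> J \<Longrightarrow> A j \<in> sets borel"
    using insert.prems by auto
  define \<mu> where "\<mu> = measure std_normal_distribution (A i)"
  have split: "(LINT \<omega>|M. iexp (t * Z i \<omega> + s * (\<Sum>j\<in>J. c j * Z j \<omega>))) =
      complex_of_real (exp (- t\<^sup>2 / 2) * (if s = 0 then 1 else exp (- (\<Sum>j\<in>J. (c j)\<^sup>2) / 2)))"
    if "s \<in> {-1, 0, 1}" for t s c
  proof -
    have eq: "t * Z i \<omega> + s * (\<Sum>j\<in>J. c j * Z j \<omega>) =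
        (\<Sum>j\<in>insert i J. (if j = i then t else s * c j) * Z j \<omega>)" for \<omega>
      using insert.hyps by (auto simp: sum_distrib_left mult.assoc intro!: sum.cong)
    have sq: "(\<Sum>j\<in>insert i J. (if j = i then t else s * c j)\<^sup>2) = t\<^sup>2 + s\<^sup>2 * (\<Sum>j\<in>J. (c j)\<^sup>2)"
      using insert.hyps by (auto simp: sum_distrib_left power_mult_distrib intro!: sum.cong)
    show ?thesis
      unfolding eq insert.prems(3) sq using that
      by (auto simp: diff_divide_distrib simp flip: exp_add of_real_mult)
  qed
  have fac: "(LINT \<omega>|M. indicator (A i) (Z i \<omega>) * iexp (\<Sum>j\<in>J. c j * Z j \<omega>)) =
      of_real (\<mu> * exp (- (\<Sum>j\<in>J. (c j)\<^sup>2) / 2))" for c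
    unfolding \<mu>_def
    by (rule std_normal_char_imp_factor(1)[OF \<open>prob_space M\<close>]) (use split in auto)
  have law: "(LINT \<omega>|M. indicator (A i) (Z i \<omega>)) = \<mu>"
    unfolding \<mu>_def
    by (rule std_normal_char_imp_factor(2)[OF \<open>prob_space M\<close>, of "Z i" "\<lambda>\<omega>. \<Sum>j\<in>J. 0 * Z j \<omega>" 1])
       (use split[of _ _ "\<lambda>_. 0"] in auto)
  have prob_i: "prob {\<omega>\<in>space M. Z i \<omega> \<in> A i} = \<mu>"
  proof -
    have "prob {\<omega>\<in>space M. Z i \<omega> \<in> A i} = (LINT \<omega>|M. indicator {\<omega>\<in>space M. Z i \<omega> \<in> A i} \<omega>)"
      by simp
    also have "\<dots> = (LINT \<omega>|M. indicator (A i) (Z i \<omega>))"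
      by (rule Bochner_Integration.integral_cong) (auto simp: indicator_def)
    finally show ?thesis using law by simp
  qed
  show ?case
  proof (cases "\<mu> = 0")
    case True
    have "prob {\<omega>\<in>space M. \<forall>j\<in>insert i J. Z j \<omega> \<in> A j} \<le> prob {\<omega>\<in>space M. Z i \<omega> \<in> A i}"
      by (rule finite_measure_mono) auto
    then show ?thesis using True insert.hyps prob_i measure_nonneg[of M]
      by (auto simp: \<mu>_def antisym)
  next
    case False
    then have \<mu>: "\<mu> > 0" by (simp add: \<mu>_def zero_less_measure_iff)
    (* the conditional probability given Z i \<in> A i *)
    define N where "N = density M (\<lambda>\<omega>. ennreal (indicator (A i) (Z i \<omega>) / \<mu>))"
    have int: "integrable M (\<lambda>\<omega>. indicator (A i) (Z i \<omega>) :: real)"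
      by (rule integrable_const_bound[where B=1]) auto
    have "emeasure N (space N) = (\<integral>\<^sup>+ \<omega>. ennreal (indicator (A i) (Z i \<omega>) / \<mu>) \<partial>M)"
      by (auto simp: N_def emeasure_density intro!: nn_integral_cong)
    also have "\<dots> = ennreal (LINT \<omega>|M. indicator (A i) (Z i \<omega>) / \<mu>)"
      by (rule nn_integral_eq_integral) (use int \<mu> in auto)
    also have "\<dots> = 1" using law \<mu> by simp
    finally have N: "prob_space N" by (intro prob_spaceI)
    have [measurable]: "Z j \<in> borel_measurable N" if "j \<in> J" for j using that by (simp add: N_def)
    have charN: "(LINT \<omega>|N. iexp (\<Sum>j\<in>J. c j * Z j \<omega>)) = complex_of_real (exp (- (\<Sum>j\<in>J. (c j)\<^sup>2) / 2))" for c
    proof -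
      have "(LINT \<omega>|N. iexp (\<Sum>j\<in>J. c j * Z j \<omega>))
          = (LINT \<omega>|M. (indicator (A i) (Z i \<omega>) / \<mu>) *\<^sub>R iexp (\<Sum>j\<in>J. c j * Z j \<omega>))"
        unfolding N_def by (rule integral_density) (use \<mu> in auto)
      also have "\<dots> = (LINT \<omega>|M. indicator (A i) (Z i \<omega>) * iexp (\<Sum>j\<in>J. c j * Z j \<omega>)) / \<mu>"
        by (subst integral_divide_zero[symmetric], rule Bochner_Integration.integral_cong) 
           (auto simp: indicator_def scaleR_conv_of_real)
      also have "\<dots> = complex_of_real (exp (- (\<Sum>j\<in>J. (c j)\<^sup>2) / 2))"
        unfolding fac using \<mu> by simp
      finally show ?thesis .
    qed
    have "(\<Prod>j\<in>J. measure std_normal_distribution (A j)) = measure N {\<omega>\<in>space N. \<forall>j\<in>J. Z j \<omega> \<in> A j}"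
      by (rule insert.IH[symmetric, OF N]) (use insert.prems charN in auto)
    also have "\<dots> = (LINT \<omega>|N. indicator {\<omega>\<in>space N. \<forall>j\<in>J. Z j \<omega> \<in> A j} \<omega>)"
      by (auto intro!: arg_cong[where f="measure N"])
    also have "\<dots> = (LINT \<omega>|M. (indicator (A i) (Z i \<omega>) / \<mu>) * indicator {\<omega>\<in>space N. \<forall>j\<in>J. Z j \<omega> \<in> A j} \<omega>)"
      unfolding N_def using \<mu> insert.hyps(1) by (intro integral_real_density) auto
    also have "\<dots> = (LINT \<omega>|M. indicator {\<omega>\<in>space M. \<forall>j\<in>insert i J. Z j \<omega> \<in> A j} \<omega>) / \<mu>"
      by (subst integral_divide_zero[symmetric], rule Bochner_Integration.integral_cong)
         (auto simp: indicator_def N_def)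
    also have "\<dots> = prob {\<omega>\<in>space M. \<forall>j\<in>insert i J. Z j \<omega> \<in> A j} / \<mu>"
      by (auto intro!: arg_cong[where f=prob])
    finally show ?thesis
      using \<mu> insert.hyps by (simp add: \<mu>_def field_simps)
  qed
qed

lemma joint_std_normal_char_imp_indep:
  fixes Z :: "'i \<Rightarrow> 'a \<Rightarrow> real"
  assumes "prob_space M" "finite J" and Z: "\<And>j. j \<in> J \<Longrightarrow> Z j \<in> borel_measurable M"
    and char: "\<And>c. (LINT \<omega>|M. iexp (\<Sum>j\<in>J. c j * Z j \<omega>)) = complex_of_real (exp (- (\<Sum>j\<in>J. (c j)\<^sup>2) / 2))"
  shows "prob_space.indep_vars M (\<lambda>_. borel) Z J"
    and "\<And>j. j \<in> J \<Longrightarrow> distr M borel (Z j) = std_normal_distribution"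
proof -
  interpret prob_space M by fact
  interpret std: real_distribution std_normal_distribution by (rule real_dist_normal_dist)
  have law: "prob {\<omega>\<in>space M. \<forall>j\<in>K. Z j \<omega> \<in> A j} = (\<Prod>j\<in>K. measure std_normal_distribution (A j))"
    if "K \<subseteq> J" "\<And>j. j \<in> K \<Longrightarrow> A j \<in> sets borel" for A K
  proof -
    have "prob {\<omega>\<in>space M. \<forall>j\<in>K. Z j \<omega> \<in> A j} = prob {\<omega>\<in>space M. \<forall>j\<in>J. Z j \<omega> \<in> (if j \<in> K then A j else UNIV)}"
      using that(1) by (intro arg_cong[where f=prob]) auto
    also have "\<dots> = (\<Prod>j\<in>J. measure std_normal_distribution (if j \<in> K then A j else UNIV))"
      by (rule joint_std_normal_char_imp_product_law) (use assms that in auto)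
    also have "\<dots> = (\<Prod>j\<in>K. measure std_normal_distribution (A j))"
      using that(1) \<open>finite J\<close> std.prob_space
      by (intro prod.mono_neutral_cong_right) auto
    finally show ?thesis .
  qed
  have one: "prob (Z j -` B \<inter> space M) = measure std_normal_distribution B" if "j \<in> J" "B \<in> sets borel" for j B
  proof -
    have "Z j -` B \<inter> space M = {\<omega>\<in>space M. \<forall>i\<in>{j}. Z i \<omega> \<in> B}" by auto
    then show ?thesis using law[of "{j}" "\<lambda>_. B"] that by simp
  qed
  show "indep_vars (\<lambda>_. borel) Z J"
    unfolding indep_vars_def2 indep_sets_def
  proof (intro conjI ballI allI impI)
    fix K A assume KA: "K \<subseteq> J" "K \<noteq> {}" "finite K" "A \<in> (\<Pi> i\<in>K. {Z i -` A \<inter> space M |A. A \<in> sets borel})"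
    then have "\<forall>j\<in>K. \<exists>B. A j = Z j -` B \<inter> space M \<and> B \<in> sets borel"
      by (auto simp: Pi_iff)
    then obtain B where B: "\<And>j. j \<in> K \<Longrightarrow> A j = Z j -` B j \<inter> space M" "\<And>j. j \<in> K \<Longrightarrow> B j \<in> sets borel"
      by metis
    have "(\<Inter>j\<in>K. A j) = {\<omega>\<in>space M. \<forall>j\<in>K. Z j \<omega> \<in> B j}"
      using B(1) KA by auto
    then have "prob (\<Inter>j\<in>K. A j) = (\<Prod>j\<in>K. measure std_normal_distribution (B j))"
      using law[of K B] B KA by auto
    also have "\<dots> = (\<Prod>j\<in>K. prob (A j))"
      by (rule prod.cong) (use KA B one in auto)
    finally show "prob (\<Inter> (A ` K)) = (\<Prod>j\<in>K. prob (A j))" .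
  qed (use Z in \<open>auto intro!: measurable_sets\<close>)
  fix j assume j: "j \<in> J"
  show "distr M borel (Z j) = std_normal_distribution"
  proof (rule measure_eqI)
    fix B assume "B \<in> sets (distr M borel (Z j))"
    then show "emeasure (distr M borel (Z j)) B = emeasure std_normal_distribution B"
      using one[OF j, of B] Z[OF j]
      by (simp add: emeasure_distr emeasure_eq_measure std.emeasure_eq_measure)
  qed simp
qed

section \<open>The central limit theorem for centred squares\<close>

text \<open>
A sum of \<open>n\<close> independent centred squares of standard normal variables, scaled to variance 1 (each term
has variance 2).  For \<open>n = 0\<close> the quotient \<open>0 / 0 = 0\<close> makes it the point mass at 0.
\<close>

definition chi_square_law :: "nat \<Rightarrow> real measure" where
  "chi_square_law n = distr (\<Pi>\<^sub>M i\<in>(UNIV::nat set). std_normal_distribution) borel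
     (\<lambda>x. (\<Sum>i<n. (x i)\<^sup>2 - 1) / sqrt (real n * 2))"

lemma std_normal_square_moments:
  "integrable std_normal_distribution (\<lambda>x. x\<^sup>2 - 1)"
  "(LINT x|std_normal_distribution. x\<^sup>2 - 1) = 0"
  "integrable std_normal_distribution (\<lambda>x. (x\<^sup>2 - 1)\<^sup>2)"
  "(LINT x|std_normal_distribution. (x\<^sup>2 - 1)\<^sup>2) = 2"
proof -
  interpret std: real_distribution std_normal_distribution by (rule real_dist_normal_dist)
  note [simp] = std.prob_space[simplified]
  have e: "(x\<^sup>2 - 1)\<^sup>2 = x ^ 4 - 2 * x\<^sup>2 + 1" for x :: real by algebra
  note i = integrable_std_normal_distribution_moment
  have m2: "(LINT x|std_normal_distribution. x\<^sup>2) = 1" and m4: "(LINT x|std_normal_distribution. x^4) = 3"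
    using std_normal_distribution_even_moments(1)[of 1] std_normal_distribution_even_moments(1)[of 2]
    by (auto simp: fact_numeral)
  show "integrable std_normal_distribution (\<lambda>x. x\<^sup>2 - 1)"
    "integrable std_normal_distribution (\<lambda>x. (x\<^sup>2 - 1)\<^sup>2)"
    unfolding e using i[of 2] i[of 4] by auto
  show "(LINT x|std_normal_distribution. x\<^sup>2 - 1) = 0" using i[of 2] m2 by simp
  show "(LINT x|std_normal_distribution. (x\<^sup>2 - 1)\<^sup>2) = 2"
    unfolding e using i[of 2] i[of 4] m2 m4 by simp
qed

lemma std_normal_product_space:
  defines "P \<equiv> \<Pi>\<^sub>M i\<in>(UNIV::nat set). std_normal_distribution"
  shows "prob_space P" and "(\<lambda>x. x i) \<in> borel_measurable P"
    and "distr P borel (\<lambda>x. x i) = std_normal_distribution"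
    and "prob_space.indep_vars P (\<lambda>_. borel) (\<lambda>i x. x i) UNIV"
proof -
  interpret std: real_distribution std_normal_distribution by (rule real_dist_normal_dist)
  show P: "prob_space P" unfolding P_def by (rule prob_space_PiM) (rule std.prob_space_axioms)
  interpret P: prob_space P by (rule P)
  show meas[measurable]: "(\<lambda>x. x i) \<in> borel_measurable P" for i
    using measurable_component_singleton[of i UNIV "\<lambda>_. std_normal_distribution"]
    by (simp add: P_def cong: measurable_cong_sets)
  have comp: "distr P std_normal_distribution (\<lambda>x. x i) = std_normal_distribution" for i
    unfolding P_def by (rule distr_PiM_component) (auto intro: std.prob_space_axioms)
  show "distr P borel (\<lambda>x. x i) = std_normal_distribution"
    by (subst comp[of i, symmetric]) (rule distr_cong, auto)
  have "P.indep_vars (\<lambda>_. std_normal_distribution) (\<lambda>i x. x i) UNIV"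
    by (subst P.indep_vars_iff_distr_eq_PiM') (auto simp: comp restrict_UNIV distr_id2 P_def[symmetric] cong: measurable_cong_sets)
  then show "P.indep_vars (\<lambda>_. borel) (\<lambda>i x. x i) UNIV"
    by (rule P.indep_vars_compose2) auto
qed

lemma real_distribution_chi_square_law: "real_distribution (chi_square_law n)"
proof -
  note [measurable] = std_normal_product_space(2)
  show ?thesis
    unfolding chi_square_law_def
    by (rule prob_space.real_distribution_distr[OF std_normal_product_space(1)]) measurable
qed

lemma weak_conv_chi_square_law: "weak_conv_m chi_square_law std_normal_distribution"
proof -
  let ?P = "\<Pi>\<^sub>M i\<in>(UNIV::nat set). std_normal_distribution"
  note comp = std_normal_product_space(3) and [measurable] = std_normal_product_space(2)
  interpret P: prob_space ?P by (rule std_normal_product_space(1))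
  have int: "(LINT x|?P. f (x i)) = (LINT x|std_normal_distribution. f x)"
    and intb: "integrable ?P (\<lambda>x. f (x i)) \<longleftrightarrow> integrable std_normal_distribution f"
    if [measurable]: "f \<in> borel_measurable borel" for f :: "real \<Rightarrow> real" and i
    by (subst (2) comp[of i, symmetric], subst integral_distr; simp)
       (subst comp[of i, symmetric], subst integrable_distr_eq; simp)
  have "weak_conv_m (\<lambda>n. distr ?P borel (\<lambda>x. (\<Sum>i<n. (x i)\<^sup>2 - 1) / sqrt (real n * (sqrt 2)\<^sup>2))) std_normal_distribution"
  proof (rule P.central_limit_theorem_zero_mean)
    show "P.indep_vars (\<lambda>_. borel) (\<lambda>i x. (x i)\<^sup>2 - 1) UNIV"
      by (rule P.indep_vars_compose2[OF std_normal_product_space(4)]) auto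
    show "P.expectation (\<lambda>x. (x n)\<^sup>2 - 1) = 0" "integrable ?P (\<lambda>x. ((x n)\<^sup>2 - 1)\<^sup>2)" for n
      using int[of "\<lambda>x. x\<^sup>2 - 1" n] intb[of "\<lambda>x. (x\<^sup>2 - 1)\<^sup>2" n] std_normal_square_moments by auto
    then show "P.variance (\<lambda>x. (x n)\<^sup>2 - 1) = (sqrt 2)\<^sup>2" for n
      using int[of "\<lambda>x. (x\<^sup>2 - 1)\<^sup>2" n] std_normal_square_moments by simp
    show "distr ?P borel (\<lambda>x. (x n)\<^sup>2 - 1) = distr std_normal_distribution borel (\<lambda>x. x\<^sup>2 - 1)" for n
      by (subst (2) comp[of n, symmetric], subst distr_distr) (auto simp: comp_def)
  qed auto
  then show ?thesis by (simp add: chi_square_law_def[abs_def])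
qed

text \<open>
Both characteristic functions are the same power of that of a single term.  The central limit theorem
concerns one sequence of variables on one space; this lemma transfers it to families that live on
different spaces for different \<open>\<epsilon>\<close>.
\<close>

lemma distr_standardized_square_sum:
  fixes Z :: "'i \<Rightarrow> 'a \<Rightarrow> real"
  assumes "prob_space M" "finite J" and indep: "prob_space.indep_vars M (\<lambda>_. borel) Z J"
    and law: "\<And>j. j \<in> J \<Longrightarrow> distr M borel (Z j) = std_normal_distribution"
  shows "distr M borel (\<lambda>\<omega>. (\<Sum>j\<in>J. (Z j \<omega>)\<^sup>2 - 1) / sqrt (real (card J) * 2)) = chi_square_law (card J)"
proof -
  define g where "g = (\<lambda>x::real. (x\<^sup>2 - 1) / sqrt (real (card J) * 2))"
  have [measurable]: "g \<in> borel_measurable borel" by (simp add: g_def)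
  have gen: "char (distr M' borel (\<lambda>\<omega>. \<Sum>j\<in>K. g (Z' j \<omega>))) t =
      (char (distr std_normal_distribution borel g) t) ^ card K"
    if M': "prob_space M'" and K: "finite K" "prob_space.indep_vars M' (\<lambda>_. borel) Z' K"
      "\<And>j. j \<in> K \<Longrightarrow> distr M' borel (Z' j) = std_normal_distribution"
    for M' :: "'c measure" and K :: "'k set" and Z' t
  proof -
    interpret prob_space M' by fact
    have Z'[measurable]: "Z' j \<in> borel_measurable M'" if "j \<in> K" for j
      using K(2) that by (auto simp: indep_vars_def)
    have "indep_vars (\<lambda>_. borel) (\<lambda>j \<omega>. g (Z' j \<omega>)) K"
      by (rule indep_vars_compose2[OF K(2)]) auto
    then have "char (distr M' borel (\<lambda>\<omega>. \<Sum>j\<in>K. g (Z' j \<omega>))) t = (\<Prod>j\<in>K. char (distr M' borel (\<lambda>\<omega>. g (Z' j \<omega>))) t)"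
      by (rule char_distr_sum)
    also have "distr M' borel (\<lambda>\<omega>. g (Z' j \<omega>)) = distr std_normal_distribution borel g" if "j \<in> K" for j
      using K(3)[OF that, symmetric] that by (simp add: distr_distr comp_def)
    then have "(\<Prod>j\<in>K. char (distr M' borel (\<lambda>\<omega>. g (Z' j \<omega>))) t) = (\<Prod>j\<in>K. char (distr std_normal_distribution borel g) t)"
      by (intro prod.cong) auto
    finally show ?thesis by simp
  qed
  let ?P = "\<Pi>\<^sub>M i\<in>(UNIV::nat set). std_normal_distribution"
  interpret P: prob_space ?P by (rule std_normal_product_space(1))
  interpret M: prob_space M by fact
  have indepP: "P.indep_vars (\<lambda>_. borel) (\<lambda>i x. x i) {..<card J}"
    by (rule P.indep_vars_subset[OF std_normal_product_space(4)]) simp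
  note [measurable] = std_normal_product_space(2)
  have [measurable]: "Z j \<in> borel_measurable M" if "j \<in> J" for j
    using indep that by (auto simp: M.indep_vars_def)
  have "distr M borel (\<lambda>\<omega>. \<Sum>j\<in>J. g (Z j \<omega>)) = distr ?P borel (\<lambda>x. \<Sum>i<card J. g (x i))"
  proof (rule Levy_uniqueness)
    show "char (distr M borel (\<lambda>\<omega>. \<Sum>j\<in>J. g (Z j \<omega>))) = char (distr ?P borel (\<lambda>x. \<Sum>i<card J. g (x i)))"
      using gen[OF assms] gen[OF P.prob_space_axioms _ indepP std_normal_product_space(3)] by (intro ext) simp
  qed auto
  then show ?thesis by (simp add: g_def chi_square_law_def sum_divide_distrib)
qed

lemma isCont_cdf_std_normal: "isCont (cdf std_normal_distribution) z"
proof -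
  interpret std: real_distribution std_normal_distribution by (rule real_dist_normal_dist)
  have "emeasure std_normal_distribution {z} = 0"
    by (subst emeasure_density) (auto simp: nn_integral_null_set[of "{z}"] simp flip: null_sets_def)
  then show ?thesis by (simp add: std.isCont_cdf measure_def)
qed

lemma cdf_std_normal_quantile:
  assumes "0 < p" "p < 1"
  shows "cdf std_normal_distribution (quantile std_normal_distribution p) = p"
proof -
  interpret std: real_distribution std_normal_distribution by (rule real_dist_normal_dist)
  let ?\<Phi> = "cdf std_normal_distribution"
  let ?S = "{x. p \<le> ?\<Phi> x}"
  have cont: "continuous_on UNIV ?\<Phi>"
    by (simp add: continuous_at_imp_continuous_on isCont_cdf_std_normal)
  obtain a where a: "\<And>x. x \<le> a \<Longrightarrow> ?\<Phi> x < p"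
    using order_tendstoD(2)[OF std.cdf_lim_at_bot assms(1)] by (auto simp: eventually_at_bot_linorder)
  obtain b where b: "p < ?\<Phi> b"
    using order_tendstoD(1)[OF std.cdf_lim_at_top_prob assms(2)] by (auto simp: eventually_at_top_linorder)
  have bdd: "bdd_below ?S" using a by (intro bdd_belowI[of _ a]) (force simp: not_less[symmetric])
  have ne: "?S \<noteq> {}" using b by (auto intro: less_imp_le)
  have "closed ?S" by (intro closed_Collect_le continuous_on_const cont)
  then have ge: "p \<le> ?\<Phi> (Inf ?S)" using closed_contains_Inf[OF ne bdd] by auto
  have "?\<Phi> (Inf ?S) \<le> p"
  proof (rule LIMSEQ_le_const2)
    show "(\<lambda>n. ?\<Phi> (Inf ?S - 1 / real (Suc n))) \<longlonglongrightarrow> ?\<Phi> (Inf ?S)"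
    proof (rule isCont_tendsto_compose[OF isCont_cdf_std_normal])
      show "(\<lambda>n. Inf ?S - 1 / real (Suc n)) \<longlonglongrightarrow> Inf ?S"
        using tendsto_diff[OF tendsto_const[of "Inf ?S"] LIMSEQ_inverse_real_of_nat] by (simp add: inverse_eq_divide)
    qed
    have "\<not> p \<le> ?\<Phi> (Inf ?S - 1 / real (Suc n))" for n
    proof
      assume "p \<le> ?\<Phi> (Inf ?S - 1 / real (Suc n))"
      then have "Inf ?S \<le> Inf ?S - 1 / real (Suc n)" by (intro cInf_lower bdd) simp
      then show False by simp
    qed
    then show "\<exists>N. \<forall>n\<ge>N. ?\<Phi> (Inf ?S - 1 / real (Suc n)) \<le> p" by (auto simp: not_le intro: less_imp_le)
  qed
  with ge show ?thesis by (simp add: quantile_def)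
qed

text \<open>
A distribution function is monotone, so its value at \<open>c n * z\<close> lies between those at \<open>z - d/2\<close> and
\<open>z + d/2\<close> once \<open>c n * z\<close> is close to \<open>z\<close>; continuity of the limit then closes the gap.
\<close>

lemma weak_conv_scaled_cdf:
  assumes conv: "weak_conv_m N std_normal_distribution" and N: "\<And>n. real_distribution (N n)" and c: "c \<longlonglongrightarrow> (1::real)"
  shows "(\<lambda>n. cdf (N n) (c n * z)) \<longlonglongrightarrow> cdf std_normal_distribution z"
proof (rule LIMSEQ_I)
  let ?\<Phi> = "cdf std_normal_distribution"
  have pt: "(\<lambda>n. cdf (N n) x) \<longlonglongrightarrow> ?\<Phi> x" for x
    using conv isCont_cdf_std_normal by (simp add: weak_conv_m_def weak_conv_def)
  fix r :: real assume "0 < r"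
  obtain d where d: "0 < d" "\<And>x. \<bar>x - z\<bar> < d \<Longrightarrow> \<bar>?\<Phi> x - ?\<Phi> z\<bar> < r / 2"
    using isCont_cdf_std_normal[of z, unfolded continuous_at_eps_delta, rule_format, of "r / 2"] \<open>0 < r\<close>
    by (auto simp: dist_real_def)
  have cz: "(\<lambda>n. c n * z) \<longlonglongrightarrow> z" using tendsto_mult[OF c tendsto_const[of z]] by simp
  have "\<forall>\<^sub>F n in sequentially. \<bar>c n * z - z\<bar> < d / 2"
    using tendstoD[OF cz, of "d / 2"] d by (simp add: dist_real_def)
  moreover have "\<forall>\<^sub>F n in sequentially. \<bar>cdf (N n) (z - d / 2) - ?\<Phi> (z - d / 2)\<bar> < r / 2"
    using tendstoD[OF pt[of "z - d / 2"], of "r / 2"] \<open>0 < r\<close> by (simp add: dist_real_def)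
  moreover have "\<forall>\<^sub>F n in sequentially. \<bar>cdf (N n) (z + d / 2) - ?\<Phi> (z + d / 2)\<bar> < r / 2"
    using tendstoD[OF pt[of "z + d / 2"], of "r / 2"] \<open>0 < r\<close> by (simp add: dist_real_def)
  ultimately have "\<forall>\<^sub>F n in sequentially. norm (cdf (N n) (c n * z) - ?\<Phi> z) < r"
  proof eventually_elim
    case (elim n)
    interpret real_distribution "N n" by (rule N)
    have "cdf (N n) (z - d / 2) \<le> cdf (N n) (c n * z)" "cdf (N n) (c n * z) \<le> cdf (N n) (z + d / 2)"
      by (rule cdf_nondecreasing, use elim(1) in linarith)+
    moreover have "\<bar>?\<Phi> (z - d / 2) - ?\<Phi> z\<bar> < r / 2" "\<bar>?\<Phi> (z + d / 2) - ?\<Phi> z\<bar> < r / 2"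
      using d by (auto intro!: d(2))
    ultimately show ?case using elim(2,3) unfolding real_norm_def by linarith
  qed
  then show "\<exists>n0. \<forall>n\<ge>n0. norm (cdf (N n) (c n * z) - ?\<Phi> z) < r" by (simp add: eventually_sequentially)
qed

section \<open>Truncated means and convergence in probability\<close>

text \<open>
\<open>E min(1, Z)\<close> tends to 0 exactly when \<open>Z\<close> tends to 0 in probability.  It serves as the measure of
smallness throughout because errors can be added without keeping track of thresholds.
\<close>

definition trunc_mean :: "'a measure \<Rightarrow> ('a \<Rightarrow> ennreal) \<Rightarrow> real" where
  "trunc_mean M Z = enn2real (\<integral>\<^sup>+ \<omega>. min 1 (Z \<omega>) \<partial>M)"

context prob_space
begin

lemma ennreal_trunc_mean: "ennreal (trunc_mean M Z) = (\<integral>\<^sup>+ \<omega>. min 1 (Z \<omega>) \<partial>M)"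
proof -
  have "(\<integral>\<^sup>+ \<omega>. min 1 (Z \<omega>) \<partial>M) \<le> (\<integral>\<^sup>+ \<omega>. 1 \<partial>M)"
    by (intro nn_integral_mono) auto
  also have "\<dots> = 1" by (simp add: emeasure_space_1)
  finally have "(\<integral>\<^sup>+ \<omega>. min 1 (Z \<omega>) \<partial>M) < \<top>"
    by (rule order.strict_trans1) simp
  then show ?thesis by (simp add: trunc_mean_def)
qed

lemma trunc_mean_nonneg: "0 \<le> trunc_mean M Z"
  by (simp add: trunc_mean_def)

lemma trunc_mean_mono:
  assumes "\<And>\<omega>. \<omega> \<in> space M \<Longrightarrow> Z \<omega> \<le> Z' \<omega>"
  shows "trunc_mean M Z \<le> trunc_mean M Z'"
proof -
  have "ennreal (trunc_mean M Z) \<le> ennreal (trunc_mean M Z')"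
    unfolding ennreal_trunc_mean using assms by (intro nn_integral_mono min.mono) auto
  then show ?thesis by (simp add: trunc_mean_nonneg)
qed

lemma trunc_mean_cong:
  "(\<And>\<omega>. \<omega> \<in> space M \<Longrightarrow> Z \<omega> = Z' \<omega>) \<Longrightarrow> trunc_mean M Z = trunc_mean M Z'"
  by (intro antisym trunc_mean_mono) auto

text \<open>
The factor 2 fits squared errors, for which \<open>(a + b)\<^sup>2 \<le> 2 a\<^sup>2 + 2 b\<^sup>2\<close>.
\<close>

lemma trunc_mean_quasi_add:
  assumes [measurable]: "A \<in> borel_measurable M" "B \<in> borel_measurable M"
    and Z: "\<And>\<omega>. \<omega> \<in> space M \<Longrightarrow> Z \<omega> \<le> 2 * A \<omega> + 2 * B \<omega>"
  shows "trunc_mean M Z \<le> 2 * trunc_mean M A + 2 * trunc_mean M B"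
proof -
  have le: "min 1 z \<le> 2 * min 1 a + 2 * min 1 b" if "z \<le> 2 * a + 2 * b" for a b z :: ennreal
  proof (cases "1 \<le> a \<or> 1 \<le> b")
    case True
    then have "1 \<le> min 1 a + min 1 b"
      by (auto simp: min_absorb1 intro: add_increasing add_increasing2)
    also have "\<dots> \<le> 2 * min 1 a + 2 * min 1 b"
      by (intro add_mono) (auto simp: mult_2 intro: add_increasing)
    finally show ?thesis by (rule min.coboundedI1)
  next
    case False
    then have "min 1 a = a" "min 1 b = b" by (auto intro!: min.absorb2)
    then show ?thesis using that by (simp add: min.coboundedI2)
  qed
  have "ennreal (trunc_mean M Z) \<le> (\<integral>\<^sup>+ \<omega>. 2 * min 1 (A \<omega>) + 2 * min 1 (B \<omega>) \<partial>M)"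
    unfolding ennreal_trunc_mean by (intro nn_integral_mono le Z)
  also have "\<dots> = 2 * ennreal (trunc_mean M A) + 2 * ennreal (trunc_mean M B)"
    unfolding ennreal_trunc_mean by (simp add: nn_integral_add nn_integral_cmult)
  also have "\<dots> = ennreal (2 * trunc_mean M A + 2 * trunc_mean M B)"
    by (simp add: ennreal_plus ennreal_mult trunc_mean_nonneg)
  finally show ?thesis
    by (subst (asm) ennreal_le_iff) (auto simp: trunc_mean_nonneg)
qed

lemma trunc_mean_cmult:
  assumes [measurable]: "Z \<in> borel_measurable M" and "1 \<le> c"
  shows "trunc_mean M (\<lambda>\<omega>. ennreal c * Z \<omega>) \<le> c * trunc_mean M Z"
proof -
  have le: "min 1 (ennreal c * z) \<le> ennreal c * min 1 z" for z
  proof (cases "z \<le> 1")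
    case True
    then show ?thesis by (simp add: min.absorb2)
  next
    case False
    then show ?thesis using \<open>1 \<le> c\<close> by (simp add: min.absorb1 min.coboundedI1)
  qed
  have "ennreal (trunc_mean M (\<lambda>\<omega>. ennreal c * Z \<omega>)) \<le> (\<integral>\<^sup>+ \<omega>. ennreal c * min 1 (Z \<omega>) \<partial>M)"
    unfolding ennreal_trunc_mean by (intro nn_integral_mono le)
  also have "\<dots> = ennreal (c * trunc_mean M Z)"
    using \<open>1 \<le> c\<close> by (simp add: nn_integral_cmult ennreal_trunc_mean ennreal_mult')
  finally show ?thesis
    by (subst (asm) ennreal_le_iff) (use \<open>1 \<le> c\<close> in \<open>auto simp: trunc_mean_nonneg\<close>)
qed

lemma trunc_mean_eq_expectation:
  assumes [measurable]: "f \<in> borel_measurable M" and "\<And>\<omega>. \<omega> \<in> space M \<Longrightarrow> 0 \<le> f \<omega>"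
  shows "trunc_mean M (\<lambda>\<omega>. ennreal (f \<omega>)) = expectation (\<lambda>\<omega>. min 1 (f \<omega>))"
proof -
  have "(\<integral>\<^sup>+ \<omega>. min 1 (ennreal (f \<omega>)) \<partial>M) = (\<integral>\<^sup>+ \<omega>. ennreal (min 1 (f \<omega>)) \<partial>M)"
    using assms(2) by (intro nn_integral_cong) (auto simp: min_def)
  also have "\<dots> = ennreal (expectation (\<lambda>\<omega>. min 1 (f \<omega>)))"
    by (intro nn_integral_eq_integral integrable_const_bound[where B=1]) (use assms(2) in auto)
  finally show ?thesis
    using assms(2) by (auto simp: trunc_mean_def intro!: enn2real_ennreal integral_nonneg_AE)
qed

lemma trunc_mean_markov:
  assumes [measurable]: "Z \<in> borel_measurable M" and "0 < e"
  shows "min 1 e * prob {\<omega>\<in>space M. Z \<omega> > ennreal e} \<le> trunc_mean M Z"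
proof -
  have ennreal_min: "ennreal (min 1 e) = min 1 (ennreal e)"
    using \<open>0 < e\<close> by (simp add: min_def)
  have "ennreal (min 1 e * prob {\<omega>\<in>space M. Z \<omega> > ennreal e})
      = (\<integral>\<^sup>+ \<omega>. ennreal (min 1 e) * indicator {\<omega>\<in>space M. Z \<omega> > ennreal e} \<omega> \<partial>M)"
    using \<open>0 < e\<close> by (simp add: nn_integral_cmult_indicator emeasure_eq_measure ennreal_mult'')
  also have "\<dots> \<le> ennreal (trunc_mean M Z)"
    unfolding ennreal_trunc_mean
    by (intro nn_integral_mono) (auto simp: indicator_def ennreal_min min.coboundedI2)
  finally show ?thesis by (simp add: trunc_mean_nonneg)
qed

lemma trunc_mean_le_prob:
  assumes [measurable]: "Z \<in> borel_measurable M" and "0 \<le> e"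
  shows "trunc_mean M Z \<le> e + prob {\<omega>\<in>space M. Z \<omega> > ennreal e}"
proof -
  have "ennreal (trunc_mean M Z) \<le> (\<integral>\<^sup>+ \<omega>. ennreal e + indicator {\<omega>\<in>space M. Z \<omega> > ennreal e} \<omega> \<partial>M)"
    unfolding ennreal_trunc_mean
    by (intro nn_integral_mono) (auto simp: indicator_def min.coboundedI1 min.coboundedI2)
  also have "\<dots> = ennreal (e + prob {\<omega>\<in>space M. Z \<omega> > ennreal e})"
    using \<open>0 \<le> e\<close> by (simp add: nn_integral_add emeasure_eq_measure prob_space ennreal_plus)
  finally show ?thesis using \<open>0 \<le> e\<close> by (subst (asm) ennreal_le_iff) auto
qed

lemma null_in_prob_iff_trunc_mean:
  "null_in_prob M Z \<longleftrightarrow> (\<forall>k. Z k \<in> borel_measurable M) \<and> (\<lambda>k. trunc_mean M (Z k)) \<longlonglongrightarrow> 0"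
proof (intro iffI conjI; (elim conjE)?)
  assume Z: "null_in_prob M Z"
  then show meas: "\<forall>k. Z k \<in> borel_measurable M" by (simp add: null_in_prob_def)
  show "(\<lambda>k. trunc_mean M (Z k)) \<longlonglongrightarrow> 0"
  proof (rule LIMSEQ_I)
    fix r :: real assume "0 < r"
    then have "(\<lambda>k. prob {\<omega>\<in>space M. Z k \<omega> > ennreal (r / 2)}) \<longlonglongrightarrow> 0"
      using Z by (simp add: null_in_prob_def)
    from LIMSEQ_D[OF this, of "r / 2"] \<open>0 < r\<close> obtain N where
      N: "\<And>k. k \<ge> N \<Longrightarrow> prob {\<omega>\<in>space M. Z k \<omega> > ennreal (r / 2)} < r / 2" by auto
    have "norm (trunc_mean M (Z k) - 0) < r" if "k \<ge> N" for k
      using trunc_mean_le_prob[of "Z k" "r / 2"] meas N[OF that] \<open>0 < r\<close> trunc_mean_nonneg[of "Z k"] by auto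
    then show "\<exists>N. \<forall>k\<ge>N. norm (trunc_mean M (Z k) - 0) < r" by blast
  qed
next
  assume Z: "\<forall>k. Z k \<in> borel_measurable M" and lim: "(\<lambda>k. trunc_mean M (Z k)) \<longlonglongrightarrow> 0"
  have "(\<lambda>k. prob {\<omega>\<in>space M. Z k \<omega> > ennreal e}) \<longlonglongrightarrow> 0" if "0 < e" for e
  proof (rule tendsto_sandwich[OF _ _ tendsto_const])
    show "(\<lambda>k. trunc_mean M (Z k) / min 1 e) \<longlonglongrightarrow> 0"
      using tendsto_divide[OF lim tendsto_const[of "min 1 e"]] that by (auto simp: min_def)
    show "\<forall>\<^sub>F k in sequentially. prob {\<omega>\<in>space M. Z k \<omega> > ennreal e} \<le> trunc_mean M (Z k) / min 1 e"
      using trunc_mean_markov[of "Z _" e] Z that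
      by (intro always_eventually allI) (simp add: field_simps)
  qed auto
  with Z show "null_in_prob M Z" by (simp add: null_in_prob_def)
qed

lemma trunc_mean_square_le_abs:
  "trunc_mean M (\<lambda>\<omega>. ennreal ((J \<omega>)\<^sup>2)) \<le> trunc_mean M (\<lambda>\<omega>. ennreal \<bar>J \<omega>\<bar>)"
proof -
  have "min 1 (ennreal (x\<^sup>2)) \<le> min 1 (ennreal \<bar>x\<bar>)" for x :: real
  proof (cases "\<bar>x\<bar> \<le> 1")
    case True
    then have "x\<^sup>2 \<le> \<bar>x\<bar>" using mult_left_le[of "\<bar>x\<bar>" "\<bar>x\<bar>"] by (simp add: power2_eq_square)
    then show ?thesis by (intro min.mono ennreal_leI) auto
  next
    case False
    then show ?thesis by (simp add: min.absorb1)
  qed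
  then have "ennreal (trunc_mean M (\<lambda>\<omega>. ennreal ((J \<omega>)\<^sup>2))) \<le> ennreal (trunc_mean M (\<lambda>\<omega>. ennreal \<bar>J \<omega>\<bar>))"
    unfolding ennreal_trunc_mean by (intro nn_integral_mono)
  then show ?thesis by (simp add: trunc_mean_nonneg)
qed

lemma trunc_mean_AE_limit:
  assumes [measurable]: "\<And>k. Z k \<in> borel_measurable M" and nn: "\<And>k \<omega>. \<omega> \<in> space M \<Longrightarrow> 0 \<le> Z k \<omega>"
    and lim: "AE \<omega> in M. (\<lambda>k. Z k \<omega>) \<longlonglongrightarrow> 0"
  shows "(\<lambda>k. trunc_mean M (\<lambda>\<omega>. ennreal (Z k \<omega>))) \<longlonglongrightarrow> 0"
proof -
  have "(\<lambda>k. expectation (\<lambda>\<omega>. min 1 (Z k \<omega>))) \<longlonglongrightarrow> expectation (\<lambda>\<omega>. 0)"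
  proof (rule integral_dominated_convergence[where w="\<lambda>_. 1"])
    show "AE \<omega> in M. (\<lambda>k. min 1 (Z k \<omega>)) \<longlonglongrightarrow> 0"
      using lim
    proof eventually_elim
      case (elim \<omega>)
      then have "(\<lambda>k. min 1 (Z k \<omega>)) \<longlonglongrightarrow> min 1 0" by (intro tendsto_intros)
      then show ?case by simp
    qed
    show "AE \<omega> in M. norm (min 1 (Z k \<omega>)) \<le> 1" for k using nn by auto
  qed auto
  moreover have "trunc_mean M (\<lambda>\<omega>. ennreal (Z k \<omega>)) = expectation (\<lambda>\<omega>. min 1 (Z k \<omega>))" for k
    by (rule trunc_mean_eq_expectation) (use nn in auto)
  ultimately show ?thesis by simp
qed

end

section \<open>Elementary integrals\<close>

text \<open>
Pairs of an adapted step integrand and its integral against \<open>Y\<close>.  The terms need not be ordered in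
time, so that closure under sums, multiples and restriction to later times is immediate; a common
ordered partition is chosen only where the orthogonality of increments is used
(\<open>elementary_integral_obtain_simple\<close>).
\<close>

inductive elementary_integral :: "(real \<Rightarrow> 'a measure) \<Rightarrow> real \<Rightarrow> (real \<Rightarrow> 'a \<Rightarrow> real) \<Rightarrow>
    (real \<Rightarrow> 'a \<Rightarrow> real) \<Rightarrow> ('a \<Rightarrow> real) \<Rightarrow> bool"
  for F :: "real \<Rightarrow> 'a measure" and T Y where
  zero: "elementary_integral F T Y (\<lambda>_ _. 0) (\<lambda>_. 0)"
| step: "0 \<le> s \<Longrightarrow> s \<le> t \<Longrightarrow> t \<le> T \<Longrightarrow> \<xi> \<in> borel_measurable (F s) \<Longrightarrow>
    (\<And>\<omega>. \<omega> \<in> space (F s) \<Longrightarrow> \<bar>\<xi> \<omega>\<bar> \<le> B) \<Longrightarrow>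
    elementary_integral F T Y (\<lambda>u \<omega>. \<xi> \<omega> * indicator {s<..t} u) (\<lambda>\<omega>. \<xi> \<omega> * (Y t \<omega> - Y s \<omega>))"
| add: "elementary_integral F T Y H J \<Longrightarrow> elementary_integral F T Y H' J' \<Longrightarrow>
    elementary_integral F T Y (\<lambda>u \<omega>. H u \<omega> + H' u \<omega>) (\<lambda>\<omega>. J \<omega> + J' \<omega>)"

lemma elementary_integral_sum:
  assumes "finite I" "\<And>i. i \<in> I \<Longrightarrow> elementary_integral F T Y (H i) (J i)"
  shows "elementary_integral F T Y (\<lambda>u \<omega>. \<Sum>i\<in>I. H i u \<omega>) (\<lambda>\<omega>. \<Sum>i\<in>I. J i \<omega>)"
  using assms
proof (induction I rule: finite_induct)
  case (insert i I)
  then show ?case using elementary_integral.add[of F T Y "H i" "J i"] by simp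
qed (simp add: elementary_integral.zero)

lemma simple_integrandD:
  assumes "simple_integrand G T n \<tau> \<xi>"
  shows "i \<le> j \<Longrightarrow> j \<le> n \<Longrightarrow> \<tau> i \<le> \<tau> j" "i \<le> n \<Longrightarrow> 0 \<le> \<tau> i" "i \<le> n \<Longrightarrow> \<tau> i \<le> T"
    "i < n \<Longrightarrow> \<xi> i \<in> borel_measurable (G (\<tau> i))"
    "i < n \<Longrightarrow> \<exists>B. \<forall>\<omega>\<in>space (G (\<tau> i)). \<bar>\<xi> i \<omega>\<bar> \<le> B"
proof -
  show mono: "\<tau> i \<le> \<tau> j" if "i \<le> j" "j \<le> n" for i j
    using that(1) that assms
    by (induction rule: dec_induct) (auto simp: simple_integrand_def intro: order_trans dest: Suc_le_lessD)
  show "i \<le> n \<Longrightarrow> 0 \<le> \<tau> i" "i \<le> n \<Longrightarrow> \<tau> i \<le> T"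
    using mono[of 0 i] mono[of i n] assms by (auto simp: simple_integrand_def)
  show "i < n \<Longrightarrow> \<xi> i \<in> borel_measurable (G (\<tau> i))" "i < n \<Longrightarrow> \<exists>B. \<forall>\<omega>\<in>space (G (\<tau> i)). \<bar>\<xi> i \<omega>\<bar> \<le> B"
    using assms by (auto simp: simple_integrand_def)
qed

lemma filtration_measurable_mono:
  assumes F: "filtration \<Omega> F" and "s \<le> t" and f: "f \<in> borel_measurable (F s)"
  shows "f \<in> borel_measurable (F t)"
  using f filtration.sets_F_mono[OF F \<open>s \<le> t\<close>] filtration.space_F[OF F]
  by (auto intro: measurable_mono[THEN subsetD, of borel borel "F s" "F t"])

lemma elementary_integral_simple:
  assumes "simple_integrand F T n \<tau> \<xi>"
  shows "elementary_integral F T Y (simple_process n \<tau> \<xi>) (simple_integral Y n \<tau> \<xi>)"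
proof -
  have "elementary_integral F T Y (\<lambda>u \<omega>. \<xi> i \<omega> * indicator {\<tau> i<..\<tau> (Suc i)} u) (\<lambda>\<omega>. \<xi> i \<omega> * (Y (\<tau> (Suc i)) \<omega> - Y (\<tau> i) \<omega>))"
    if "i < n" for i
  proof -
    from assms that obtain B where "\<xi> i \<in> borel_measurable (F (\<tau> i))" "\<forall>\<omega>\<in>space (F (\<tau> i)). \<bar>\<xi> i \<omega>\<bar> \<le> B"
      by (auto simp: simple_integrand_def)
    moreover have "0 \<le> \<tau> i" "\<tau> (Suc i) \<le> T" "\<tau> i \<le> \<tau> (Suc i)"
      using simple_integrandD(1-3)[OF assms] that by auto
    ultimately show ?thesis by (intro elementary_integral.step) auto
  qed
  then show ?thesis
    unfolding simple_process_def[abs_def] simple_integral_def[abs_def]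
    by (intro elementary_integral_sum) auto
qed

definition grid :: "real \<Rightarrow> nat \<Rightarrow> (nat \<Rightarrow> real) \<Rightarrow> bool" where
  "grid T n p \<longleftrightarrow> strict_mono_on {..n} p \<and> p ` {..n} \<subseteq> {0..T}"

text \<open>
With \<open>g = (\<lambda>u. Y u \<omega>)\<close> this refines an integral, with \<open>g = (\<lambda>x. indicator {..x} u)\<close> an integrand:
passing to a finer grid is the same telescoping sum in both cases.
\<close>

lemma sum_grid_telescope:
  fixes g :: "real \<Rightarrow> real"
  assumes p: "grid T n p" and ab: "a \<le> b" "b \<le> n"
  shows "(\<Sum>l<n. indicator {p a<..p b} (p (Suc l)) * (g (p (Suc l)) - g (p l))) = g (p b) - g (p a)"
proof -
  have lt: "p i < p j \<longleftrightarrow> i < j" if "i \<le> n" "j \<le> n" for i j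
    using p that by (auto simp: grid_def strict_mono_on_less)
  have le: "p i \<le> p j \<longleftrightarrow> i \<le> j" if "i \<le> n" "j \<le> n" for i j
    using p that by (auto simp: grid_def strict_mono_on_less_eq)
  have "(\<Sum>l<n. indicator {p a<..p b} (p (Suc l)) * (g (p (Suc l)) - g (p l)))
      = (\<Sum>l<n. if l \<in> {a..<b} then g (p (Suc l)) - g (p l) else 0)"
    by (rule sum.cong) (use ab lt le in \<open>auto simp: indicator_def\<close>)
  also have "\<dots> = (\<Sum>l=a..<b. g (p (Suc l)) - g (p l))"
    using ab by (subst sum.inter_restrict[symmetric]) (auto intro!: sum.cong)
  also have "\<dots> = g (p b) - g (p a)"
    by (rule sum_Suc_diff') (use ab in auto)
  finally show ?thesis .
qed

lemma simple_integrand_grid: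
  assumes "grid T n p"
    and "\<And>l. l < n \<Longrightarrow> \<xi> l \<in> borel_measurable (F (p l)) \<and> (\<exists>B. \<forall>\<omega>\<in>space (F (p l)). \<bar>\<xi> l \<omega>\<bar> \<le> B)"
  shows "simple_integrand F T n p \<xi>"
proof -
  have "p l \<le> p (Suc l)" if "l < n" for l
    using assms(1) that by (auto simp: grid_def strict_mono_on_less_eq)
  then show ?thesis using assms unfolding simple_integrand_def by (auto simp: grid_def image_subset_iff)
qed

text \<open>
On a grid that contains all its jump times an elementary integrand is constant on each cell
\<open>]p l, p (l+1)]\<close>.  Its value there is read off at the right end point, yet is known at the left
one, because no jump time lies strictly inside the cell.
\<close>

lemma elementary_integral_refine:
  assumes F: "filtration \<Omega> F" and "elementary_integral F T Y H J"
  shows "\<exists>P. finite P \<and> P \<subseteq> {0..T} \<and> (\<forall>n p. grid T n p \<longrightarrow> P \<subseteq> p ` {..n} \<longrightarrow>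
     simple_integrand F T n p (\<lambda>l. H (p (Suc l))) \<and>
     H = simple_process n p (\<lambda>l. H (p (Suc l))) \<and> J = simple_integral Y n p (\<lambda>l. H (p (Suc l))))"
  (is "\<exists>P. finite P \<and> P \<subseteq> {0..T} \<and> ?Q P H J")
  using assms(2)
proof induction
  case zero
  have "?Q {} (\<lambda>_ _. 0) (\<lambda>_. 0)"
    by (auto simp: simple_process_def[abs_def] simple_integral_def[abs_def] intro!: simple_integrand_grid exI[of _ 0])
  then show ?case by blast
next
  case (step s t \<xi> B)
  let ?H = "\<lambda>u \<omega>. \<xi> \<omega> * indicator {s<..t} u"
  have "?Q {s, t} ?H (\<lambda>\<omega>. \<xi> \<omega> * (Y t \<omega> - Y s \<omega>))"
  proof (intro allI impI)
    fix n p assume p: "grid T n p" and "{s, t} \<subseteq> p ` {..n}"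
    then obtain a b where ab: "a \<le> n" "b \<le> n" "s = p a" "t = p b" by auto
    have lt: "p i < p j \<longleftrightarrow> i < j" if "i \<le> n" "j \<le> n" for i j
      using p that by (auto simp: grid_def strict_mono_on_less)
    have le: "p i \<le> p j \<longleftrightarrow> i \<le> j" if "i \<le> n" "j \<le> n" for i j
      using p that by (auto simp: grid_def strict_mono_on_less_eq)
    have "a \<le> b" using ab step le by auto
    note tele = sum_grid_telescope[OF p \<open>a \<le> b\<close> \<open>b \<le> n\<close>]
    have ind: "indicator {x<..y} u = indicator {..y} u - (indicator {..x} u :: real)" if "x \<le> y" for x y u :: real
      using that by (auto simp: indicator_def)
    have H: "?H u \<omega> = (\<Sum>l<n. ?H (p (Suc l)) \<omega> * indicator {p l<..p (Suc l)} u)" for u \<omega>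
    proof -
      have "(\<Sum>l<n. ?H (p (Suc l)) \<omega> * indicator {p l<..p (Suc l)} u)
          = \<xi> \<omega> * (\<Sum>l<n. indicator {p a<..p b} (p (Suc l)) * (indicator {..p (Suc l)} u - indicator {..p l} u))"
        unfolding sum_distrib_left
        by (intro sum.cong) (auto simp: ind le ab mult.assoc)
      then show ?thesis using tele[of "\<lambda>x. indicator {..x} u"] \<open>a \<le> b\<close> ab by (simp add: ind le)
    qed
    have J: "\<xi> \<omega> * (Y t \<omega> - Y s \<omega>) = (\<Sum>l<n. ?H (p (Suc l)) \<omega> * (Y (p (Suc l)) \<omega> - Y (p l) \<omega>))" for \<omega>
      using tele[of "\<lambda>x. Y x \<omega>"] ab by (simp add: sum_distrib_left[symmetric] mult.assoc)
    have \<xi>: "?H (p (Suc l)) \<in> borel_measurable (F (p l)) \<and> (\<exists>B. \<forall>\<omega>\<in>space (F (p l)). \<bar>?H (p (Suc l)) \<omega>\<bar> \<le> B)"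
      if "l < n" for l
    proof (cases "a \<le> l")
      case True
      then have "\<xi> \<in> borel_measurable (F (p l))"
        using ab that le by (intro filtration_measurable_mono[OF F _ step(4)]) auto
      moreover have "\<forall>\<omega>\<in>space (F (p l)). \<bar>?H (p (Suc l)) \<omega>\<bar> \<le> \<bar>B\<bar>"
        using step(5) filtration.space_F[OF F] by (fastforce simp: indicator_def)
      ultimately show ?thesis by auto
    next
      case False
      then have "p (Suc l) \<le> s" using that ab le by auto
      then have z: "indicator {s<..t} (p (Suc l)) = (0::real)" by auto
      show ?thesis unfolding z by (auto intro!: exI[of _ 0])
    qed
    show "simple_integrand F T n p (\<lambda>l. ?H (p (Suc l))) \<and> ?H = simple_process n p (\<lambda>l. ?H (p (Suc l))) \<and>
        (\<lambda>\<omega>. \<xi> \<omega> * (Y t \<omega> - Y s \<omega>)) = simple_integral Y n p (\<lambda>l. ?H (p (Suc l)))"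
      unfolding simple_process_def[abs_def] simple_integral_def[abs_def]
      using simple_integrand_grid[where F=F and \<xi>="\<lambda>l. ?H (p (Suc l))", OF p \<xi>] by (intro conjI ext H J)
  qed
  moreover have "finite {s, t}" "{s, t} \<subseteq> {0..T}" using step by auto
  ultimately show ?case by blast
next
  case (add H J H' J')
  from add.IH(1) obtain P where P: "finite P" "P \<subseteq> {0..T}" "?Q P H J"
    by (elim exE conjE)
  from add.IH(2) obtain P' where P': "finite P'" "P' \<subseteq> {0..T}" "?Q P' H' J'"
    by (elim exE conjE)
  have "?Q (P \<union> P') (\<lambda>u \<omega>. H u \<omega> + H' u \<omega>) (\<lambda>\<omega>. J \<omega> + J' \<omega>)"
  proof (intro allI impI conjI)
    fix n p assume p: "grid T n p" "P \<union> P' \<subseteq> p ` {..n}"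
    let ?\<xi> = "\<lambda>l. H (p (Suc l))" and ?\<xi>' = "\<lambda>l. H' (p (Suc l))"
    from p(2) have sub: "P \<subseteq> p ` {..n}" "P' \<subseteq> p ` {..n}" by auto
    note R = P(3)[rule_format, OF p(1) sub(1)]
    note Q = R[THEN conjunct1] R[THEN conjunct2, THEN conjunct1] R[THEN conjunct2, THEN conjunct2]
    note R' = P'(3)[rule_format, OF p(1) sub(2)]
    note Q' = R'[THEN conjunct1] R'[THEN conjunct2, THEN conjunct1] R'[THEN conjunct2, THEN conjunct2]
    have "simple_process n p (\<lambda>l \<omega>. ?\<xi> l \<omega> + ?\<xi>' l \<omega>) = (\<lambda>u \<omega>. simple_process n p ?\<xi> u \<omega> + simple_process n p ?\<xi>' u \<omega>)"
      by (simp add: simple_process_def[abs_def] distrib_right sum.distrib)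
    then show "(\<lambda>u \<omega>. H u \<omega> + H' u \<omega>) = simple_process n p (\<lambda>l \<omega>. ?\<xi> l \<omega> + ?\<xi>' l \<omega>)"
      by (simp only: Q(2)[symmetric] Q'(2)[symmetric])
    have "simple_integral Y n p (\<lambda>l \<omega>. ?\<xi> l \<omega> + ?\<xi>' l \<omega>) = (\<lambda>\<omega>. simple_integral Y n p ?\<xi> \<omega> + simple_integral Y n p ?\<xi>' \<omega>)"
      by (simp add: simple_integral_def[abs_def] distrib_right sum.distrib)
    then show "(\<lambda>\<omega>. J \<omega> + J' \<omega>) = simple_integral Y n p (\<lambda>l \<omega>. ?\<xi> l \<omega> + ?\<xi>' l \<omega>)"
      by (simp only: Q(3)[symmetric] Q'(3)[symmetric])
    show "simple_integrand F T n p (\<lambda>l \<omega>. ?\<xi> l \<omega> + ?\<xi>' l \<omega>)"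
    proof (rule simple_integrand_grid[OF p(1)])
      fix l assume l: "l < n"
      obtain B B' where B: "\<forall>\<omega>\<in>space (F (p l)). \<bar>?\<xi> l \<omega>\<bar> \<le> B" "\<forall>\<omega>\<in>space (F (p l)). \<bar>?\<xi>' l \<omega>\<bar> \<le> B'"
        using simple_integrandD(5)[OF Q(1) l] simple_integrandD(5)[OF Q'(1) l] by blast
      have "\<forall>\<omega>\<in>space (F (p l)). \<bar>?\<xi> l \<omega> + ?\<xi>' l \<omega>\<bar> \<le> B + B'"
        using B by (meson abs_triangle_ineq add_mono order_trans)
      then show "(\<lambda>\<omega>. ?\<xi> l \<omega> + ?\<xi>' l \<omega>) \<in> borel_measurable (F (p l)) \<and>
          (\<exists>B. \<forall>\<omega>\<in>space (F (p l)). \<bar>?\<xi> l \<omega> + ?\<xi>' l \<omega>\<bar> \<le> B)"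
        using simple_integrandD(4)[OF Q(1) l] simple_integrandD(4)[OF Q'(1) l] by (intro conjI borel_measurable_add exI)
    qed
  qed
  moreover have "finite (P \<union> P')" "P \<union> P' \<subseteq> {0..T}" using P(1,2) P'(1,2) by auto
  ultimately show ?case by (intro exI[of _ "P \<union> P'"] conjI)
qed

lemma elementary_integral_obtain_simple:
  assumes F: "filtration \<Omega> F" and "0 \<le> T" "elementary_integral F T Y H J"
  obtains n \<tau> \<xi> where "simple_integrand F T n \<tau> \<xi>" "H = simple_process n \<tau> \<xi>" "J = simple_integral Y n \<tau> \<xi>"
proof -
  from elementary_integral_refine[OF F assms(3)] obtain P where P: "finite P" "P \<subseteq> {0..T}" and
    Q: "\<forall>n p. grid T n p \<longrightarrow> P \<subseteq> p ` {..n} \<longrightarrow> simple_integrand F T n p (\<lambda>l. H (p (Suc l))) \<and>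
     H = simple_process n p (\<lambda>l. H (p (Suc l))) \<and> J = simple_integral Y n p (\<lambda>l. H (p (Suc l)))"
    by (elim exE conjE)
  define xs where "xs = sorted_list_of_set (insert 0 P)"
  define n where "n = length xs - 1"
  have xs: "set xs = insert 0 P" "sorted_wrt (<) xs" using P
    by (simp_all only: xs_def set_sorted_list_of_set strict_sorted_list_of_set finite_insert)
  then have "xs \<noteq> []" by auto
  then have len: "length xs = Suc n" by (cases xs) (auto simp: n_def)
  have im: "(!) xs ` {..n} = insert 0 P"
    using xs(1) len by (auto simp: set_conv_nth less_Suc_eq_le image_iff)
  have g: "grid T n ((!) xs)"
    unfolding grid_def im using P \<open>0 \<le> T\<close> xs(2) len
    by (auto intro!: strict_mono_onI sorted_wrt_nth_less[of "(<)" xs])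
  show thesis
  proof (rule that)
    note R = Q[rule_format, OF g, unfolded im, OF subset_insertI]
    show "simple_integrand F T n ((!) xs) (\<lambda>l. H (xs ! Suc l))" by (rule R[THEN conjunct1])
    show "H = simple_process n ((!) xs) (\<lambda>l. H (xs ! Suc l))" by (rule R[THEN conjunct2, THEN conjunct1])
    show "J = simple_integral Y n ((!) xs) (\<lambda>l. H (xs ! Suc l))" by (rule R[THEN conjunct2, THEN conjunct2])
  qed
qed

lemma elementary_integral_cmult:
  assumes "elementary_integral F T Y H J"
  shows "elementary_integral F T Y (\<lambda>u \<omega>. c * H u \<omega>) (\<lambda>\<omega>. c * J \<omega>)"
  using assms
proof induction
  case zero
  then show ?case using elementary_integral.zero by simp
next
  case (step s t \<xi> B)
  have "elementary_integral F T Y (\<lambda>u \<omega>. (c * \<xi> \<omega>) * indicator {s<..t} u) (\<lambda>\<omega>. (c * \<xi> \<omega>) * (Y t \<omega> - Y s \<omega>))"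
    by (rule elementary_integral.step[where B="\<bar>c\<bar> * B"]) (use step in \<open>auto simp: abs_mult intro!: mult_left_mono\<close>)
  then show ?case by (simp add: mult.assoc)
next
  case (add H J H' J')
  then show ?case using elementary_integral.add by (simp add: distrib_left)
qed

lemma elementary_integral_diff:
  assumes "elementary_integral F T Y H J" "elementary_integral F T Y H' J'"
  shows "elementary_integral F T Y (\<lambda>u \<omega>. H u \<omega> - H' u \<omega>) (\<lambda>\<omega>. J \<omega> - J' \<omega>)"
  using elementary_integral.add[OF assms(1) elementary_integral_cmult[OF assms(2), of "-1"]] by simp

text \<open>
A term on \<open>]a, b]\<close> restricted to times after \<open>s\<close> is a term on \<open>]max a s, max b s]\<close>, which is empty
when \<open>b \<le> s\<close>; since it starts no earlier than \<open>s\<close>, a weight known at time \<open>s\<close> may be absorbed.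
\<close>

lemma elementary_integral_restrict_scale:
  assumes F: "filtration \<Omega> F" and "elementary_integral F T Y H J"
    and s: "0 \<le> s" "s \<le> T" and \<eta>: "\<eta> \<in> borel_measurable (F s)" "\<And>\<omega>. \<omega> \<in> \<Omega> \<Longrightarrow> \<bar>\<eta> \<omega>\<bar> \<le> B"
  shows "\<exists>J'. elementary_integral F T Y (\<lambda>u \<omega>. indicator {s<..} u * H u \<omega>) J' \<and>
      elementary_integral F T Y (\<lambda>u \<omega>. \<eta> \<omega> * (indicator {s<..} u * H u \<omega>)) (\<lambda>\<omega>. \<eta> \<omega> * J' \<omega>)"
  using assms(2)
proof induction
  case zero
  then show ?case using elementary_integral.zero by (intro exI[of _ "\<lambda>_. 0"]) simp
next
  case (step a b \<xi> C)
  have ind: "indicator {s<..} u * (x * indicator {a<..b} u) = x * (indicator {max a s<..max b s} u :: real)" for x u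
    using step(2) by (auto simp: indicator_def)
  note sp = filtration.space_F[OF F]
  have up: "f \<in> borel_measurable (F (max a s))" if "f \<in> borel_measurable (F r)" "r \<le> max a s" for f r
    by (rule filtration_measurable_mono[OF F that(2,1)])
  have "elementary_integral F T Y (\<lambda>u \<omega>. indicator {s<..} u * (\<xi> \<omega> * indicator {a<..b} u)) (\<lambda>\<omega>. \<xi> \<omega> * (Y (max b s) \<omega> - Y (max a s) \<omega>))"
    unfolding ind
    by (rule elementary_integral.step[where B=C]) (use step s sp in \<open>auto intro: up\<close>)
  moreover have "elementary_integral F T Y (\<lambda>u \<omega>. (\<eta> \<omega> * \<xi> \<omega>) * indicator {max a s<..max b s} u)
      (\<lambda>\<omega>. (\<eta> \<omega> * \<xi> \<omega>) * (Y (max b s) \<omega> - Y (max a s) \<omega>))"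
  proof (rule elementary_integral.step[where B="B * C"])
    show "(\<lambda>\<omega>. \<eta> \<omega> * \<xi> \<omega>) \<in> borel_measurable (F (max a s))"
      by (intro borel_measurable_times up[OF \<eta>(1)] up[OF step(4)]) auto
    show "\<bar>\<eta> \<omega> * \<xi> \<omega>\<bar> \<le> B * C" if "\<omega> \<in> space (F (max a s))" for \<omega>
      using that sp \<eta>(2)[of \<omega>] step(5)[of \<omega>] by (auto simp: abs_mult intro!: mult_mono')
  qed (use step s in auto)
  ultimately show ?case
    unfolding ind by (intro exI[of _ "\<lambda>\<omega>. \<xi> \<omega> * (Y (max b s) \<omega> - Y (max a s) \<omega>)"]) (simp add: mult.assoc)
next
  case (add H J H' J')
  then obtain K K' where
    K: "elementary_integral F T Y (\<lambda>u \<omega>. indicator {s<..} u * H u \<omega>) K"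
       "elementary_integral F T Y (\<lambda>u \<omega>. \<eta> \<omega> * (indicator {s<..} u * H u \<omega>)) (\<lambda>\<omega>. \<eta> \<omega> * K \<omega>)" and
    K': "elementary_integral F T Y (\<lambda>u \<omega>. indicator {s<..} u * H' u \<omega>) K'"
       "elementary_integral F T Y (\<lambda>u \<omega>. \<eta> \<omega> * (indicator {s<..} u * H' u \<omega>)) (\<lambda>\<omega>. \<eta> \<omega> * K' \<omega>)"
    by (elim exE conjE)
  show ?case
    using elementary_integral.add[OF K(1) K'(1)] elementary_integral.add[OF K(2) K'(2)]
    by (intro exI[of _ "\<lambda>\<omega>. K \<omega> + K' \<omega>"]) (simp add: distrib_left)
qed

section \<open>The Ito isometry and its localisation\<close>

text \<open>
The cells are disjoint, so no mixed products occur.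
\<close>

lemma simple_process_square:
  assumes "\<And>i. i < n \<Longrightarrow> \<tau> i \<le> \<tau> (Suc i)"
  shows "(simple_process n \<tau> \<xi> t \<omega>)\<^sup>2 = (\<Sum>i<n. (\<xi> i \<omega>)\<^sup>2 * indicator {\<tau> i<..\<tau> (Suc i)} t)"
    and "\<tau> n < t \<Longrightarrow> simple_process n \<tau> \<xi> t \<omega> = 0"
proof -
  have "(simple_process n \<tau> \<xi> t \<omega>)\<^sup>2 = (\<Sum>i<n. (\<xi> i \<omega>)\<^sup>2 * indicator {\<tau> i<..\<tau> (Suc i)} t) \<and>
      (\<tau> n < t \<longrightarrow> simple_process n \<tau> \<xi> t \<omega> = 0)"
    using assms
  proof (induction n)
    case (Suc n)
    then have IH: "(simple_process n \<tau> \<xi> t \<omega>)\<^sup>2 = (\<Sum>i<n. (\<xi> i \<omega>)\<^sup>2 * indicator {\<tau> i<..\<tau> (Suc i)} t)"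
      "\<tau> n < t \<Longrightarrow> simple_process n \<tau> \<xi> t \<omega> = 0" by auto
    have S: "simple_process (Suc n) \<tau> \<xi> t \<omega> = simple_process n \<tau> \<xi> t \<omega> + \<xi> n \<omega> * indicator {\<tau> n<..\<tau> (Suc n)} t"
      by (simp add: simple_process_def)
    show ?case
      using IH Suc.prems[of n] by (auto simp: S indicator_def power2_sum)
  qed (simp add: simple_process_def)
  then show "(simple_process n \<tau> \<xi> t \<omega>)\<^sup>2 = (\<Sum>i<n. (\<xi> i \<omega>)\<^sup>2 * indicator {\<tau> i<..\<tau> (Suc i)} t)"
    and "\<tau> n < t \<Longrightarrow> simple_process n \<tau> \<xi> t \<omega> = 0" by auto
qed

abbreviation energy :: "real \<Rightarrow> (real \<Rightarrow> real) \<Rightarrow> ennreal" where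
  "energy T h \<equiv> (\<integral>\<^sup>+ t. ennreal ((h t)\<^sup>2) \<partial>lebesgue_on {0..T})"

lemma nn_integral_simple_process_square:
  assumes "simple_integrand F T n \<tau> \<xi>"
  shows "energy T (\<lambda>t. simple_process n \<tau> \<xi> t \<omega>)
     = ennreal (\<Sum>i<n. (\<xi> i \<omega>)\<^sup>2 * (\<tau> (Suc i) - \<tau> i))"
proof -
  have sub: "{\<tau> i<..\<tau> (Suc i)} \<subseteq> {0..T}" "\<tau> i \<le> \<tau> (Suc i)" if "i < n" for i
    using simple_integrandD(1)[OF assms, of i "Suc i"] simple_integrandD(2)[OF assms, of i]
      simple_integrandD(3)[OF assms, of "Suc i"] that by auto
  have "energy T (\<lambda>t. simple_process n \<tau> \<xi> t \<omega>)
      = (\<integral>\<^sup>+ t. (\<Sum>i<n. ennreal ((\<xi> i \<omega>)\<^sup>2) * indicator {\<tau> i<..\<tau> (Suc i)} t) \<partial>lebesgue_on {0..T})"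
    using sub by (intro nn_integral_cong) (simp add: simple_process_square ennreal_mult'' ennreal_indicator flip: sum_ennreal)
  also have "\<dots> = (\<Sum>i<n. \<integral>\<^sup>+ t. ennreal ((\<xi> i \<omega>)\<^sup>2) * indicator {\<tau> i<..\<tau> (Suc i)} t \<partial>lebesgue_on {0..T})"
    by (rule nn_integral_sum)
      (use sub in \<open>auto intro!: borel_measurable_times_ennreal borel_measurable_indicator simp: sets_restrict_space_iff\<close>)
  also have "\<dots> = (\<Sum>i<n. ennreal ((\<xi> i \<omega>)\<^sup>2 * (\<tau> (Suc i) - \<tau> i)))"
    using sub by (intro sum.cong refl)
      (subst nn_integral_cmult_indicator; simp add: sets_restrict_space_iff emeasure_restrict_space ennreal_mult'')
  also have "\<dots> = ennreal (\<Sum>i<n. (\<xi> i \<omega>)\<^sup>2 * (\<tau> (Suc i) - \<tau> i))"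
    using sub by (intro sum_ennreal) (auto intro!: mult_nonneg_nonneg)
  finally show ?thesis .
qed

lemma integrable_mult_of_squares:
  fixes f g :: "'b \<Rightarrow> real"
  assumes [measurable]: "f \<in> borel_measurable N" "g \<in> borel_measurable N"
    and "integrable N (\<lambda>x. (f x)\<^sup>2)" "integrable N (\<lambda>x. (g x)\<^sup>2)"
  shows "integrable N (\<lambda>x. f x * g x)"
proof (rule Bochner_Integration.integrable_bound[OF Bochner_Integration.integrable_add[OF assms(3,4)]])
  have "norm (f x * g x) \<le> norm ((f x)\<^sup>2 + (g x)\<^sup>2)" for x
    using sum_squares_bound[of "f x" "g x"] sum_squares_bound[of "- f x" "g x"]
    by (auto simp: abs_le_iff)
  then show "AE x in N. norm (f x * g x) \<le> norm ((f x)\<^sup>2 + (g x)\<^sup>2)" by simp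
qed auto

locale wiener_space = 
  fixes M :: "'a measure" and F :: "real \<Rightarrow> 'a measure" and T :: real and W :: "real \<Rightarrow> 'a \<Rightarrow> real"
  assumes wiener: "wiener_process M F T W" and T_pos: "0 < T"
begin

sublocale prob_space M using wiener by (simp add: wiener_process_def)

lemma filtration_F: "filtration (space M) F"
  using wiener by (simp add: wiener_process_def)

lemma space_F [simp]: "space (F t) = space M"
  using filtration.space_F[OF filtration_F] .

lemma measurable_F_mono: "s \<le> t \<Longrightarrow> f \<in> borel_measurable (F s) \<Longrightarrow> f \<in> borel_measurable (F t)"
  by (rule filtration_measurable_mono[OF filtration_F])

lemma measurable_F_imp: "f \<in> borel_measurable (F s) \<Longrightarrow> f \<in> borel_measurable M"
  using wiener measurable_from_subalg unfolding wiener_process_def by blast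

lemma W_measurable_F: "0 \<le> s \<Longrightarrow> s \<le> t \<Longrightarrow> t \<le> T \<Longrightarrow> W s \<in> borel_measurable (F t)"
  using wiener measurable_F_mono[of s t "W s"] by (auto simp: wiener_process_def)

lemma W_measurable: "0 \<le> s \<Longrightarrow> s \<le> T \<Longrightarrow> W s \<in> borel_measurable M"
  using W_measurable_F[of s s] measurable_F_imp by auto

lemma indep_increment:
  assumes "0 \<le> s" "s < t" "t \<le> T" and X: "X \<in> borel_measurable (F s)"
  shows "indep_var borel X borel (\<lambda>\<omega>. W t \<omega> - W s \<omega>)"
proof -
  let ?D = "\<lambda>\<omega>. W t \<omega> - W s \<omega>"
  have ind: "indep_set (sets (F s)) {?D -` A \<inter> space M | A. A \<in> sets borel}"
    using wiener assms by (auto simp: wiener_process_def)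
  have [measurable]: "?D \<in> borel_measurable M" using W_measurable assms by auto
  have sigD: "sigma_sets (space M) {?D -` A \<inter> space M | A. A \<in> sets borel} = {?D -` A \<inter> space M | A. A \<in> sets borel}"
    using sets_vimage_algebra2[of ?D "space M" borel] sets.sigma_sets_eq[of "vimage_algebra (space M) ?D borel"] by (simp add: space_vimage_algebra)
  have sigX: "sigma_sets (space M) {X -` A \<inter> space M | A. A \<in> sets borel} \<subseteq> sets (F s)"
    using measurable_sets[OF X] sets.sigma_sets_subset[of "{X -` A \<inter> space M | A. A \<in> sets borel}" "F s"] by auto
  show ?thesis
    unfolding indep_var_eq sigD
  proof (intro conjI)
    show "indep_set (sigma_sets (space M) {X -` A \<inter> space M |A. A \<in> sets borel}) {?D -` A \<inter> space M | A. A \<in> sets borel}"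
      unfolding indep_set_def using sigX
      by (intro indep_sets_mono_sets[OF ind[unfolded indep_set_def]]) (auto split: bool.splits)
  qed (use measurable_F_imp[OF X] in auto)
qed

lemma increment_moments:
  assumes "0 \<le> s" "s < t" "t \<le> T"
  shows "integrable M (\<lambda>\<omega>. W t \<omega> - W s \<omega>)" "expectation (\<lambda>\<omega>. W t \<omega> - W s \<omega>) = 0"
    "integrable M (\<lambda>\<omega>. (W t \<omega> - W s \<omega>)\<^sup>2)" "expectation (\<lambda>\<omega>. (W t \<omega> - W s \<omega>)\<^sup>2) = t - s"
    "expectation (\<lambda>\<omega>. iexp (c * (W t \<omega> - W s \<omega>))) = complex_of_real (exp (- (c\<^sup>2 * (t - s)) / 2))"
proof -
  let ?D = "\<lambda>\<omega>. W t \<omega> - W s \<omega>" and ?sd = "sqrt (t - s)"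
  have D: "distributed M lborel ?D (normal_density 0 ?sd)"
    using wiener assms by (auto simp: wiener_process_def)
  have [measurable]: "?D \<in> borel_measurable M" using W_measurable assms by auto
  have pos: "?sd > 0" using assms by simp
  have N: "distributed M lborel (\<lambda>\<omega>. ?D \<omega> / ?sd) std_normal_density"
    using normal_standard_normal_convert[OF pos, of ?D 0] D by simp
  have law: "distr M borel (\<lambda>\<omega>. ?D \<omega> / ?sd) = std_normal_distribution"
    using distributed_distr_eq_density[OF N] by (simp cong: distr_cong)
  have eq: "?D \<omega> = ?sd * (?D \<omega> / ?sd)" for \<omega> using pos by simp
  have int: "integrable M (\<lambda>\<omega>. (?D \<omega> / ?sd) ^ k)"
    and ex: "expectation (\<lambda>\<omega>. (?D \<omega> / ?sd) ^ k) = (LINT x|std_normal_distribution. x ^ k)" for k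
    using integrable_std_normal_distribution_moment[of k]
    unfolding law[symmetric] by (simp_all add: integrable_distr_eq integral_distr)
  show "integrable M ?D" using integrable_mult_right[OF int[of 1], of ?sd] pos by simp
  show "expectation ?D = 0" using ex[of 1] pos integral_std_normal_distribution_moment_odd[of 1] by simp
  have e2: "(?D \<omega>)\<^sup>2 = (t - s) * (?D \<omega> / ?sd)\<^sup>2" for \<omega>
    using assms by (simp add: power_divide)
  show "integrable M (\<lambda>\<omega>. (?D \<omega>)\<^sup>2)" unfolding e2 using int[of 2] by simp
  show "expectation (\<lambda>\<omega>. (?D \<omega>)\<^sup>2) = t - s"
    unfolding e2 using ex[of 2] std_normal_distribution_even_moments(1)[of 1] by simp
  have "expectation (\<lambda>\<omega>. iexp (c * ?D \<omega>)) = char (distr M borel (\<lambda>\<omega>. ?D \<omega> / ?sd)) (c * ?sd)"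
    using pos by (simp add: char_def integral_distr)
  also have "\<dots> = complex_of_real (exp (- (c\<^sup>2 * (t - s)) / 2))"
    unfolding law char_std_normal_distribution using assms by (simp add: power_mult_distrib)
  finally show "expectation (\<lambda>\<omega>. iexp (c * ?D \<omega>)) = complex_of_real (exp (- (c\<^sup>2 * (t - s)) / 2))" .
qed

lemma simple_integrand_Suc:
  "simple_integrand F T (Suc n) \<tau> \<xi> \<Longrightarrow> simple_integrand F T n \<tau> \<xi>"
  using simple_integrandD(3)[of F T "Suc n" \<tau> \<xi> n] by (auto simp: simple_integrand_def)

lemma simple_integral_measurable:
  assumes "simple_integrand F T n \<tau> \<xi>"
  shows "simple_integral W n \<tau> \<xi> \<in> borel_measurable (F (\<tau> n))"
proof -
  note D = simple_integrandD[OF assms]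
  have "(\<lambda>\<omega>. \<xi> i \<omega> * (W (\<tau> (Suc i)) \<omega> - W (\<tau> i) \<omega>)) \<in> borel_measurable (F (\<tau> n))" if "i < n" for i
    using D(1)[of i n] D(4)[of i] that D(1)[of "Suc i" n] D(2)[of i] D(2)[of "Suc i"] D(3)[of n]
    by (intro borel_measurable_times borel_measurable_diff W_measurable_F)
       (auto intro: measurable_F_mono)
  then show ?thesis
    unfolding simple_integral_def[abs_def] by (intro borel_measurable_sum) auto
qed

text \<open>
An increment of \<open>W\<close> is centred and independent of the past, to which both the earlier part of the
integral and the current weight belong; so the mixed term of the square has mean 0.
\<close>

lemma simple_integral_isometry:
  assumes "simple_integrand F T n \<tau> \<xi>"
  shows "integrable M (\<lambda>\<omega>. (simple_integral W n \<tau> \<xi> \<omega>)\<^sup>2)"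
    and "integrable M (\<lambda>\<omega>. \<Sum>i<n. (\<xi> i \<omega>)\<^sup>2 * (\<tau> (Suc i) - \<tau> i))"
    and "expectation (\<lambda>\<omega>. (simple_integral W n \<tau> \<xi> \<omega>)\<^sup>2)
        = expectation (\<lambda>\<omega>. \<Sum>i<n. (\<xi> i \<omega>)\<^sup>2 * (\<tau> (Suc i) - \<tau> i))"
proof -
  have "integrable M (\<lambda>\<omega>. (simple_integral W n \<tau> \<xi> \<omega>)\<^sup>2) \<and>
      integrable M (\<lambda>\<omega>. \<Sum>i<n. (\<xi> i \<omega>)\<^sup>2 * (\<tau> (Suc i) - \<tau> i)) \<and>
      expectation (\<lambda>\<omega>. (simple_integral W n \<tau> \<xi> \<omega>)\<^sup>2)
        = expectation (\<lambda>\<omega>. \<Sum>i<n. (\<xi> i \<omega>)\<^sup>2 * (\<tau> (Suc i) - \<tau> i))"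
    using assms
  proof (induction n)
    case 0 then show ?case by (simp add: simple_integral_def)
  next
    case (Suc n)
    note D = simple_integrandD[OF Suc.prems]
    define A where "A = simple_integral W n \<tau> \<xi>"
    define s where "s = \<tau> n"
    define t where "t = \<tau> (Suc n)"
    define x where "x = \<xi> n"
    let ?D = "\<lambda>\<omega>. W t \<omega> - W s \<omega>"
    have st: "0 \<le> s" "s \<le> t" "t \<le> T" using D(1)[of n "Suc n"] D(2)[of n] D(3)[of "Suc n"] by (auto simp: s_def t_def)
    have IH: "integrable M (\<lambda>\<omega>. (A \<omega>)\<^sup>2)" "integrable M (\<lambda>\<omega>. \<Sum>i<n. (\<xi> i \<omega>)\<^sup>2 * (\<tau> (Suc i) - \<tau> i))"
      "expectation (\<lambda>\<omega>. (A \<omega>)\<^sup>2) = expectation (\<lambda>\<omega>. \<Sum>i<n. (\<xi> i \<omega>)\<^sup>2 * (\<tau> (Suc i) - \<tau> i))"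
      using Suc.IH simple_integrand_Suc[OF Suc.prems] by (auto simp: A_def)
    have S: "simple_integral W (Suc n) \<tau> \<xi> \<omega> = A \<omega> + x \<omega> * ?D \<omega>" for \<omega>
      by (simp add: simple_integral_def A_def s_def t_def x_def)
    have AF: "A \<in> borel_measurable (F s)"
      unfolding A_def s_def by (rule simple_integral_measurable[OF simple_integrand_Suc[OF Suc.prems]])
    have xF: "x \<in> borel_measurable (F s)" using D(4)[of n] by (simp add: x_def s_def)
    obtain B where B: "\<And>\<omega>. \<omega> \<in> space M \<Longrightarrow> \<bar>x \<omega>\<bar> \<le> B" using D(5)[of n] by (auto simp: x_def)
    note [measurable] = measurable_F_imp[OF AF] measurable_F_imp[OF xF]
    have x2: "integrable M (\<lambda>\<omega>. (x \<omega>)\<^sup>2)"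
      by (rule integrable_const_bound[where B="B\<^sup>2"]) (use power_mono[OF B, of _ 2] in auto)
    have Ax: "integrable M (\<lambda>\<omega>. A \<omega> * x \<omega>)"
      by (rule integrable_mult_of_squares[OF _ _ IH(1) x2]) auto
    show ?case
    proof (cases "s = t")
      case True
      then show ?thesis using IH by (simp add: S s_def[symmetric] t_def[symmetric])
    next
      case False
      then have st': "s < t" using st by simp
      note mom = increment_moments[OF st(1) st' st(3)]
      note ind = indep_increment[OF st(1) st' st(3)]
      have "(\<lambda>\<omega>. A \<omega> * x \<omega>) \<in> borel_measurable (F s)" using AF xF by simp
      note c1 = indep_var_integrable[OF ind[OF this] Ax mom(1)]
        and c2 = indep_var_lebesgue_integral[OF ind[OF this] Ax mom(1)]
      have xx: "(\<lambda>\<omega>. (x \<omega>)\<^sup>2) \<in> borel_measurable (F s)" using xF by simp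
      have ind2: "indep_var borel (\<lambda>\<omega>. (x \<omega>)\<^sup>2) borel (\<lambda>\<omega>. (?D \<omega>)\<^sup>2)"
        using indep_var_compose[OF ind[OF xx], of id borel "\<lambda>y. y\<^sup>2" borel] by (simp add: comp_def)
      note d1 = indep_var_integrable[OF ind2 x2 mom(3)]
        and d2 = indep_var_lebesgue_integral[OF ind2 x2 mom(3)]
      have e: "(A \<omega> + x \<omega> * ?D \<omega>)\<^sup>2 = (A \<omega>)\<^sup>2 + 2 * (A \<omega> * x \<omega> * ?D \<omega>) + (x \<omega>)\<^sup>2 * (?D \<omega>)\<^sup>2" for \<omega>
        by (simp add: power2_sum power_mult_distrib)
      have "integrable M (\<lambda>\<omega>. (A \<omega> + x \<omega> * ?D \<omega>)\<^sup>2)"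
        unfolding e using IH c1 d1 by (intro Bochner_Integration.integrable_add integrable_mult_right) auto
      moreover have "expectation (\<lambda>\<omega>. (A \<omega> + x \<omega> * ?D \<omega>)\<^sup>2) = expectation (\<lambda>\<omega>. (A \<omega>)\<^sup>2) + expectation (\<lambda>\<omega>. (x \<omega>)\<^sup>2) * (t - s)"
        unfolding e using IH(1) c1 d1 c2 d2 mom(2,4)
        by (simp add: Bochner_Integration.integral_add Bochner_Integration.integrable_add integrable_mult_right)
      ultimately show ?thesis
        using IH x2 by (simp add: S s_def[symmetric] t_def[symmetric] x_def[symmetric])
    qed
  qed
  then show "integrable M (\<lambda>\<omega>. (simple_integral W n \<tau> \<xi> \<omega>)\<^sup>2)"
    and "integrable M (\<lambda>\<omega>. \<Sum>i<n. (\<xi> i \<omega>)\<^sup>2 * (\<tau> (Suc i) - \<tau> i))"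
    and "expectation (\<lambda>\<omega>. (simple_integral W n \<tau> \<xi> \<omega>)\<^sup>2)
        = expectation (\<lambda>\<omega>. \<Sum>i<n. (\<xi> i \<omega>)\<^sup>2 * (\<tau> (Suc i) - \<tau> i))"
    by auto
qed

text \<open>
The size of an integrand, insensitive to its values outside \<open>{0..T}\<close>.
\<close>

definition trunc_energy :: "(real \<Rightarrow> 'a \<Rightarrow> real) \<Rightarrow> real" where
  "trunc_energy H = trunc_mean M (\<lambda>\<omega>. energy T (\<lambda>t. H t \<omega>))"

text \<open>
The isometry controls second moments, but energies are only known to be small in probability.
Therefore the integrand is set to 0 from the first cell on whose energy would push the accumulated
energy \<open>Q\<close> above \<open>e\<close>.  This is adapted, since \<open>Q (Suc i)\<close> is known at time \<open>\<tau> i\<close>.  The stopped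
integral has second moment at most \<open>e\<close>, and it differs from the original one only where the total
energy exceeds \<open>e\<close>, an event of probability at most \<open>E min(1, Q n) / e\<close>.
\<close>

lemma simple_integral_stopped_bound:
  assumes si: "simple_integrand F T n \<tau> \<xi>" and e: "0 < e" "e \<le> 1"
  shows "trunc_mean M (\<lambda>\<omega>. ennreal ((simple_integral W n \<tau> \<xi> \<omega>)\<^sup>2)) \<le> trunc_energy (simple_process n \<tau> \<xi>) / e + e"
proof -
  note D = simple_integrandD[OF si]
  define Q where "Q k \<omega> = (\<Sum>i<k. (\<xi> i \<omega>)\<^sup>2 * (\<tau> (Suc i) - \<tau> i))" for k \<omega>
  define \<xi>' where "\<xi>' i \<omega> = (if Q (Suc i) \<omega> \<le> e then \<xi> i \<omega> else 0)" for i \<omega>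
  have d: "0 \<le> \<tau> (Suc i) - \<tau> i" if "i < n" for i using D(1)[of i "Suc i"] that by simp
  have \<xi>M: "\<xi> i \<in> borel_measurable (F (\<tau> k))" if "i \<le> k" "k < n" for i k
    using D(4)[of i] D(1)[of i k] that by (auto intro: measurable_F_mono)
  have QM: "Q k \<in> borel_measurable M" if "k \<le> n" for k
    unfolding Q_def[abs_def] using D(4) that
    by (intro borel_measurable_sum borel_measurable_times borel_measurable_power)
      (auto intro: measurable_F_imp[OF D(4)])
  have [measurable]: "Q n \<in> borel_measurable M" by (rule QM) simp
  have si': "simple_integrand F T n \<tau> \<xi>'"
    unfolding simple_integrand_def
  proof (intro conjI allI impI)
    fix i assume i: "i < n"
    have "Q (Suc i) \<in> borel_measurable (F (\<tau> i))"
      unfolding Q_def[abs_def] using \<xi>M i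
      by (intro borel_measurable_sum borel_measurable_times borel_measurable_power) auto
    then show "\<xi>' i \<in> borel_measurable (F (\<tau> i))"
      unfolding \<xi>'_def[abs_def] using \<xi>M[of i i] i
        borel_measurable_le[of "Q (Suc i)" "F (\<tau> i)" "\<lambda>_. e"]
      by (intro measurable_If) auto
    obtain B where "\<And>\<omega>. \<omega> \<in> space M \<Longrightarrow> \<bar>\<xi> i \<omega>\<bar> \<le> B" using D(5)[OF i] by auto
    then show "\<exists>B. \<forall>\<omega>\<in>space (F (\<tau> i)). \<bar>\<xi>' i \<omega>\<bar> \<le> B"
      by (intro exI[of _ "\<bar>B\<bar>"]) (force simp: \<xi>'_def)
  qed (use si in \<open>auto simp: simple_integrand_def\<close>)
  have Qmono: "Q i \<omega> \<le> Q j \<omega>" if "i \<le> j" "j \<le> n" for i j \<omega>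
    unfolding Q_def using that d by (intro sum_mono2) (auto intro!: mult_nonneg_nonneg)
  have Q0: "0 \<le> Q n \<omega>" for \<omega> using Qmono[of 0 n] by (simp add: Q_def)
  have cap: "(\<Sum>i<k. (\<xi>' i \<omega>)\<^sup>2 * (\<tau> (Suc i) - \<tau> i)) \<le> min e (Q k \<omega>)" if "k \<le> n" for k \<omega>
    using that
  proof (induction k)
    case (Suc k)
    then show ?case using d[of k] Qmono[of k "Suc k" \<omega>] by (auto simp: \<xi>'_def Q_def)
  qed (use e in \<open>simp add: Q_def\<close>)
  let ?J = "simple_integral W n \<tau> \<xi>" and ?J' = "simple_integral W n \<tau> \<xi>'"
  have [measurable]: "?J \<in> borel_measurable M" "?J' \<in> borel_measurable M"
    using simple_integral_measurable[OF si] simple_integral_measurable[OF si'] by (auto intro: measurable_F_imp)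
  note iso = simple_integral_isometry[OF si']
  have pw: "min 1 ((?J \<omega>)\<^sup>2) \<le> min 1 (Q n \<omega>) / e + (?J' \<omega>)\<^sup>2" for \<omega>
  proof (cases "Q n \<omega> \<le> e")
    case True
    then have "\<xi>' i \<omega> = \<xi> i \<omega>" if "i < n" for i
      using Qmono[of "Suc i" n \<omega>] that by (auto simp: \<xi>'_def)
    then have "?J' \<omega> = ?J \<omega>" by (simp add: simple_integral_def)
    moreover have "0 \<le> min 1 (Q n \<omega>) / e" using Q0 e by simp
    ultimately show ?thesis by (auto simp: min_def)
  next
    case False
    then have "1 \<le> min 1 (Q n \<omega>) / e" using e by (simp add: field_simps min_def)
    then show ?thesis by (simp add: min.coboundedI1 add_increasing2)
  qed
  have iQ: "integrable M (\<lambda>\<omega>. min 1 (Q n \<omega>))"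
    using Q0 by (intro integrable_const_bound[where B=1]) auto
  have "trunc_mean M (\<lambda>\<omega>. ennreal ((?J \<omega>)\<^sup>2)) = expectation (\<lambda>\<omega>. min 1 ((?J \<omega>)\<^sup>2))"
    by (rule trunc_mean_eq_expectation) auto
  also have "\<dots> \<le> expectation (\<lambda>\<omega>. min 1 (Q n \<omega>) / e + (?J' \<omega>)\<^sup>2)"
    by (rule integral_mono[OF _ Bochner_Integration.integrable_add[OF integrable_divide[OF iQ] iso(1)] pw])
      (rule integrable_const_bound[where B=1], auto)
  also have "\<dots> = expectation (\<lambda>\<omega>. min 1 (Q n \<omega>)) / e + expectation (\<lambda>\<omega>. (?J' \<omega>)\<^sup>2)"
    by (subst Bochner_Integration.integral_add[OF integrable_divide[OF iQ] iso(1)]) simp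
  also have "expectation (\<lambda>\<omega>. (?J' \<omega>)\<^sup>2) \<le> expectation (\<lambda>\<omega>. e)"
    unfolding iso(3) using iso(2) cap[of n] by (intro integral_mono) auto
  also have "expectation (\<lambda>\<omega>. min 1 (Q n \<omega>)) = trunc_energy (simple_process n \<tau> \<xi>)"
    unfolding trunc_energy_def nn_integral_simple_process_square[OF si]
    using Q0 by (subst trunc_mean_eq_expectation[symmetric]) (auto simp: Q_def[symmetric])
  finally show ?thesis by (simp add: prob_space)
qed

end

section \<open>Stochastic integrals with respect to the Wiener process\<close>

lemma ennreal_twice_add_twice:
  assumes "0 \<le> a" "0 \<le> b"
  shows "ennreal (2 * a + 2 * b) = 2 * ennreal a + 2 * ennreal b"
proof -
  have "ennreal (2 * a + 2 * b) = ennreal (2 * a) + ennreal (2 * b)"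
    by (rule ennreal_plus) (use assms in auto)
  also have "\<dots> = ennreal 2 * ennreal a + ennreal 2 * ennreal b"
    by (simp only: ennreal_mult''[OF assms(1)] ennreal_mult''[OF assms(2)])
  finally show ?thesis by simp
qed

context wiener_space
begin

definition jointly_measurable :: "(real \<Rightarrow> 'a \<Rightarrow> real) \<Rightarrow> bool" where
  "jointly_measurable H \<longleftrightarrow> (\<lambda>(t, \<omega>). H t \<omega>) \<in> borel_measurable (lebesgue_on {0..T} \<Otimes>\<^sub>M M)"

abbreviation trunc_sq :: "('a \<Rightarrow> real) \<Rightarrow> real" where
  "trunc_sq J \<equiv> trunc_mean M (\<lambda>\<omega>. ennreal ((J \<omega>)\<^sup>2))"

lemma jointly_measurable_cong:
  "(\<And>t \<omega>. t \<in> {0..T} \<Longrightarrow> \<omega> \<in> space M \<Longrightarrow> H t \<omega> = H' t \<omega>) \<Longrightarrow> jointly_measurable H = jointly_measurable H'"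
  unfolding jointly_measurable_def by (rule measurable_cong) (auto simp: space_pair_measure)

lemma jointly_measurable_add:
  "jointly_measurable H \<Longrightarrow> jointly_measurable H' \<Longrightarrow> jointly_measurable (\<lambda>t \<omega>. H t \<omega> + H' t \<omega>)"
  unfolding jointly_measurable_def by (auto simp: split_beta' intro: borel_measurable_add)

lemma jointly_measurable_diff:
  "jointly_measurable H \<Longrightarrow> jointly_measurable H' \<Longrightarrow> jointly_measurable (\<lambda>t \<omega>. H t \<omega> - H' t \<omega>)"
  unfolding jointly_measurable_def by (auto simp: split_beta' intro: borel_measurable_diff)

lemma jointly_measurable_times:
  "jointly_measurable H \<Longrightarrow> jointly_measurable H' \<Longrightarrow> jointly_measurable (\<lambda>t \<omega>. H t \<omega> * H' t \<omega>)"
  unfolding jointly_measurable_def by (auto simp: split_beta' intro: borel_measurable_times)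

lemma jointly_measurable_time:
  "f \<in> borel_measurable (lebesgue_on {0..T}) \<Longrightarrow> jointly_measurable (\<lambda>t \<omega>. f t)"
  unfolding jointly_measurable_def by simp

lemma jointly_measurable_rv:
  "f \<in> borel_measurable M \<Longrightarrow> jointly_measurable (\<lambda>t \<omega>. f \<omega>)"
  unfolding jointly_measurable_def by simp

lemma jointly_measurable_section:
  assumes "jointly_measurable H" "\<omega> \<in> space M"
  shows "(\<lambda>t. H t \<omega>) \<in> borel_measurable (lebesgue_on {0..T})"
  using measurable_compose[OF measurable_Pair2'[OF assms(2)] assms(1)[unfolded jointly_measurable_def]]
  by simp

lemma measurable_square_time_integral:
  assumes "jointly_measurable H"
  shows "(\<lambda>\<omega>. energy T (\<lambda>t. H t \<omega>)) \<in> borel_measurable M"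
proof -
  interpret L: finite_measure "lebesgue_on {0..T}"
    by (rule finite_measure_lebesgue_on) simp
  have [measurable]: "(\<lambda>(\<omega>, t). H t \<omega>) \<in> borel_measurable (M \<Otimes>\<^sub>M lebesgue_on {0..T})"
    using measurable_pair_swap[OF assms[unfolded jointly_measurable_def]] by simp
  have "(\<lambda>(\<omega>, t). ennreal ((H t \<omega>)\<^sup>2)) \<in> borel_measurable (M \<Otimes>\<^sub>M lebesgue_on {0..T})"
    by measurable
  then show ?thesis by (rule L.borel_measurable_nn_integral)
qed

lemma trunc_energy_mono_scale:
  assumes "jointly_measurable H" and K: "\<And>t \<omega>. t \<in> {0..T} \<Longrightarrow> \<omega> \<in> space M \<Longrightarrow> \<bar>K t \<omega>\<bar> \<le> B * \<bar>H t \<omega>\<bar>"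
  shows "trunc_energy K \<le> max 1 (B\<^sup>2) * trunc_energy H"
proof -
  have "trunc_energy K \<le> trunc_mean M (\<lambda>\<omega>. ennreal (max 1 (B\<^sup>2)) * energy T (\<lambda>t. H t \<omega>))"
    unfolding trunc_energy_def
  proof (rule trunc_mean_mono)
    fix \<omega> assume \<omega>: "\<omega> \<in> space M"
    have [measurable]: "(\<lambda>t. H t \<omega>) \<in> borel_measurable (lebesgue_on {0..T})"
      by (rule jointly_measurable_section[OF assms(1) \<omega>])
    have "(K t \<omega>)\<^sup>2 \<le> max 1 (B\<^sup>2) * (H t \<omega>)\<^sup>2" if "t \<in> {0..T}" for t
    proof -
      have "(K t \<omega>)\<^sup>2 \<le> B\<^sup>2 * (H t \<omega>)\<^sup>2"
        using power_mono[OF K[OF that \<omega>], of 2] by (simp add: power_mult_distrib)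
      also have "\<dots> \<le> max 1 (B\<^sup>2) * (H t \<omega>)\<^sup>2" by (intro mult_right_mono) auto
      finally show ?thesis .
    qed
    then have "ennreal ((K t \<omega>)\<^sup>2) \<le> ennreal (max 1 (B\<^sup>2)) * ennreal ((H t \<omega>)\<^sup>2)" if "t \<in> {0..T}" for t
      using that by (subst ennreal_mult''[symmetric]) (auto intro!: ennreal_leI)
    then have "energy T (\<lambda>t. K t \<omega>) \<le> (\<integral>\<^sup>+ t. ennreal (max 1 (B\<^sup>2)) * ennreal ((H t \<omega>)\<^sup>2) \<partial>lebesgue_on {0..T})"
      by (intro nn_integral_mono) simp
    also have "\<dots> = ennreal (max 1 (B\<^sup>2)) * energy T (\<lambda>t. H t \<omega>)"
      by (rule nn_integral_cmult) measurable
    finally show "energy T (\<lambda>t. K t \<omega>) \<le> \<dots>" .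
  qed
  also have "\<dots> \<le> max 1 (B\<^sup>2) * trunc_energy H"
    unfolding trunc_energy_def by (rule trunc_mean_cmult) (use measurable_square_time_integral[OF assms(1)] in auto)
  finally show ?thesis .
qed

lemma trunc_energy_add:
  assumes "jointly_measurable A" "jointly_measurable B"
    and "\<And>t \<omega>. t \<in> {0..T} \<Longrightarrow> \<omega> \<in> space M \<Longrightarrow> H t \<omega> = A t \<omega> + B t \<omega>"
  shows "trunc_energy H \<le> 2 * trunc_energy A + 2 * trunc_energy B"
  unfolding trunc_energy_def
proof (rule trunc_mean_quasi_add)
  fix \<omega> assume \<omega>: "\<omega> \<in> space M"
  have [measurable]: "(\<lambda>t. A t \<omega>) \<in> borel_measurable (lebesgue_on {0..T})" "(\<lambda>t. B t \<omega>) \<in> borel_measurable (lebesgue_on {0..T})"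
    by (rule jointly_measurable_section[OF assms(1) \<omega>] jointly_measurable_section[OF assms(2) \<omega>])+
  have "(H t \<omega>)\<^sup>2 \<le> 2 * (A t \<omega>)\<^sup>2 + 2 * (B t \<omega>)\<^sup>2" if "t \<in> {0..T}" for t
    using sum_squares_bound[of "A t \<omega>" "B t \<omega>"] assms(3)[OF that \<omega>] by (simp add: power2_sum)
  then have "energy T (\<lambda>t. H t \<omega>) \<le> (\<integral>\<^sup>+ t. ennreal (2 * (A t \<omega>)\<^sup>2 + 2 * (B t \<omega>)\<^sup>2) \<partial>lebesgue_on {0..T})"
    by (intro nn_integral_mono ennreal_leI) simp
  also have "\<dots> = (\<integral>\<^sup>+ t. 2 * ennreal ((A t \<omega>)\<^sup>2) + 2 * ennreal ((B t \<omega>)\<^sup>2) \<partial>lebesgue_on {0..T})"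
    by (simp only: ennreal_twice_add_twice zero_le_power2)
  also have "\<dots> = 2 * energy T (\<lambda>t. A t \<omega>) + 2 * energy T (\<lambda>t. B t \<omega>)"
    by (simp add: nn_integral_add nn_integral_cmult)
  finally show "energy T (\<lambda>t. H t \<omega>) \<le> \<dots>" .
qed (use assms measurable_square_time_integral in auto)

lemma trunc_sq_mono_scale:
  assumes [measurable]: "J \<in> borel_measurable M" and K: "\<And>\<omega>. \<omega> \<in> space M \<Longrightarrow> \<bar>K \<omega>\<bar> \<le> B * \<bar>J \<omega>\<bar>"
  shows "trunc_sq K \<le> max 1 (B\<^sup>2) * trunc_sq J"
proof -
  have "trunc_sq K \<le> trunc_mean M (\<lambda>\<omega>. ennreal (max 1 (B\<^sup>2)) * ennreal ((J \<omega>)\<^sup>2))"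
  proof (rule trunc_mean_mono)
    fix \<omega> assume \<omega>: "\<omega> \<in> space M"
    have "(K \<omega>)\<^sup>2 \<le> B\<^sup>2 * (J \<omega>)\<^sup>2"
      using power_mono[OF K[OF \<omega>], of 2] by (simp add: power_mult_distrib)
    also have "\<dots> \<le> max 1 (B\<^sup>2) * (J \<omega>)\<^sup>2" by (intro mult_right_mono) auto
    finally show "ennreal ((K \<omega>)\<^sup>2) \<le> ennreal (max 1 (B\<^sup>2)) * ennreal ((J \<omega>)\<^sup>2)"
      by (subst ennreal_mult''[symmetric]) (auto intro!: ennreal_leI)
  qed
  also have "\<dots> \<le> max 1 (B\<^sup>2) * trunc_sq J" by (rule trunc_mean_cmult) auto
  finally show ?thesis .
qed

lemma trunc_sq_add:
  assumes [measurable]: "A \<in> borel_measurable M" "B \<in> borel_measurable M"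
    and "\<And>\<omega>. \<omega> \<in> space M \<Longrightarrow> J \<omega> = A \<omega> + B \<omega>"
  shows "trunc_sq J \<le> 2 * trunc_sq A + 2 * trunc_sq B"
proof (rule trunc_mean_quasi_add)
  fix \<omega> assume \<omega>: "\<omega> \<in> space M"
  have "(J \<omega>)\<^sup>2 \<le> 2 * (A \<omega>)\<^sup>2 + 2 * (B \<omega>)\<^sup>2"
    using sum_squares_bound[of "A \<omega>" "B \<omega>"] assms(3)[OF \<omega>] by (simp add: power2_sum)
  then have "ennreal ((J \<omega>)\<^sup>2) \<le> ennreal (2 * (A \<omega>)\<^sup>2 + 2 * (B \<omega>)\<^sup>2)" by (rule ennreal_leI)
  then show "ennreal ((J \<omega>)\<^sup>2) \<le> 2 * ennreal ((A \<omega>)\<^sup>2) + 2 * ennreal ((B \<omega>)\<^sup>2)"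
    by (simp only: ennreal_twice_add_twice zero_le_power2)
qed auto

lemma trunc_energy_zero: "trunc_energy (\<lambda>t \<omega>. 0) = 0"
  by (simp add: trunc_energy_def trunc_mean_def)

lemma trunc_energy_nonneg: "0 \<le> trunc_energy H"
  by (simp add: trunc_energy_def trunc_mean_nonneg)

lemma trunc_energy_cong:
  "(\<And>t \<omega>. t \<in> {0..T} \<Longrightarrow> \<omega> \<in> space M \<Longrightarrow> (H t \<omega>)\<^sup>2 = (H' t \<omega>)\<^sup>2) \<Longrightarrow> trunc_energy H = trunc_energy H'"
  unfolding trunc_energy_def by (intro trunc_mean_cong nn_integral_cong) auto

lemma elementary_integral_measurable:
  assumes "elementary_integral F T W G J"
  shows "jointly_measurable G" "J \<in> borel_measurable M"
proof -
  have "jointly_measurable G \<and> J \<in> borel_measurable M"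
    using assms
  proof induction
    case zero then show ?case by (simp add: jointly_measurable_def)
  next
    case (step s t \<xi> B)
    have "jointly_measurable (\<lambda>u \<omega>. \<xi> \<omega> * indicator {s<..t} u)"
      by (intro jointly_measurable_times jointly_measurable_rv jointly_measurable_time borel_measurable_indicator
          measurable_F_imp[OF step(4)]) (use step in \<open>auto simp: sets_restrict_space_iff\<close>)
    then show ?case using step W_measurable measurable_F_imp[OF step(4)] by auto
  qed (auto intro: jointly_measurable_add)
  then show "jointly_measurable G" "J \<in> borel_measurable M" by auto
qed

lemma elementary_integral_bound:
  assumes "elementary_integral F T W G J" "0 < e" "e \<le> 1"
  shows "trunc_sq J \<le> trunc_energy G / e + e"
proof -
  obtain n \<tau> \<xi> where "simple_integrand F T n \<tau> \<xi>" "G = simple_process n \<tau> \<xi>" "J = simple_integral W n \<tau> \<xi>"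
    using elementary_integral_obtain_simple[OF filtration_F less_imp_le[OF T_pos] assms(1)] by metis
  then show ?thesis using simple_integral_stopped_bound[of n \<tau> \<xi> e] assms by auto
qed

text \<open>
\<open>I\<close> is a version of \<open>\<integral> H dW\<close> over \<open>[0, T]\<close>: the pair \<open>(H, I)\<close> is a limit in probability of
elementary pairs.  Keeping \<open>I\<close> as an argument avoids any choice of a version.
\<close>

definition has_W_integral :: "(real \<Rightarrow> 'a \<Rightarrow> real) \<Rightarrow> ('a \<Rightarrow> real) \<Rightarrow> bool" where
  "has_W_integral H I \<longleftrightarrow> jointly_measurable H \<and> I \<in> borel_measurable M \<and>
     (\<forall>e>0. \<exists>G J. elementary_integral F T W G J \<and> trunc_energy (\<lambda>t \<omega>. G t \<omega> - H t \<omega>) < e \<and> trunc_sq (\<lambda>\<omega>. J \<omega> - I \<omega>) < e)"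

lemma has_W_integral_measurable: "has_W_integral H I \<Longrightarrow> jointly_measurable H" "has_W_integral H I \<Longrightarrow> I \<in> borel_measurable M"
  by (auto simp: has_W_integral_def)

lemma has_W_integral_obtain:
  assumes "has_W_integral H I" "0 < e"
  obtains G J where "elementary_integral F T W G J" "trunc_energy (\<lambda>t \<omega>. G t \<omega> - H t \<omega>) < e" "trunc_sq (\<lambda>\<omega>. J \<omega> - I \<omega>) < e"
  using assms unfolding has_W_integral_def by blast

lemma has_W_integral_elementary: "elementary_integral F T W G J \<Longrightarrow> has_W_integral G J"
  unfolding has_W_integral_def using elementary_integral_measurable
  by (auto intro!: exI[of _ G] exI[of _ J] simp: trunc_energy_zero trunc_mean_def)

lemma has_W_integral_cong:
  assumes "has_W_integral H I" "\<And>t \<omega>. t \<in> {0..T} \<Longrightarrow> \<omega> \<in> space M \<Longrightarrow> H t \<omega> = H' t \<omega>"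
    "\<And>\<omega>. \<omega> \<in> space M \<Longrightarrow> I \<omega> = I' \<omega>"
  shows "has_W_integral H' I'"
proof -
  have "jointly_measurable H'" using assms jointly_measurable_cong[of H H'] by (auto simp: has_W_integral_def)
  moreover have "I' \<in> borel_measurable M" using assms measurable_cong[of M I I' borel] by (auto simp: has_W_integral_def)
  moreover have "trunc_energy (\<lambda>t \<omega>. G t \<omega> - H t \<omega>) = trunc_energy (\<lambda>t \<omega>. G t \<omega> - H' t \<omega>)" for G
    by (rule trunc_energy_cong) (simp add: assms)
  moreover have "trunc_sq (\<lambda>\<omega>. J \<omega> - I \<omega>) = trunc_sq (\<lambda>\<omega>. J \<omega> - I' \<omega>)" for J
    by (rule trunc_mean_cong) (simp add: assms)
  ultimately show ?thesis using assms(1) by (simp add: has_W_integral_def)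
qed

lemma has_W_integral_limit:
  assumes "jointly_measurable H" "I \<in> borel_measurable M"
    and lim: "\<And>e. 0 < e \<Longrightarrow> \<exists>H' I'. has_W_integral H' I' \<and> trunc_energy (\<lambda>t \<omega>. H' t \<omega> - H t \<omega>) < e \<and> trunc_sq (\<lambda>\<omega>. I' \<omega> - I \<omega>) < e"
  shows "has_W_integral H I"
  unfolding has_W_integral_def
proof (intro conjI allI impI assms(1,2))
  fix e :: real assume "0 < e"
  then obtain H' I' where 1: "has_W_integral H' I'" "trunc_energy (\<lambda>t \<omega>. H' t \<omega> - H t \<omega>) < e / 4" "trunc_sq (\<lambda>\<omega>. I' \<omega> - I \<omega>) < e / 4"
    using lim[of "e / 4"] by auto
  obtain G J where 2: "elementary_integral F T W G J" "trunc_energy (\<lambda>t \<omega>. G t \<omega> - H' t \<omega>) < e / 4" "trunc_sq (\<lambda>\<omega>. J \<omega> - I' \<omega>) < e / 4"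
    using has_W_integral_obtain[OF 1(1), of "e / 4"] \<open>0 < e\<close> by auto
  note m = has_W_integral_measurable[OF 1(1)] elementary_integral_measurable[OF 2(1)]
  have "trunc_energy (\<lambda>t \<omega>. G t \<omega> - H t \<omega>) \<le> 2 * trunc_energy (\<lambda>t \<omega>. G t \<omega> - H' t \<omega>) + 2 * trunc_energy (\<lambda>t \<omega>. H' t \<omega> - H t \<omega>)"
    by (rule trunc_energy_add) (use m assms in \<open>auto intro: jointly_measurable_diff\<close>)
  moreover have "trunc_sq (\<lambda>\<omega>. J \<omega> - I \<omega>) \<le> 2 * trunc_sq (\<lambda>\<omega>. J \<omega> - I' \<omega>) + 2 * trunc_sq (\<lambda>\<omega>. I' \<omega> - I \<omega>)"
    by (rule trunc_sq_add) (use m assms in auto)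
  ultimately show "\<exists>G J. elementary_integral F T W G J \<and> trunc_energy (\<lambda>t \<omega>. G t \<omega> - H t \<omega>) < e \<and> trunc_sq (\<lambda>\<omega>. J \<omega> - I \<omega>) < e"
    using 1 2 by (intro exI[of _ G] exI[of _ J]) auto
qed

lemma has_W_integral_add:
  assumes 1: "has_W_integral H I" and 2: "has_W_integral H' I'"
  shows "has_W_integral (\<lambda>t \<omega>. H t \<omega> + H' t \<omega>) (\<lambda>\<omega>. I \<omega> + I' \<omega>)"
  unfolding has_W_integral_def
proof (intro conjI allI impI)
  note m = has_W_integral_measurable[OF 1] has_W_integral_measurable[OF 2]
  show "jointly_measurable (\<lambda>t \<omega>. H t \<omega> + H' t \<omega>)" "(\<lambda>\<omega>. I \<omega> + I' \<omega>) \<in> borel_measurable M"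
    using m by (auto intro: jointly_measurable_add)
  fix e :: real assume "0 < e"
  then have "0 < e / 4" by simp
  from has_W_integral_obtain[OF 1 this] obtain G J where
    G: "elementary_integral F T W G J" "trunc_energy (\<lambda>t \<omega>. G t \<omega> - H t \<omega>) < e / 4" "trunc_sq (\<lambda>\<omega>. J \<omega> - I \<omega>) < e / 4" .
  from has_W_integral_obtain[OF 2 \<open>0 < e / 4\<close>] obtain G' J' where
    G': "elementary_integral F T W G' J'" "trunc_energy (\<lambda>t \<omega>. G' t \<omega> - H' t \<omega>) < e / 4" "trunc_sq (\<lambda>\<omega>. J' \<omega> - I' \<omega>) < e / 4" .
  note n = elementary_integral_measurable[OF G(1)] elementary_integral_measurable[OF G'(1)]
  have "trunc_energy (\<lambda>t \<omega>. (G t \<omega> + G' t \<omega>) - (H t \<omega> + H' t \<omega>)) \<le> 2 * trunc_energy (\<lambda>t \<omega>. G t \<omega> - H t \<omega>) + 2 * trunc_energy (\<lambda>t \<omega>. G' t \<omega> - H' t \<omega>)"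
    by (rule trunc_energy_add) (use m n in \<open>auto intro: jointly_measurable_diff\<close>)
  moreover have "trunc_sq (\<lambda>\<omega>. (J \<omega> + J' \<omega>) - (I \<omega> + I' \<omega>)) \<le> 2 * trunc_sq (\<lambda>\<omega>. J \<omega> - I \<omega>) + 2 * trunc_sq (\<lambda>\<omega>. J' \<omega> - I' \<omega>)"
    by (rule trunc_sq_add) (use m n in auto)
  ultimately show "\<exists>G J. elementary_integral F T W G J \<and> trunc_energy (\<lambda>t \<omega>. G t \<omega> - (H t \<omega> + H' t \<omega>)) < e \<and> trunc_sq (\<lambda>\<omega>. J \<omega> - (I \<omega> + I' \<omega>)) < e"
    using G G' elementary_integral.add[OF G(1) G'(1)]
    by (intro exI[of _ "\<lambda>t \<omega>. G t \<omega> + G' t \<omega>"] exI[of _ "\<lambda>\<omega>. J \<omega> + J' \<omega>"]) auto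
qed

text \<open>
The approximating integrands need not vanish before \<open>s\<close> although \<open>H\<close> does, so the weight cannot be
applied to them directly.  Their part before \<open>s\<close> has small energy, hence a small integral, and may
be dropped first.
\<close>

lemma has_W_integral_scale:
  assumes 1: "has_W_integral H I" and s: "0 \<le> s" "s \<le> T"
    and \<eta>: "\<eta> \<in> borel_measurable (F s)" "\<And>\<omega>. \<omega> \<in> space M \<Longrightarrow> \<bar>\<eta> \<omega>\<bar> \<le> B"
    and zero: "\<And>t \<omega>. t \<in> {0..s} \<Longrightarrow> \<omega> \<in> space M \<Longrightarrow> H t \<omega> = 0"
  shows "has_W_integral (\<lambda>t \<omega>. \<eta> \<omega> * H t \<omega>) (\<lambda>\<omega>. \<eta> \<omega> * I \<omega>)"
  unfolding has_W_integral_def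
proof (intro conjI allI impI)
  note m = has_W_integral_measurable[OF 1]
  have \<eta>M: "\<eta> \<in> borel_measurable M" by (rule measurable_F_imp[OF \<eta>(1)])
  show "jointly_measurable (\<lambda>t \<omega>. \<eta> \<omega> * H t \<omega>)" "(\<lambda>\<omega>. \<eta> \<omega> * I \<omega>) \<in> borel_measurable M"
    using m \<eta>M by (auto intro: jointly_measurable_times jointly_measurable_rv)
  fix e :: real assume "0 < e"
  (* The integral of the part before s costs 2 d, the distance to I becomes 6 d, and the weight
     multiplies it by C; hence d is a fraction of e / C. *)
  define C where "C = max 1 (B\<^sup>2)"
  define d where "d = min 1 (e / (8 * C))"
  have C: "1 \<le> C" by (simp add: C_def)
  have d: "0 < d" "d \<le> 1" using C \<open>0 < e\<close> by (auto simp: d_def)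
  have "C * d \<le> C * (e / (8 * C))" using C by (intro mult_left_mono) (auto simp: d_def)
  then have Cd: "C * d \<le> e / 8" using C by simp
  from has_W_integral_obtain[OF 1, of "d * d"] d obtain G J where
    G: "elementary_integral F T W G J" "trunc_energy (\<lambda>t \<omega>. G t \<omega> - H t \<omega>) < d * d" "trunc_sq (\<lambda>\<omega>. J \<omega> - I \<omega>) < d * d" by auto
  from elementary_integral_restrict_scale[OF filtration_F G(1) s \<eta>] obtain J' where
    J': "elementary_integral F T W (\<lambda>u \<omega>. indicator {s<..} u * G u \<omega>) J'"
      "elementary_integral F T W (\<lambda>u \<omega>. \<eta> \<omega> * (indicator {s<..} u * G u \<omega>)) (\<lambda>\<omega>. \<eta> \<omega> * J' \<omega>)" by auto
  note n = elementary_integral_measurable[OF G(1)] elementary_integral_measurable[OF J'(1)]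
  have GH: "jointly_measurable (\<lambda>t \<omega>. G t \<omega> - H t \<omega>)" using n m by (auto intro: jointly_measurable_diff)
  have dd: "d * d \<le> d" using d mult_left_le[of d d] by simp
  have "trunc_energy (\<lambda>t \<omega>. G t \<omega> - indicator {s<..} t * G t \<omega>) \<le> max 1 (1\<^sup>2) * trunc_energy (\<lambda>t \<omega>. G t \<omega> - H t \<omega>)"
    by (rule trunc_energy_mono_scale[OF GH]) (use zero in \<open>auto simp: indicator_def\<close>)
  then have a: "trunc_energy (\<lambda>t \<omega>. G t \<omega> - indicator {s<..} t * G t \<omega>) < d * d" using G by simp
  have "trunc_sq (\<lambda>\<omega>. J \<omega> - J' \<omega>) \<le> trunc_energy (\<lambda>t \<omega>. G t \<omega> - indicator {s<..} t * G t \<omega>) / d + d"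
    by (rule elementary_integral_bound[OF elementary_integral_diff[OF G(1) J'(1)] d])
  also have "\<dots> \<le> 2 * d" using a d by (simp add: field_simps)
  finally have b: "trunc_sq (\<lambda>\<omega>. J \<omega> - J' \<omega>) \<le> 2 * d" .
  have "trunc_sq (\<lambda>\<omega>. J' \<omega> - J \<omega>) = trunc_sq (\<lambda>\<omega>. J \<omega> - J' \<omega>)" by (simp add: power2_commute)
  moreover have "trunc_sq (\<lambda>\<omega>. J' \<omega> - I \<omega>) \<le> 2 * trunc_sq (\<lambda>\<omega>. J' \<omega> - J \<omega>) + 2 * trunc_sq (\<lambda>\<omega>. J \<omega> - I \<omega>)"
    by (rule trunc_sq_add) (use m n in auto)
  ultimately have c: "trunc_sq (\<lambda>\<omega>. J' \<omega> - I \<omega>) < 6 * d" using b G(3) dd by linarith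
  have "trunc_sq (\<lambda>\<omega>. \<eta> \<omega> * J' \<omega> - \<eta> \<omega> * I \<omega>) \<le> C * trunc_sq (\<lambda>\<omega>. J' \<omega> - I \<omega>)"
    unfolding C_def
    by (rule trunc_sq_mono_scale)
      (use m n \<eta> in \<open>auto simp: abs_mult intro!: mult_right_mono simp flip: right_diff_distrib\<close>)
  also have "\<dots> \<le> C * (6 * d)" using C c by (intro mult_left_mono) auto
  finally have r1: "trunc_sq (\<lambda>\<omega>. \<eta> \<omega> * J' \<omega> - \<eta> \<omega> * I \<omega>) < e" using Cd \<open>0 < e\<close> by linarith
  have "\<bar>\<eta> \<omega> * (indicator {s<..} t * G t \<omega>) - \<eta> \<omega> * H t \<omega>\<bar> \<le> B * \<bar>G t \<omega> - H t \<omega>\<bar>"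
    if "t \<in> {0..T}" "\<omega> \<in> space M" for t \<omega>
  proof (cases "t \<le> s")
    case True
    have "0 \<le> B" using \<eta>(2)[OF that(2)] by linarith
    then show ?thesis using True that zero[of t \<omega>] by simp
  next
    case False
    then show ?thesis using \<eta>(2)[OF that(2)]
      by (auto simp: abs_mult intro!: mult_right_mono simp flip: right_diff_distrib)
  qed
  then have "trunc_energy (\<lambda>t \<omega>. \<eta> \<omega> * (indicator {s<..} t * G t \<omega>) - \<eta> \<omega> * H t \<omega>) \<le> C * trunc_energy (\<lambda>t \<omega>. G t \<omega> - H t \<omega>)"
    unfolding C_def by (rule trunc_energy_mono_scale[OF GH])
  also have "\<dots> \<le> C * d" using C G dd by (intro mult_left_mono) auto
  finally have r2: "trunc_energy (\<lambda>t \<omega>. \<eta> \<omega> * (indicator {s<..} t * G t \<omega>) - \<eta> \<omega> * H t \<omega>) < e" using Cd \<open>0 < e\<close> by linarith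
  show "\<exists>G J. elementary_integral F T W G J \<and> trunc_energy (\<lambda>t \<omega>. G t \<omega> - \<eta> \<omega> * H t \<omega>) < e \<and> trunc_sq (\<lambda>\<omega>. J \<omega> - \<eta> \<omega> * I \<omega>) < e"
    using J'(2) r1 r2 by blast
qed

lemma has_W_integral_cmult:
  assumes 1: "has_W_integral H I"
  shows "has_W_integral (\<lambda>t \<omega>. c * H t \<omega>) (\<lambda>\<omega>. c * I \<omega>)"
  unfolding has_W_integral_def
proof (intro conjI allI impI)
  note m = has_W_integral_measurable[OF 1]
  show "jointly_measurable (\<lambda>t \<omega>. c * H t \<omega>)" "(\<lambda>\<omega>. c * I \<omega>) \<in> borel_measurable M"
    using m jointly_measurable_times[OF jointly_measurable_rv[of "\<lambda>_. c"]] by auto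
  fix e :: real assume "0 < e"
  define C where "C = max 1 (\<bar>c\<bar>\<^sup>2)"
  have C: "1 \<le> C" by (simp add: C_def)
  from has_W_integral_obtain[OF 1, of "e / C"] C \<open>0 < e\<close> obtain G J where
    G: "elementary_integral F T W G J" "trunc_energy (\<lambda>t \<omega>. G t \<omega> - H t \<omega>) < e / C" "trunc_sq (\<lambda>\<omega>. J \<omega> - I \<omega>) < e / C" by auto
  note n = elementary_integral_measurable[OF G(1)]
  have "trunc_energy (\<lambda>t \<omega>. c * G t \<omega> - c * H t \<omega>) \<le> C * trunc_energy (\<lambda>t \<omega>. G t \<omega> - H t \<omega>)"
    unfolding C_def by (rule trunc_energy_mono_scale)
      (use m n in \<open>auto simp: abs_mult simp flip: right_diff_distrib intro: jointly_measurable_diff\<close>)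
  moreover have "trunc_sq (\<lambda>\<omega>. c * J \<omega> - c * I \<omega>) \<le> C * trunc_sq (\<lambda>\<omega>. J \<omega> - I \<omega>)"
    unfolding C_def by (rule trunc_sq_mono_scale) (use m n in \<open>auto simp: abs_mult simp flip: right_diff_distrib\<close>)
  ultimately show "\<exists>G J. elementary_integral F T W G J \<and> trunc_energy (\<lambda>t \<omega>. G t \<omega> - c * H t \<omega>) < e \<and> trunc_sq (\<lambda>\<omega>. J \<omega> - c * I \<omega>) < e"
    using elementary_integral_cmult[OF G(1), of c] G(2,3) C
    by (intro exI[of _ "\<lambda>t \<omega>. c * G t \<omega>"] exI[of _ "\<lambda>\<omega>. c * J \<omega>"]) (auto simp: field_simps)
qed

lemma has_W_integral_diff:
  assumes "has_W_integral H I" "has_W_integral H' I'"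
  shows "has_W_integral (\<lambda>t \<omega>. H t \<omega> - H' t \<omega>) (\<lambda>\<omega>. I \<omega> - I' \<omega>)"
  using has_W_integral_add[OF assms(1) has_W_integral_cmult[OF assms(2), of "-1"]] by simp

lemma has_W_integral_zero: "has_W_integral (\<lambda>t \<omega>. 0) (\<lambda>\<omega>. 0)"
  by (rule has_W_integral_elementary[OF elementary_integral.zero])

lemma has_W_integral_sum:
  assumes "finite J" "\<And>j. j \<in> J \<Longrightarrow> has_W_integral (H j) (I j)"
  shows "has_W_integral (\<lambda>t \<omega>. \<Sum>j\<in>J. H j t \<omega>) (\<lambda>\<omega>. \<Sum>j\<in>J. I j \<omega>)"
  using assms
proof (induction J rule: finite_induct)
  case (insert j J)
  then show ?case using has_W_integral_add[of "H j" "I j"] by simp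
qed (simp add: has_W_integral_zero)

text \<open>
With \<open>has_W_integral_diff\<close> this says that the integral depends continuously, in probability, on the
integrand, and in particular is almost surely unique.
\<close>

lemma has_W_integral_bound:
  assumes 1: "has_W_integral H I" and d: "0 < d" "d \<le> 1"
  shows "trunc_sq I \<le> 4 * trunc_energy H / d + 2 * d"
proof (rule field_le_epsilon)
  fix e :: real assume "0 < e"
  define \<eta> where "\<eta> = e * d / 8"
  have \<eta>: "0 < \<eta>" using d \<open>0 < e\<close> by (simp add: \<eta>_def)
  from has_W_integral_obtain[OF 1 this] obtain G J where
    G: "elementary_integral F T W G J" "trunc_energy (\<lambda>t \<omega>. G t \<omega> - H t \<omega>) < \<eta>" "trunc_sq (\<lambda>\<omega>. J \<omega> - I \<omega>) < \<eta>" .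
  note n = elementary_integral_measurable[OF G(1)] has_W_integral_measurable[OF 1]
  have "trunc_energy G \<le> 2 * trunc_energy (\<lambda>t \<omega>. G t \<omega> - H t \<omega>) + 2 * trunc_energy H"
    by (rule trunc_energy_add) (use n in \<open>auto intro: jointly_measurable_diff\<close>)
  also have "\<dots> \<le> 2 * \<eta> + 2 * trunc_energy H" using G by simp
  finally have "trunc_energy G / d \<le> (2 * \<eta> + 2 * trunc_energy H) / d" using d by (simp add: divide_right_mono)
  then have "trunc_sq J \<le> (2 * \<eta> + 2 * trunc_energy H) / d + d" (is "_ \<le> ?r")
    using elementary_integral_bound[OF G(1) d] by linarith
  moreover have "trunc_sq (\<lambda>\<omega>. I \<omega> - J \<omega>) < \<eta>" using G(3) by (simp only: power2_commute[of "I _"])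
  moreover have "trunc_sq I \<le> 2 * trunc_sq (\<lambda>\<omega>. I \<omega> - J \<omega>) + 2 * trunc_sq J"
    by (rule trunc_sq_add) (use n in auto)
  moreover have "x \<le> 2 * \<eta> + 2 * r" if "z \<le> r" "y < \<eta>" "x \<le> 2 * y + 2 * z" for x y z r :: real
    using that by linarith
  ultimately have "trunc_sq I \<le> 2 * \<eta> + 2 * ?r" by blast
  also have "\<dots> = 2 * \<eta> + 4 * (\<eta> / d) + 4 * trunc_energy H / d + 2 * d"
    using d by (simp add: field_simps)
  also have "\<eta> / d = e / 8" using d by (simp add: \<eta>_def)
  also have "2 * \<eta> \<le> e / 4" using d \<open>0 < e\<close> by (simp add: \<eta>_def mult_left_le)
  finally show "trunc_sq I \<le> 4 * trunc_energy H / d + 2 * d + e" using \<open>0 < e\<close> by simp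
qed

end

section \<open>Integrals with respect to the observed process\<close>

text \<open>
A continuous process is the pointwise limit of the processes that are observed only at the
times \<open>\<lfloor>(n + 1) u\<rfloor> / (n + 1)\<close>, and these depend measurably on time through an integer.
\<close>

lemma continuous_process_jointly_measurable:
  fixes V :: "real \<Rightarrow> 'a \<Rightarrow> real"
  assumes "0 \<le> t" and V[measurable]: "\<And>u. u \<in> {0..t} \<Longrightarrow> V u \<in> borel_measurable N"
    and cont: "\<And>\<omega>. \<omega> \<in> space N \<Longrightarrow> continuous_on {0..t} (\<lambda>u. V u \<omega>)"
  shows "(\<lambda>(u, \<omega>). V u \<omega>) \<in> borel_measurable (lebesgue_on {0..t} \<Otimes>\<^sub>M N)"
proof -
  define q where "q n u = max 0 (min t (real_of_int \<lfloor>real (Suc n) * u\<rfloor> / real (Suc n)))" for n u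
  have q_in: "q n u \<in> {0..t}" for n u using \<open>0 \<le> t\<close> by (auto simp: q_def)
  have q_lim: "(\<lambda>n. q n u) \<longlonglongrightarrow> u" if u: "u \<in> {0..t}" for u
  proof -
    have "(\<lambda>n. real_of_int \<lfloor>real (Suc n) * u\<rfloor> / real (Suc n)) \<longlonglongrightarrow> u"
    proof (rule tendsto_sandwich[where f="\<lambda>n. u - 1 / real (Suc n)" and h="\<lambda>n. u"])
      have le: "u - 1 / real (Suc n) \<le> real_of_int \<lfloor>real (Suc n) * u\<rfloor> / real (Suc n)" for n
      proof -
        have "real (Suc n) * u - 1 \<le> real_of_int \<lfloor>real (Suc n) * u\<rfloor>" by linarith
        then have "(real (Suc n) * u - 1) / real (Suc n) \<le> real_of_int \<lfloor>real (Suc n) * u\<rfloor> / real (Suc n)"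
          by (intro divide_right_mono) auto
        moreover have "(real (Suc n) * u - 1) / real (Suc n) = u - 1 / real (Suc n)"
          by (simp add: field_simps)
        ultimately show ?thesis by simp
      qed
      then show "\<forall>\<^sub>F n in sequentially. u - 1 / real (Suc n) \<le> real_of_int \<lfloor>real (Suc n) * u\<rfloor> / real (Suc n)" by simp
      have "real_of_int \<lfloor>real (Suc n) * u\<rfloor> / real (Suc n) \<le> u" for n
      proof -
        have "real_of_int \<lfloor>real (Suc n) * u\<rfloor> / real (Suc n) \<le> (real (Suc n) * u) / real (Suc n)"
          by (intro divide_right_mono) auto
        then show ?thesis by simp
      qed
      then show "\<forall>\<^sub>F n in sequentially. real_of_int \<lfloor>real (Suc n) * u\<rfloor> / real (Suc n) \<le> u" by simp
      show "(\<lambda>n. u - 1 / real (Suc n)) \<longlonglongrightarrow> u"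
        using tendsto_diff[OF tendsto_const[of u] LIMSEQ_inverse_real_of_nat] by (simp add: inverse_eq_divide)
    qed auto
    then have "(\<lambda>n. q n u) \<longlonglongrightarrow> max 0 (min t u)"
      unfolding q_def by (intro tendsto_intros)
    then show ?thesis using u by (simp add: max_absorb2 min_absorb2)
  qed
  show ?thesis
  proof (rule borel_measurable_LIMSEQ_real)
    show "(\<lambda>n. case p of (u, \<omega>) \<Rightarrow> V (q n u) \<omega>) \<longlonglongrightarrow> (case p of (u, \<omega>) \<Rightarrow> V u \<omega>)"
      if p: "p \<in> space (lebesgue_on {0..t} \<Otimes>\<^sub>M N)" for p
    proof -
      obtain u \<omega> where u: "p = (u, \<omega>)" "u \<in> {0..t}" "\<omega> \<in> space N"
        using p by (auto simp: space_pair_measure)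
      then show ?thesis
        using continuous_on_tendsto_compose[OF cont[OF u(3)] q_lim[OF u(2)] u(2)] q_in by simp
    qed
    fix n
    let ?V = "\<lambda>i p. V (max 0 (min t (real_of_int i / real (Suc n)))) (snd p)"
    have "(\<lambda>p. ?V \<lfloor>real (Suc n) * fst p\<rfloor> p) \<in> borel_measurable (lebesgue_on {0..t} \<Otimes>\<^sub>M N)"
    proof (rule measurable_compose_countable[where f="?V"])
      have [measurable]: "(\<lambda>u. u) \<in> borel_measurable (lebesgue_on {0..t})"
        by (intro measurable_restrict_space1 measurable_completion) simp
      show "(\<lambda>p. \<lfloor>real (Suc n) * fst p\<rfloor>) \<in> lebesgue_on {0..t} \<Otimes>\<^sub>M N \<rightarrow>\<^sub>M count_space UNIV"
        by measurable
      show "(\<lambda>p. V (max 0 (min t (real_of_int i / real (Suc n)))) (snd p)) \<in> borel_measurable (lebesgue_on {0..t} \<Otimes>\<^sub>M N)" for i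
        using \<open>0 \<le> t\<close> by (intro measurable_compose[OF measurable_snd] V) auto
    qed
    then show "(\<lambda>p. case p of (u, \<omega>) \<Rightarrow> V (q n u) \<omega>) \<in> borel_measurable (lebesgue_on {0..t} \<Otimes>\<^sub>M N)"
      by (simp add: q_def split_beta')
  qed
qed

lemma space_natural_filtration [simp]: "space (natural_filtration M X t) = space M"
  by (simp add: natural_filtration_def space_measure_of_conv)

lemma filtration_natural: "filtration (space M) (natural_filtration M X)"
proof
  have sub: "{X s -` A \<inter> space M | s A. s \<in> {0..t} \<and> A \<in> sets borel} \<subseteq> Pow (space M)" for t by auto
  show "space (natural_filtration M X i) = space M" for i
    by (rule space_natural_filtration)
  show "sets (natural_filtration M X i) \<subseteq> sets (natural_filtration M X j)" if "i \<le> j" for i j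
    unfolding natural_filtration_def sets_measure_of[OF sub]
    using that by (intro sigma_sets_mono') force
qed

lemma measurable_natural_filtration:
  assumes "s \<in> {0..t}"
  shows "X s \<in> borel_measurable (natural_filtration M X t)"
proof (rule measurableI)
  fix A :: "real set" assume "A \<in> sets borel"
  then have "X s -` A \<inter> space M \<in> sets (natural_filtration M X t)"
    using assms unfolding natural_filtration_def
    by (subst sets_measure_of) (auto intro!: sigma_sets.Basic)
  then show "X s -` A \<inter> space (natural_filtration M X t) \<in> sets (natural_filtration M X t)"
    by simp
qed auto

locale diffusion = wiener_space M F T W for M :: "'a measure" and F T W +
  fixes b s :: "real \<Rightarrow> real" and x0 :: real and X :: "real \<Rightarrow> 'a \<Rightarrow> real"
  assumes sde: "sde_solution M F W b s x0 T X"
    and b_cont: "continuous_on UNIV b" and s_cont: "continuous_on UNIV s"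
    and s_nonzero: "\<And>x. s x \<noteq> 0"
begin

abbreviation (input) "FX \<equiv> natural_filtration M X"
abbreviation (input) "Y \<equiv> drift_removed b X"

lemma X_measurable_F: "t \<in> {0..T} \<Longrightarrow> X t \<in> borel_measurable (F t)"
  and X_continuous: "\<omega> \<in> space M \<Longrightarrow> continuous_on {0..T} (\<lambda>t. X t \<omega>)"
  and X_integral: "t \<in> {0..T} \<Longrightarrow> has_ito_integral M F W (\<lambda>_ _. 1) t (\<lambda>u \<omega>. s (X u \<omega>)) (\<lambda>\<omega>. Y t \<omega> - x0)"
  using sde by (auto simp: sde_solution_def)

lemma FX_subset_F:
  assumes "t \<le> T" shows "sets (FX t) \<subseteq> sets (F t)"
  unfolding natural_filtration_def
proof (subst sets_measure_of, blast, subst space_F[of t, symmetric], rule sets.sigma_sets_subset, safe)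
  fix u and A :: "real set" assume u: "u \<in> {0..t}" and A: "A \<in> sets borel"
  have "X u \<in> borel_measurable (F t)"
    using X_measurable_F[of u] u assms by (auto intro: measurable_F_mono[of u t])
  from measurable_sets[OF this A] show "X u -` A \<inter> space M \<in> sets (F t)" by simp
qed

lemma FX_measurable_imp_F: "t \<le> T \<Longrightarrow> f \<in> borel_measurable (FX t) \<Longrightarrow> f \<in> borel_measurable (F t)"
  using FX_subset_F[of t]
  by (auto intro: measurable_mono[THEN subsetD, of borel borel "FX t" "F t"])

lemma X_composition:
  fixes g :: "real \<Rightarrow> real"
  assumes g: "continuous_on UNIV g"
  shows "u \<in> {0..t} \<Longrightarrow> (\<lambda>\<omega>. g (X u \<omega>)) \<in> borel_measurable (FX t)"
    and "\<omega> \<in> space M \<Longrightarrow> continuous_on {0..T} (\<lambda>u. g (X u \<omega>))"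
  using measurable_compose[OF measurable_natural_filtration borel_measurable_continuous_onI[OF g]]
    continuous_on_compose2[OF g X_continuous]
  by auto

lemma X_composition_jointly_measurable:
  fixes g :: "real \<Rightarrow> real"
  assumes g: "continuous_on UNIV g" and t: "t \<in> {0..T}"
  shows "(\<lambda>(u, \<omega>). g (X u \<omega>)) \<in> borel_measurable (lebesgue_on {0..t} \<Otimes>\<^sub>M FX t)"
proof (rule continuous_process_jointly_measurable)
  show "continuous_on {0..t} (\<lambda>u. g (X u \<omega>))" if "\<omega> \<in> space (FX t)" for \<omega>
    using that t by (intro continuous_on_subset[OF X_composition(2)[OF g]]) auto
qed (use t X_composition(1)[OF g] in auto)

lemma jointly_measurable_X:
  fixes g :: "real \<Rightarrow> real"
  assumes g: "continuous_on UNIV g"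
  shows "jointly_measurable (\<lambda>u \<omega>. g (X u \<omega>))"
  unfolding jointly_measurable_def
proof (rule continuous_process_jointly_measurable)
  show "(\<lambda>\<omega>. g (X u \<omega>)) \<in> borel_measurable M" if "u \<in> {0..T}" for u
    using that X_composition(1)[OF g that] measurable_F_imp[OF FX_measurable_imp_F[of T]] by auto
qed (use T_pos X_composition(2)[OF g] in auto)

lemma Y_measurable_FX:
  assumes t: "t \<in> {0..T}"
  shows "Y t \<in> borel_measurable (FX t)"
proof -
  interpret L: finite_measure "lebesgue_on {0..t}"
    by (rule finite_measure_lebesgue_on) simp
  have "(\<lambda>(\<omega>, u). b (X u \<omega>)) \<in> borel_measurable (FX t \<Otimes>\<^sub>M lebesgue_on {0..t})"
    using measurable_pair_swap[OF X_composition_jointly_measurable[OF b_cont t]] by simp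
  then have "(\<lambda>\<omega>. LINT u|lebesgue_on {0..t}. b (X u \<omega>)) \<in> borel_measurable (FX t)"
    by (rule L.borel_measurable_lebesgue_integral)
  then show ?thesis
    unfolding drift_removed_def[abs_def]
    using t by (intro borel_measurable_diff measurable_natural_filtration) auto
qed

text \<open>
This is the stochastic equation at time \<open>t\<close>, read on the fixed interval \<open>[0, T]\<close>: simple processes
with last grid point at most \<open>t\<close> vanish afterwards.
\<close>

lemma has_W_integral_Y:
  assumes t: "t \<in> {0..T}"
  shows "has_W_integral (\<lambda>u \<omega>. indicator {0..t} u * s (X u \<omega>)) (\<lambda>\<omega>. Y t \<omega> - x0)"
  unfolding has_W_integral_def
proof (intro conjI allI impI)
  show "jointly_measurable (\<lambda>u \<omega>. indicator {0..t} u * s (X u \<omega>))"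
    using t by (intro jointly_measurable_times jointly_measurable_time jointly_measurable_X s_cont borel_measurable_indicator)
      (auto simp: sets_restrict_space_iff)
  show "(\<lambda>\<omega>. Y t \<omega> - x0) \<in> borel_measurable M"
    using measurable_F_imp[OF FX_measurable_imp_F[OF _ Y_measurable_FX[OF t]]] t by auto
  fix e :: real assume "0 < e"
  obtain n \<tau> \<xi> where si: "\<And>k. simple_integrand F t (n k) (\<tau> k) (\<xi> k)" and
    nip1: "null_in_prob M (\<lambda>k \<omega>. \<integral>\<^sup>+ u. ennreal ((simple_process (n k) (\<tau> k) (\<xi> k) u \<omega> - s (X u \<omega>))\<^sup>2 * 1) \<partial>lebesgue_on {0..t})" and
    nip2: "null_in_prob M (\<lambda>k \<omega>. ennreal \<bar>simple_integral W (n k) (\<tau> k) (\<xi> k) \<omega> - (Y t \<omega> - x0)\<bar>)"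
    using X_integral[OF t] unfolding has_ito_integral_def by blast
  have lim1: "(\<lambda>k. trunc_mean M (\<lambda>\<omega>. \<integral>\<^sup>+ u. ennreal ((simple_process (n k) (\<tau> k) (\<xi> k) u \<omega> - s (X u \<omega>))\<^sup>2 * 1) \<partial>lebesgue_on {0..t})) \<longlonglongrightarrow> 0"
    and lim2: "(\<lambda>k. trunc_mean M (\<lambda>\<omega>. ennreal \<bar>simple_integral W (n k) (\<tau> k) (\<xi> k) \<omega> - (Y t \<omega> - x0)\<bar>)) \<longlonglongrightarrow> 0"
    using nip1 nip2 by (simp_all only: null_in_prob_iff_trunc_mean)
  obtain k where
    k1: "trunc_mean M (\<lambda>\<omega>. \<integral>\<^sup>+ u. ennreal ((simple_process (n k) (\<tau> k) (\<xi> k) u \<omega> - s (X u \<omega>))\<^sup>2 * 1) \<partial>lebesgue_on {0..t}) < e" and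
    k2: "trunc_mean M (\<lambda>\<omega>. ennreal \<bar>simple_integral W (n k) (\<tau> k) (\<xi> k) \<omega> - (Y t \<omega> - x0)\<bar>) < e"
    using eventually_happens[OF eventually_conj[OF order_tendstoD(2)[OF lim1 \<open>0 < e\<close>] order_tendstoD(2)[OF lim2 \<open>0 < e\<close>]]]
    by auto
  have siT: "simple_integrand F T (n k) (\<tau> k) (\<xi> k)"
    using si[of k] t by (auto simp: simple_integrand_def)
  let ?G = "simple_process (n k) (\<tau> k) (\<xi> k)" and ?J = "simple_integral W (n k) (\<tau> k) (\<xi> k)"
  have Gz: "?G u \<omega> = 0" if "t < u" for u \<omega>
    using si[of k] that by (intro simple_process_square(2)) (auto simp: simple_integrand_def)
  have "trunc_energy (\<lambda>u \<omega>. ?G u \<omega> - indicator {0..t} u * s (X u \<omega>)) = trunc_mean M (\<lambda>\<omega>. \<integral>\<^sup>+ u. ennreal ((?G u \<omega> - s (X u \<omega>))\<^sup>2 * 1) \<partial>lebesgue_on {0..t})"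
    unfolding trunc_energy_def
  proof (rule trunc_mean_cong)
    fix \<omega>
    have "energy T (\<lambda>u. ?G u \<omega> - indicator {0..t} u * s (X u \<omega>))
        = (\<integral>\<^sup>+ u. ennreal ((?G u \<omega> - indicator {0..t} u * s (X u \<omega>))\<^sup>2) * indicator {0..T} u \<partial>lebesgue)"
      by (subst nn_integral_restrict_space) auto
    also have "\<dots> = (\<integral>\<^sup>+ u. ennreal ((?G u \<omega> - s (X u \<omega>))\<^sup>2 * 1) * indicator {0..t} u \<partial>lebesgue)"
      using t Gz by (intro nn_integral_cong) (auto simp: indicator_def not_le)
    also have "\<dots> = (\<integral>\<^sup>+ u. ennreal ((?G u \<omega> - s (X u \<omega>))\<^sup>2 * 1) \<partial>lebesgue_on {0..t})"
      by (subst nn_integral_restrict_space) auto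
    finally show "energy T (\<lambda>u. ?G u \<omega> - indicator {0..t} u * s (X u \<omega>)) = \<dots>" .
  qed
  moreover have "trunc_sq (\<lambda>\<omega>. ?J \<omega> - (Y t \<omega> - x0)) < e"
    using trunc_mean_square_le_abs k2 by (rule le_less_trans)
  ultimately show "\<exists>G J. elementary_integral F T W G J \<and> trunc_energy (\<lambda>u \<omega>. G u \<omega> - indicator {0..t} u * s (X u \<omega>)) < e
      \<and> trunc_sq (\<lambda>\<omega>. J \<omega> - (Y t \<omega> - x0)) < e"
    using elementary_integral_simple[OF siT, of W] k1
    by (intro exI[of _ ?G] exI[of _ ?J] conjI) simp_all
qed

lemma has_W_integral_Y_increment:
  assumes uv: "0 \<le> u" "u \<le> v" "v \<le> T"
    and \<xi>: "\<xi> \<in> borel_measurable (F u)" "\<And>\<omega>. \<omega> \<in> space M \<Longrightarrow> \<bar>\<xi> \<omega>\<bar> \<le> B"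
  shows "has_W_integral (\<lambda>r \<omega>. \<xi> \<omega> * (indicator {u<..v} r * s (X r \<omega>))) (\<lambda>\<omega>. \<xi> \<omega> * (Y v \<omega> - Y u \<omega>))"
proof (rule has_W_integral_scale[OF _ uv(1) _ \<xi>])
  show "has_W_integral (\<lambda>r \<omega>. indicator {u<..v} r * s (X r \<omega>)) (\<lambda>\<omega>. Y v \<omega> - Y u \<omega>)"
    by (rule has_W_integral_cong[OF has_W_integral_diff[OF has_W_integral_Y[of v] has_W_integral_Y[of u]]]) (use uv in \<open>auto simp: indicator_def\<close>)
qed (use uv in auto)

text \<open>
The rule \<open>dY = s(X) dW\<close> for integrands that are adapted to the observations, which generate a smaller
filtration than the one to which \<open>W\<close> belongs.
\<close>

lemma has_W_integral_of_elementary_Y: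
  assumes "elementary_integral FX T Y H J"
  shows "has_W_integral (\<lambda>r \<omega>. H r \<omega> * s (X r \<omega>)) J"
  using assms
proof induction
  case zero
  then show ?case using has_W_integral_zero by simp
next
  case (step u v \<xi> B)
  have "\<xi> \<in> borel_measurable (F u)" using step by (intro FX_measurable_imp_F) auto
  from has_W_integral_Y_increment[OF step(1-3) this, of B] step(5) show ?case by (simp add: mult.assoc)
next
  case (add H J H' J')
  then show ?case using has_W_integral_add[OF add.IH] by (simp add: distrib_right)
qed

lemma measurable_FX_imp_M: "f \<in> borel_measurable (FX T) \<Longrightarrow> f \<in> borel_measurable M"
  by (rule measurable_F_imp[OF FX_measurable_imp_F]) auto

lemma weighted_square_eq: "(h - f / s x)\<^sup>2 * (s x)\<^sup>2 = (h * s x - f)\<^sup>2"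
  using s_nonzero[of x] by (simp add: left_diff_distrib flip: power_mult_distrib)

text \<open>
Approximating \<open>f / s(X)\<close> with respect to \<open>d\<langle>Y\<rangle> = s(X)\<^sup>2 dt\<close> by \<open>H\<close> is the same as approximating
\<open>f\<close> with respect to \<open>dt\<close> by \<open>H s(X)\<close>.  So the observed integral is an integral of the deterministic
function \<open>f\<close> against \<open>W\<close>.
\<close>

lemma has_W_integral_observed_integral:
  assumes f: "f \<in> borel_measurable (lebesgue_on {0..T})"
    and I: "has_ito_integral M FX Y (\<lambda>t \<omega>. (s (X t \<omega>))\<^sup>2) T (\<lambda>t \<omega>. f t / s (X t \<omega>)) I"
  shows "has_W_integral (\<lambda>t \<omega>. f t) I"
proof (rule has_W_integral_limit)
  show "jointly_measurable (\<lambda>t \<omega>. f t)" by (rule jointly_measurable_time[OF f])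
  show "I \<in> borel_measurable M" using I by (auto simp: has_ito_integral_def intro: measurable_FX_imp_M)
  fix e :: real assume "0 < e"
  obtain n \<tau> \<xi> where si: "\<And>k. simple_integrand FX T (n k) (\<tau> k) (\<xi> k)" and
    nip: "null_in_prob M (\<lambda>k \<omega>. \<integral>\<^sup>+ u. ennreal ((simple_process (n k) (\<tau> k) (\<xi> k) u \<omega> - f u / s (X u \<omega>))\<^sup>2 * (s (X u \<omega>))\<^sup>2) \<partial>lebesgue_on {0..T})"
      "null_in_prob M (\<lambda>k \<omega>. ennreal \<bar>simple_integral Y (n k) (\<tau> k) (\<xi> k) \<omega> - I \<omega>\<bar>)"
    using I unfolding has_ito_integral_def by blast
  have lim1: "(\<lambda>k. trunc_energy (\<lambda>u \<omega>. simple_process (n k) (\<tau> k) (\<xi> k) u \<omega> * s (X u \<omega>) - f u)) \<longlonglongrightarrow> 0"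
    and lim2: "(\<lambda>k. trunc_mean M (\<lambda>\<omega>. ennreal \<bar>simple_integral Y (n k) (\<tau> k) (\<xi> k) \<omega> - I \<omega>\<bar>)) \<longlonglongrightarrow> 0"
    using nip by (simp_all only: null_in_prob_iff_trunc_mean trunc_energy_def weighted_square_eq)
  obtain k where
    k1: "trunc_energy (\<lambda>u \<omega>. simple_process (n k) (\<tau> k) (\<xi> k) u \<omega> * s (X u \<omega>) - f u) < e" and
    k2: "trunc_mean M (\<lambda>\<omega>. ennreal \<bar>simple_integral Y (n k) (\<tau> k) (\<xi> k) \<omega> - I \<omega>\<bar>) < e"
    using eventually_happens[OF eventually_conj[OF order_tendstoD(2)[OF lim1 \<open>0 < e\<close>] order_tendstoD(2)[OF lim2 \<open>0 < e\<close>]]]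
    by auto
  have "trunc_sq (\<lambda>\<omega>. simple_integral Y (n k) (\<tau> k) (\<xi> k) \<omega> - I \<omega>) < e"
    using trunc_mean_square_le_abs k2 by (rule le_less_trans)
  then show "\<exists>H' I'. has_W_integral H' I' \<and> trunc_energy (\<lambda>t \<omega>. H' t \<omega> - f t) < e \<and> trunc_sq (\<lambda>\<omega>. I' \<omega> - I \<omega>) < e"
    using has_W_integral_of_elementary_Y[OF elementary_integral_simple[OF si[of k]]] k1
    by (intro exI[of _ "\<lambda>r \<omega>. simple_process (n k) (\<tau> k) (\<xi> k) r \<omega> * s (X r \<omega>)"] exI conjI)
qed

end

section \<open>Approximation by step processes\<close>

lemma finite_measure_lebesgue_on_interval: "finite_measure (lebesgue_on {0..T::real})"
  by (rule finite_measure_lebesgue_on) simp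

lemma continuous_measurable_lebesgue_on:
  fixes g :: "real \<Rightarrow> real"
  assumes "continuous_on UNIV g" shows "g \<in> borel_measurable (lebesgue_on A)"
  using borel_measurable_continuous_onI[OF assms] by (intro measurable_restrict_space1 measurable_completion) simp

lemma AE_lebesgue_on_nonzero: "AE t in lebesgue_on {0..T}. t \<noteq> (0::real)"
proof -
  have "AE t in lebesgue. t \<notin> {0::real}"
    by (rule AE_not_in) (simp flip: negligible_iff_null_sets)
  then show ?thesis by (auto simp: AE_restrict_space_iff elim: eventually_mono)
qed

lemma bounded_L2_limit:
  fixes g :: "nat \<Rightarrow> real \<Rightarrow> real" and T :: real
  assumes [measurable]: "\<And>n. g n \<in> borel_measurable (lebesgue_on {0..T})" "f \<in> borel_measurable (lebesgue_on {0..T})"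
    and bound: "\<And>n t. t \<in> {0..T} \<Longrightarrow> \<bar>g n t\<bar> \<le> B" 
    and lim: "AE t in lebesgue_on {0..T}. (\<lambda>n. g n t) \<longlonglongrightarrow> f t"
  shows "(\<lambda>n. energy T (\<lambda>t. g n t - f t)) \<longlonglongrightarrow> 0"
proof -
  interpret L: finite_measure "lebesgue_on {0..T}" by (rule finite_measure_lebesgue_on_interval)
  have fb: "AE t in lebesgue_on {0..T}. \<bar>f t\<bar> \<le> B"
    using lim AE_space
  proof eventually_elim
    case (elim t)
    then show ?case
      using bound[of t] by (intro LIMSEQ_le_const2[OF tendsto_rabs[of _ "f t"]]) auto
  qed
  have "(\<lambda>n. energy T (\<lambda>t. g n t - f t)) \<longlonglongrightarrow> (\<integral>\<^sup>+ t. 0 \<partial>lebesgue_on {0..T})"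
  proof (rule nn_integral_dominated_convergence[where w="\<lambda>_. ennreal ((2 * B)\<^sup>2)"])
    show "AE t in lebesgue_on {0..T}. ennreal ((g n t - f t)\<^sup>2) \<le> ennreal ((2 * B)\<^sup>2)" for n
      using fb AE_space
    proof eventually_elim
      case (elim t)
      then have "\<bar>g n t - f t\<bar> \<le> 2 * B" using bound[of t n] by auto
      then have "(g n t - f t)\<^sup>2 \<le> (2 * B)\<^sup>2" by (metis abs_ge_zero power2_abs power_mono)
      then show ?case by (rule ennreal_leI)
    qed
    show "energy T (\<lambda>t. 2 * B) < \<infinity>"
    proof -
      have "emeasure (lebesgue_on {0..T}) {0..T} < \<top>"
        using L.emeasure_finite[of "{0..T}"] by (rule less_top[THEN iffD1])
      then show ?thesis by (simp add: ennreal_mult_less_top)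
    qed
    show "AE t in lebesgue_on {0..T}. (\<lambda>n. ennreal ((g n t - f t)\<^sup>2)) \<longlonglongrightarrow> 0"
      using lim
    proof eventually_elim
      case (elim t)
      have "(\<lambda>n. (g n t - f t)\<^sup>2) \<longlonglongrightarrow> (f t - f t)\<^sup>2" by (intro tendsto_intros elim)
      then show ?case using tendsto_ennrealI by fastforce
    qed
  qed auto
  then show ?thesis by simp
qed

lemma nn_integral_square_triangle:
  fixes f :: "'a \<Rightarrow> real"
  assumes [measurable]: "f \<in> borel_measurable N" "g \<in> borel_measurable N" "h \<in> borel_measurable N"
  shows "(\<integral>\<^sup>+ t. ennreal ((f t - h t)\<^sup>2) \<partial>N) \<le> 2 * (\<integral>\<^sup>+ t. ennreal ((f t - g t)\<^sup>2) \<partial>N) + 2 * (\<integral>\<^sup>+ t. ennreal ((g t - h t)\<^sup>2) \<partial>N)"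
proof -
  have "(f t - h t)\<^sup>2 \<le> 2 * (f t - g t)\<^sup>2 + 2 * (g t - h t)\<^sup>2" for t
    using sum_squares_bound[of "f t - g t" "g t - h t"] power2_sum[of "f t - g t" "g t - h t"] by simp
  then have "(\<integral>\<^sup>+ t. ennreal ((f t - h t)\<^sup>2) \<partial>N) \<le> (\<integral>\<^sup>+ t. ennreal (2 * (f t - g t)\<^sup>2 + 2 * (g t - h t)\<^sup>2) \<partial>N)"
    by (intro nn_integral_mono ennreal_leI)
  also have "\<dots> = (\<integral>\<^sup>+ t. 2 * ennreal ((f t - g t)\<^sup>2) + 2 * ennreal ((g t - h t)\<^sup>2) \<partial>N)"
    by (simp only: ennreal_twice_add_twice zero_le_power2)
  also have "\<dots> = 2 * (\<integral>\<^sup>+ t. ennreal ((f t - g t)\<^sup>2) \<partial>N) + 2 * (\<integral>\<^sup>+ t. ennreal ((g t - h t)\<^sup>2) \<partial>N)"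
    by (simp add: nn_integral_add nn_integral_cmult)
  finally show ?thesis .
qed

definition clip :: "real \<Rightarrow> real \<Rightarrow> real" where "clip c x = max (- c) (min c x)"

lemma abs_clip_le: "\<bar>clip c x\<bar> \<le> \<bar>c\<bar>" "0 \<le> c \<Longrightarrow> \<bar>clip c x\<bar> \<le> \<bar>x\<bar>"
  and clip_eq: "\<bar>x\<bar> \<le> c \<Longrightarrow> clip c x = x"
  by (auto simp: clip_def)

lemma clip_measurable [measurable]: "clip c \<in> borel_measurable borel"
  by (simp add: clip_def[abs_def])

text \<open>
First \<open>f\<close> is replaced by a bounded function.  A measurable function is an almost everywhere limit of
continuous ones, and after clipping them at the same bound dominated convergence applies.
\<close>

lemma continuous_dense_L2:
  assumes "L2_fun T f" and e: "0 < e"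
  shows "\<exists>g. continuous_on UNIV g \<and> energy T (\<lambda>t. g t - f t) < e"
proof -
  let ?L = "lebesgue_on {0..T}"
  have [measurable]: "f \<in> borel_measurable ?L" and int: "integrable ?L (\<lambda>t. (f t)\<^sup>2)"
    using assms by (auto simp: L2_fun_def)
  note contm = continuous_measurable_lebesgue_on[of _ "{0..T}"]
  obtain d where d: "0 < d" "4 * d \<le> (e::ennreal)" "d < \<top>"
  proof (cases e)
    case (real r)
    then show ?thesis using e by (intro that[of "ennreal (r / 4)"]) (auto simp: ennreal_mult'[symmetric] simp flip: ennreal_numeral)
  next
    case top
    then show ?thesis by (intro that[of 1]) auto
  qed
  have "(\<lambda>n. energy T (\<lambda>t. clip (real n) (f t) - f t)) \<longlonglongrightarrow> (\<integral>\<^sup>+ t. 0 \<partial>?L)"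
  proof (rule nn_integral_dominated_convergence[where w="\<lambda>t. ennreal (4 * (f t)\<^sup>2)"])
    show "AE t in ?L. ennreal ((clip (real n) (f t) - f t)\<^sup>2) \<le> ennreal (4 * (f t)\<^sup>2)" for n
    proof (intro AE_I2 ennreal_leI)
      fix t
      have "\<bar>clip (real n) (f t) - f t\<bar> \<le> 2 * \<bar>f t\<bar>" using abs_clip_le(2)[of "real n" "f t"] by auto
      then have "\<bar>clip (real n) (f t) - f t\<bar>\<^sup>2 \<le> (2 * \<bar>f t\<bar>)\<^sup>2" by (rule power_mono) simp
      then show "(clip (real n) (f t) - f t)\<^sup>2 \<le> 4 * (f t)\<^sup>2" by (simp add: power_mult_distrib)
    qed
    have "(\<integral>\<^sup>+ t. ennreal (4 * (f t)\<^sup>2) \<partial>?L) = ennreal (LINT t|?L. 4 * (f t)\<^sup>2)"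
      using int by (intro nn_integral_eq_integral) auto
    then show "(\<integral>\<^sup>+ t. ennreal (4 * (f t)\<^sup>2) \<partial>?L) < \<infinity>" by simp
    show "AE t in ?L. (\<lambda>n. ennreal ((clip (real n) (f t) - f t)\<^sup>2)) \<longlonglongrightarrow> 0"
    proof (rule AE_I2)
      fix t
      have "\<forall>\<^sub>F n in sequentially. clip (real n) (f t) = f t"
        using eventually_ge_at_top[of "nat \<lceil>\<bar>f t\<bar>\<rceil>"]
        by eventually_elim (auto intro!: clip_eq simp: nat_ceiling_le_eq)
      then have "\<forall>\<^sub>F n in sequentially. 0 = ennreal ((clip (real n) (f t) - f t)\<^sup>2)"
        by eventually_elim simp
      then show "(\<lambda>n. ennreal ((clip (real n) (f t) - f t)\<^sup>2)) \<longlonglongrightarrow> 0"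
        by (rule Lim_transform_eventually[OF tendsto_const])
    qed
  qed auto
  then have "(\<lambda>n. energy T (\<lambda>t. clip (real n) (f t) - f t)) \<longlonglongrightarrow> 0" by simp
  from eventually_happens[OF order_tendstoD(2)[OF this d(1)]] obtain N where
    N: "energy T (\<lambda>t. clip (real N) (f t) - f t) < d" by auto
  have "f measurable_on {0..T}" by (subst measurable_on_iff_borel_measurable) auto
  then obtain Z g where Z: "negligible Z" and g: "\<And>n. continuous_on UNIV (g n)"
    and lim: "\<And>x. x \<notin> Z \<Longrightarrow> (\<lambda>n. g n x) \<longlonglongrightarrow> (if x \<in> {0..T} then f x else 0)"
    unfolding measurable_on_def by blast
  have gc: "continuous_on UNIV (\<lambda>t. clip (real N) (g n t))" for n
    unfolding clip_def by (intro continuous_intros g)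
  have "(\<lambda>n. energy T (\<lambda>t. clip (real N) (g n t) - clip (real N) (f t))) \<longlonglongrightarrow> 0"
  proof (rule bounded_L2_limit)
    have "AE t in lebesgue. t \<notin> Z" using Z by (auto simp: negligible_iff_null_sets intro: AE_not_in)
    then have "AE t in ?L. t \<notin> Z" by (auto simp: AE_restrict_space_iff elim: eventually_mono)
    then show "AE t in ?L. (\<lambda>n. clip (real N) (g n t)) \<longlonglongrightarrow> clip (real N) (f t)"
      using AE_space
    proof eventually_elim
      case (elim t)
      then have "(\<lambda>n. g n t) \<longlonglongrightarrow> f t" using lim[of t] by simp
      then show ?case unfolding clip_def by (intro tendsto_intros)
    qed
    show "\<bar>clip (real N) (g n t)\<bar> \<le> real N" for n t using abs_clip_le(1)[of "real N"] by simp
  qed (use contm gc in auto)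
  from eventually_happens[OF order_tendstoD(2)[OF this d(1)]] obtain n where
    n: "energy T (\<lambda>t. clip (real N) (g n t) - clip (real N) (f t)) < d" by auto
  have "energy T (\<lambda>t. clip (real N) (g n t) - f t)
      \<le> 2 * energy T (\<lambda>t. clip (real N) (g n t) - clip (real N) (f t))
        + 2 * energy T (\<lambda>t. clip (real N) (f t) - f t)"
    using contm[OF gc] by (intro nn_integral_square_triangle) auto
  also have "\<dots> < 2 * d + 2 * d"
    using n N d by (intro add_strict_mono) (auto simp: ennreal_mult_strict_left_mono)
  also have "\<dots> = 4 * d" by (simp flip: distrib_right)
  also have "\<dots> \<le> e" by (rule d(2))
  finally show ?thesis using gc by blast
qed

text \<open>
Samples of the process \<open>V\<close> at the points \<open>T i / n\<close>.  Simple integrands must have bounded weights; the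
clipping level \<open>n\<close> ensures this and, on a bounded path, is inactive for all large \<open>n\<close>.
\<close>

definition riemann_weights :: "real \<Rightarrow> nat \<Rightarrow> (real \<Rightarrow> 'a \<Rightarrow> real) \<Rightarrow> nat \<Rightarrow> 'a \<Rightarrow> real" where
  "riemann_weights T n V i \<omega> = clip (real n) (V (T * real i / real n) \<omega>)"

abbreviation riemann_process :: "real \<Rightarrow> nat \<Rightarrow> (real \<Rightarrow> 'a \<Rightarrow> real) \<Rightarrow> real \<Rightarrow> 'a \<Rightarrow> real" where
  "riemann_process T n V \<equiv> simple_process n (\<lambda>i. T * real i / real n) (riemann_weights T n V)"

lemma grid_point_in:
  assumes "0 < (T::real)" "i \<le> n" shows "T * real i / real n \<in> {0..T}"
proof (cases "n = 0")
  case False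
  have "T * real i \<le> T * real n" using assms by (intro mult_left_mono) auto
  then show ?thesis using assms False by (auto simp: divide_le_eq)
qed (use assms in auto)

lemma riemann_simple_integrand:
  assumes T: "0 < T" and V: "\<And>t. t \<in> {0..T} \<Longrightarrow> V t \<in> borel_measurable (G t)"
  shows "simple_integrand G T n (\<lambda>i. T * real i / real n) (riemann_weights T n V)"
  unfolding simple_integrand_def
proof (intro conjI allI impI)
  fix i assume i: "i < n"
  have [measurable]: "V (T * real i / real n) \<in> borel_measurable (G (T * real i / real n))"
    using V grid_point_in[OF T, of i n] i by auto
  show "riemann_weights T n V i \<in> borel_measurable (G (T * real i / real n))"
    unfolding riemann_weights_def[abs_def] by measurable
  show "\<exists>B. \<forall>\<omega>\<in>space (G (T * real i / real n)). \<bar>riemann_weights T n V i \<omega>\<bar> \<le> B"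
    using abs_clip_le(1) by (auto simp: riemann_weights_def)
  show "T * real i / real n \<le> T * real (Suc i) / real n"
    using T by (intro divide_right_mono mult_left_mono) auto
qed (use grid_point_in[OF T, of 0 n] grid_point_in[OF T, of n n] in auto)

lemma riemann_process_at:
  assumes T: "0 < T" and n: "0 < n" and t: "t \<in> {0<..T}"
  obtains u where "u \<in> {0..T}" "\<bar>u - t\<bar> \<le> T / real n" "riemann_process T n V t \<omega> = clip (real n) (V u \<omega>)"
proof -
  (* The cell ]T k / n, T (k + 1) / n] that contains t. *)
  define k where "k = nat (\<lceil>t * real n / T\<rceil> - 1)"
  have pos: "0 < t * real n / T" using assms by auto
  then have "1 \<le> \<lceil>t * real n / T\<rceil>" by linarith
  then have "real k = real_of_int \<lceil>t * real n / T\<rceil> - 1" by (simp add: k_def)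
  then have k: "real k < t * real n / T" "t * real n / T \<le> real k + 1" by linarith+
  have "t * real n / T \<le> real n" using assms by (simp add: divide_le_eq)
  then have kn: "k < n" using k by linarith
  let ?p = "\<lambda>i. T * real i / real n"
  have ink: "?p k < t" "t \<le> ?p (Suc k)" using k T n by (auto simp: field_simps)
  have uniq: "indicator {?p i<..?p (Suc i)} t = (if i = k then 1 else 0 :: real)" for i
  proof -
    have "i = k" if "?p i < t" "t \<le> ?p (Suc i)"
    proof -
      have "real i < t * real n / T" "t * real n / T \<le> real i + 1" using that T n by (auto simp: field_simps)
      then have "real i < real k + 1" "real k < real i + 1" using k by linarith+
      then show ?thesis by linarith
    qed
    then have "t \<in> {?p i<..?p (Suc i)} \<longleftrightarrow> i = k"
      using ink by (metis greaterThanAtMost_iff)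
    then show ?thesis by (simp only: indicator_def of_bool_def)
  qed
  have "riemann_process T n V t \<omega> = clip (real n) (V (?p k) \<omega>)"
    unfolding simple_process_def uniq using kn by (simp add: riemann_weights_def if_distrib sum.delta cong: if_cong)
  moreover have "\<bar>?p k - t\<bar> \<le> T / real n"
  proof -
    have "?p (Suc k) = ?p k + T / real n" by (simp add: distrib_left add_divide_distrib)
    then show ?thesis using ink by linarith
  qed
  ultimately show thesis using that grid_point_in[OF T, of k n] kn by auto
qed

text \<open>
The time \<open>t = 0\<close> lies in no cell, so there the processes vanish and the limit is in general wrong.
\<close>

lemma riemann_process_limit:
  assumes T: "0 < T" and cont: "continuous_on {0..T} (\<lambda>t. V t \<omega>)"
  shows "t \<in> {0<..T} \<Longrightarrow> (\<lambda>n. riemann_process T n V t \<omega>) \<longlonglongrightarrow> V t \<omega>"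
    and "\<exists>B. \<forall>n. \<forall>t\<in>{0..T}. \<bar>riemann_process T n V t \<omega>\<bar> \<le> B"
proof -
  have "compact ((\<lambda>t. V t \<omega>) ` {0..T})" by (rule compact_continuous_image[OF cont]) simp
  then have "bounded ((\<lambda>t. V t \<omega>) ` {0..T})" by (rule compact_imp_bounded)
  then obtain B where "\<forall>x\<in>(\<lambda>t. V t \<omega>) ` {0..T}. norm x \<le> B" unfolding bounded_iff by blast
  then have B: "\<bar>V t \<omega>\<bar> \<le> B" if "t \<in> {0..T}" for t using that by auto
  have B0: "0 \<le> B" using B[of 0] T by auto
  have "\<bar>riemann_process T n V t \<omega>\<bar> \<le> B" if "t \<in> {0..T}" for n t
  proof (cases "0 < n \<and> t \<noteq> 0")
    case True
    then have "t \<in> {0<..T}" "0 < n" using that by auto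
    from riemann_process_at[OF T this(2,1), of V \<omega>] obtain u where u: "u \<in> {0..T}"
      "\<bar>u - t\<bar> \<le> T / real n" "riemann_process T n V t \<omega> = clip (real n) (V u \<omega>)" .
    then show ?thesis using abs_clip_le(2)[of "real n" "V u \<omega>"] B[OF u(1)] by simp
  next
    case False
    have "riemann_process T n V 0 \<omega> = 0"
      unfolding simple_process_def using T by (intro sum.neutral) (auto simp: indicator_def not_less)
    then show ?thesis using False B0 by (auto simp: simple_process_def)
  qed
  then show "\<exists>B. \<forall>n. \<forall>t\<in>{0..T}. \<bar>riemann_process T n V t \<omega>\<bar> \<le> B" by blast
  assume t: "t \<in> {0<..T}"
  have "\<exists>u. u \<in> {0..T} \<and> \<bar>u - t\<bar> \<le> T / real (Suc n) \<and> riemann_process T (Suc n) V t \<omega> = clip (real (Suc n)) (V u \<omega>)" for n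
    by (rule riemann_process_at[OF T zero_less_Suc t, of n V \<omega>]) (rule exI conjI | assumption)+
  then obtain u where u: "\<And>n. u n \<in> {0..T}" "\<And>n. \<bar>u n - t\<bar> \<le> T / real (Suc n)"
    "\<And>n. riemann_process T (Suc n) V t \<omega> = clip (real (Suc n)) (V (u n) \<omega>)" by metis
  have "(\<lambda>n. u n - t) \<longlonglongrightarrow> 0"
  proof (rule Lim_null_comparison)
    show "\<forall>\<^sub>F n in sequentially. norm (u n - t) \<le> T / real (Suc n)" using u(2) by simp
    show "(\<lambda>n. T / real (Suc n)) \<longlonglongrightarrow> 0"
      using tendsto_mult[OF tendsto_const[of T] LIMSEQ_inverse_real_of_nat] by (simp add: divide_inverse)
  qed
  then have ut: "u \<longlonglongrightarrow> t" by (simp add: LIM_zero_iff)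
  have "(\<lambda>n. V (u n) \<omega>) \<longlonglongrightarrow> V t \<omega>"
    using continuous_on_tendsto_compose[OF cont ut] t u(1) by auto
  moreover have "\<forall>\<^sub>F n in sequentially. V (u n) \<omega> = riemann_process T (Suc n) V t \<omega>"
    using eventually_ge_at_top[of "nat \<lceil>B\<rceil>"]
  proof eventually_elim
    case (elim n)
    then have "B \<le> real (Suc n)" by (simp add: nat_ceiling_le_eq)
    then have "clip (real (Suc n)) (V (u n) \<omega>) = V (u n) \<omega>"
      using B[OF u(1)[of n]] by (intro clip_eq) simp
    then show ?case by (simp only: u(3))
  qed
  ultimately have "(\<lambda>n. riemann_process T (Suc n) V t \<omega>) \<longlonglongrightarrow> V t \<omega>"
    by (rule Lim_transform_eventually)
  then show "(\<lambda>n. riemann_process T n V t \<omega>) \<longlonglongrightarrow> V t \<omega>" by (rule LIMSEQ_imp_Suc)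
qed

section \<open>Existence of the observed integrals\<close>

context wiener_space
begin

lemma trunc_mean_const: "trunc_mean M (\<lambda>_. c) = enn2real (min 1 c)"
  by (simp add: trunc_mean_def emeasure_space_1)

lemma trunc_energy_deterministic_le:
  assumes "energy T (\<lambda>t. f t) < ennreal e" "0 < e"
  shows "trunc_energy (\<lambda>t \<omega>. f t) < e"
proof -
  let ?c = "energy T (\<lambda>t. f t)"
  have "ennreal (enn2real (min 1 ?c)) = min 1 ?c" by (rule ennreal_enn2real) (simp add: min_less_iff_disj)
  then have "ennreal (enn2real (min 1 ?c)) < ennreal e" using assms(1) by (simp add: min_less_iff_disj)
  then show ?thesis unfolding trunc_energy_def trunc_mean_const by (simp add: ennreal_less_iff)
qed

lemma trunc_energy_diff_commute: "trunc_energy (\<lambda>t \<omega>. H t \<omega> - H' t \<omega>) = trunc_energy (\<lambda>t \<omega>. H' t \<omega> - H t \<omega>)"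
  by (rule trunc_energy_cong) (simp add: power2_commute)

text \<open>
By the Borel-Cantelli lemma the increments are almost surely summable.  The limit is taken path by
path, so it is measurable with respect to \<open>G\<close> itself and not only to its completion.
\<close>

lemma AE_limit_of_fast_Cauchy:
  fixes J :: "nat \<Rightarrow> 'a \<Rightarrow> real"
  assumes J: "\<And>k. J k \<in> borel_measurable G" "sets G \<subseteq> sets M" "space G = space M"
    and small: "\<And>k. trunc_sq (\<lambda>\<omega>. J (Suc k) \<omega> - J k \<omega>) \<le> C * (1/8) ^ k"
  shows "\<exists>I \<in> borel_measurable G. AE \<omega> in M. (\<lambda>k. J k \<omega>) \<longlonglongrightarrow> I \<omega>"
proof (rule bexI)
  have JM[measurable]: "J k \<in> borel_measurable M" for k
    using J by (auto intro: measurable_mono[THEN subsetD, of borel borel G M])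
  define A where "A k = {\<omega>\<in>space M. ennreal ((J (Suc k) \<omega> - J k \<omega>)\<^sup>2) > ennreal ((1/4) ^ k)}" for k
  have [measurable]: "A k \<in> sets M" for k by (simp add: A_def)
  (* Markov's inequality at the level (1/2) ^ k for the increment, that is (1/4) ^ k for its square. *)
  have PA: "prob (A k) \<le> C * (1/2) ^ k" for k
  proof -
    have "min 1 ((1/4::real) ^ k) = (1/4) ^ k" by (simp add: min_absorb2 power_le_one)
    then have "(1/4) ^ k * prob (A k) \<le> C * (1/8) ^ k"
      using trunc_mean_markov[of "\<lambda>\<omega>. ennreal ((J (Suc k) \<omega> - J k \<omega>)\<^sup>2)" "(1/4) ^ k"] small[of k]
      by (simp add: A_def)
    also have "(1/8::real) ^ k = (1/4) ^ k * (1/2) ^ k" by (simp flip: power_mult_distrib)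
    finally show ?thesis by (simp add: mult.left_commute)
  qed
  have "summable (\<lambda>k. prob (A k))"
    by (rule summable_comparison_test'[where g="\<lambda>k. C * (1/2) ^ k"])
      (use PA in \<open>auto intro!: summable_mult summable_geometric\<close>)
  then have "AE \<omega> in M. eventually (\<lambda>k. \<omega> \<in> space M - A k) sequentially"
    by (intro borel_cantelli_AE1) (auto simp: less_top[symmetric])
  then show "AE \<omega> in M. (\<lambda>k. J k \<omega>) \<longlonglongrightarrow> lim (\<lambda>k. J k \<omega>)"
  proof eventually_elim
    case (elim \<omega>)
    have "summable (\<lambda>k. J (Suc k) \<omega> - J k \<omega>)"
    proof (rule summable_comparison_test_ev)
      show "\<forall>\<^sub>F k in sequentially. norm (J (Suc k) \<omega> - J k \<omega>) \<le> (1/2) ^ k"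
        using elim
      proof eventually_elim
        case (elim k)
        then have "ennreal ((J (Suc k) \<omega> - J k \<omega>)\<^sup>2) \<le> ennreal ((1/4) ^ k)" by (auto simp: A_def not_less)
        then have "(J (Suc k) \<omega> - J k \<omega>)\<^sup>2 \<le> (1/4) ^ k" by simp
        also have "(1/4::real) ^ k = ((1/2) ^ k)\<^sup>2" by (simp add: power2_eq_square flip: power_mult_distrib)
        finally show ?case using abs_le_square_iff[of "J (Suc k) \<omega> - J k \<omega>" "(1/2) ^ k"] by simp
      qed
    qed (simp add: summable_geometric)
    then have "(\<lambda>n. \<Sum>k<n. J (Suc k) \<omega> - J k \<omega>) \<longlonglongrightarrow> (\<Sum>k. J (Suc k) \<omega> - J k \<omega>)"
      by (rule summable_LIMSEQ)
    moreover have "(\<Sum>k<n. J (Suc k) \<omega> - J k \<omega>) = J n \<omega> - J 0 \<omega>" for n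
      by (rule sum_lessThan_telescope)
    ultimately have "(\<lambda>n. J n \<omega> - J 0 \<omega> + J 0 \<omega>) \<longlonglongrightarrow> (\<Sum>k. J (Suc k) \<omega> - J k \<omega>) + J 0 \<omega>"
      by (intro tendsto_add) auto
    then have "convergent (\<lambda>n. J n \<omega>)" by (auto simp: convergent_def)
    then show ?case by (simp add: convergent_LIMSEQ_iff)
  qed
  show "(\<lambda>\<omega>. lim (\<lambda>k. J k \<omega>)) \<in> borel_measurable G"
    using J(1) by (rule borel_measurable_lim_metric)
qed

end

context diffusion
begin

text \<open>
For each path \<open>f / s(X)\<close> is continuous, because \<open>s\<close> has no zero; hence its Riemann processes are
bounded and converge.  The limit in the mean over paths follows by a second dominated convergence.
\<close>

lemma trunc_energy_riemann_continuous:
  assumes f: "continuous_on UNIV f"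
  shows "(\<lambda>n. trunc_energy (\<lambda>t \<omega>. riemann_process T n (\<lambda>t \<omega>. f t / s (X t \<omega>)) t \<omega> * s (X t \<omega>) - f t)) \<longlonglongrightarrow> 0"
proof -
  let ?V = "\<lambda>t \<omega>. f t / s (X t \<omega>)"
  have sc: "\<omega> \<in> space M \<Longrightarrow> continuous_on {0..T} (\<lambda>t. s (X t \<omega>))" for \<omega>
    by (rule X_composition(2)[OF s_cont])
  have Vc: "\<omega> \<in> space M \<Longrightarrow> continuous_on {0..T} (\<lambda>t. ?V t \<omega>)" for \<omega>
    using s_nonzero by (intro continuous_on_divide sc continuous_on_subset[OF f]) auto
  have Vm: "?V t \<in> borel_measurable (FX t)" if "t \<in> {0..T}" for t
    using that X_composition(1)[OF s_cont, of t t] by (intro borel_measurable_divide) auto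
  let ?G = "\<lambda>n. riemann_process T n ?V"
  have el: "elementary_integral FX T Y (?G n) (simple_integral Y n (\<lambda>i. T * real i / real n) (riemann_weights T n ?V))" for n
    by (rule elementary_integral_simple[OF riemann_simple_integrand[OF T_pos Vm]])
  have jG: "jointly_measurable (\<lambda>t \<omega>. ?G n t \<omega> * s (X t \<omega>))" for n
    by (rule has_W_integral_measurable(1)[OF has_W_integral_of_elementary_Y[OF el]])
  have fm: "f \<in> borel_measurable (lebesgue_on {0..T})"
    by (rule continuous_measurable_lebesgue_on[OF f])
  have jd: "jointly_measurable (\<lambda>t \<omega>. ?G n t \<omega> * s (X t \<omega>) - f t)" for n
    by (intro jointly_measurable_diff jG jointly_measurable_time fm)
  have lim: "(\<lambda>n. energy T (\<lambda>t. ?G n t \<omega> * s (X t \<omega>) - f t)) \<longlonglongrightarrow> 0" if \<omega>: "\<omega> \<in> space M" for \<omega>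
  proof -
    obtain B where B: "\<And>n t. t \<in> {0..T} \<Longrightarrow> \<bar>?G n t \<omega>\<bar> \<le> B"
      using riemann_process_limit(2)[OF T_pos, of ?V \<omega>, OF Vc[OF \<omega>]] by blast
    have "bounded ((\<lambda>t. s (X t \<omega>)) ` {0..T})"
      by (intro compact_imp_bounded compact_continuous_image[OF sc[OF \<omega>]]) simp
    then obtain C where "\<forall>x\<in>(\<lambda>t. s (X t \<omega>)) ` {0..T}. norm x \<le> C" unfolding bounded_iff by blast
    then have C: "\<bar>s (X t \<omega>)\<bar> \<le> C" if "t \<in> {0..T}" for t using that by auto
    show ?thesis
    proof (rule bounded_L2_limit[where B="B * C"])
      show "(\<lambda>t. ?G n t \<omega> * s (X t \<omega>)) \<in> borel_measurable (lebesgue_on {0..T})" for n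
        by (rule jointly_measurable_section[OF jG \<omega>])
      show "\<bar>?G n t \<omega> * s (X t \<omega>)\<bar> \<le> B * C" if "t \<in> {0..T}" for n t
        using B[OF that, of n] C[OF that] by (simp add: abs_mult mult_mono')
      show "AE t in lebesgue_on {0..T}. (\<lambda>n. ?G n t \<omega> * s (X t \<omega>)) \<longlonglongrightarrow> f t"
        using AE_lebesgue_on_nonzero AE_space
      proof eventually_elim
        case (elim t)
        have "(\<lambda>n. ?G n t \<omega> * s (X t \<omega>)) \<longlonglongrightarrow> ?V t \<omega> * s (X t \<omega>)"
          by (intro tendsto_mult tendsto_const riemann_process_limit(1)[where V="?V", OF T_pos Vc[OF \<omega>]]) (use elim in auto)
        then show ?case using s_nonzero by simp
      qed
    qed (rule fm)
  qed
  let ?Z = "\<lambda>n \<omega>. enn2real (min 1 (energy T (\<lambda>t. ?G n t \<omega> * s (X t \<omega>) - f t)))"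
  have Z: "ennreal (?Z n \<omega>) = min 1 (energy T (\<lambda>t. ?G n t \<omega> * s (X t \<omega>) - f t))" for n \<omega>
    by (rule ennreal_enn2real) (simp add: min_less_iff_disj)
  have "trunc_energy (\<lambda>t \<omega>. ?G n t \<omega> * s (X t \<omega>) - f t) = trunc_mean M (\<lambda>\<omega>. ennreal (?Z n \<omega>))" for n
    unfolding trunc_energy_def Z trunc_mean_def by simp
  moreover have "(\<lambda>n. trunc_mean M (\<lambda>\<omega>. ennreal (?Z n \<omega>))) \<longlonglongrightarrow> 0"
  proof (rule trunc_mean_AE_limit)
    show "?Z n \<in> borel_measurable M" for n
      using measurable_square_time_integral[OF jd[of n]] by measurable
    show "AE \<omega> in M. (\<lambda>n. ?Z n \<omega>) \<longlonglongrightarrow> 0"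
    proof (rule AE_I2)
      fix \<omega> assume \<omega>: "\<omega> \<in> space M"
      have "(\<lambda>n. min 1 (energy T (\<lambda>t. ?G n t \<omega> * s (X t \<omega>) - f t))) \<longlonglongrightarrow> min 1 0"
        by (intro tendsto_min tendsto_const lim[OF \<omega>])
      then have "(\<lambda>n. enn2real (min 1 (energy T (\<lambda>t. ?G n t \<omega> * s (X t \<omega>) - f t)))) \<longlonglongrightarrow> enn2real (min 1 0)"
        by (intro tendsto_enn2real) auto
      then show "(\<lambda>n. ?Z n \<omega>) \<longlonglongrightarrow> 0" by simp
    qed
  qed simp
  ultimately show ?thesis by simp
qed

lemma observed_approximation:
  assumes f: "L2_fun T f" and "0 < e"
  shows "\<exists>H J. elementary_integral FX T Y H J \<and> trunc_energy (\<lambda>t \<omega>. H t \<omega> * s (X t \<omega>) - f t) < e"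
proof -
  have fm: "f \<in> borel_measurable (lebesgue_on {0..T})" using f by (simp add: L2_fun_def)
  obtain g where g: "continuous_on UNIV g" "energy T (\<lambda>t. g t - f t) < ennreal (e / 4)"
    using continuous_dense_L2[OF f, of "ennreal (e / 4)"] \<open>0 < e\<close> by auto
  have gm: "g \<in> borel_measurable (lebesgue_on {0..T})"
    by (rule continuous_measurable_lebesgue_on[OF g(1)])
  let ?V = "\<lambda>t \<omega>. g t / s (X t \<omega>)"
  have "0 < e / 4" using \<open>0 < e\<close> by simp
  from eventually_happens[OF order_tendstoD(2)[OF trunc_energy_riemann_continuous[OF g(1)] this]] obtain n where
    n: "trunc_energy (\<lambda>t \<omega>. riemann_process T n ?V t \<omega> * s (X t \<omega>) - g t) < e / 4" by auto
  have Vm: "?V t \<in> borel_measurable (FX t)" if "t \<in> {0..T}" for t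
    using that X_composition(1)[OF s_cont, of t t] by (intro borel_measurable_divide) auto
  let ?J = "simple_integral Y n (\<lambda>i. T * real i / real n) (riemann_weights T n ?V)"
  have el: "elementary_integral FX T Y (riemann_process T n ?V) ?J"
    by (rule elementary_integral_simple[OF riemann_simple_integrand[OF T_pos Vm]])
  have jG: "jointly_measurable (\<lambda>t \<omega>. riemann_process T n ?V t \<omega> * s (X t \<omega>))"
    by (rule has_W_integral_measurable(1)[OF has_W_integral_of_elementary_Y[OF el]])
  have "trunc_energy (\<lambda>t \<omega>. g t - f t) < e / 4"
    by (rule trunc_energy_deterministic_le) (use g \<open>0 < e\<close> in auto)
  moreover have "trunc_energy (\<lambda>t \<omega>. riemann_process T n ?V t \<omega> * s (X t \<omega>) - f t)
      \<le> 2 * trunc_energy (\<lambda>t \<omega>. riemann_process T n ?V t \<omega> * s (X t \<omega>) - g t) + 2 * trunc_energy (\<lambda>t \<omega>. g t - f t)"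
    by (rule trunc_energy_add[OF jointly_measurable_diff[OF jG jointly_measurable_time[OF gm]]
          jointly_measurable_diff[OF jointly_measurable_time[OF gm] jointly_measurable_time[OF fm]]]) simp
  ultimately have "trunc_energy (\<lambda>t \<omega>. riemann_process T n ?V t \<omega> * s (X t \<omega>) - f t) < e" using n by linarith
  with el show ?thesis by (intro exI conjI)
qed

text \<open>
The integrands \<open>H k\<close> are chosen with \<open>H k s(X)\<close> at distance \<open>d k = 8 ^ (- k)\<close> from \<open>f\<close>.  By
\<open>has_W_integral_bound\<close> their integrals then form a sequence to which \<open>AE_limit_of_fast_Cauchy\<close> applies,
with a limit measurable with respect to the observations.
\<close>

lemma observed_integral_exists:
  assumes f: "L2_fun T f"
  shows "\<exists>I. has_ito_integral M FX Y (\<lambda>t \<omega>. (s (X t \<omega>))\<^sup>2) T (\<lambda>t \<omega>. f t / s (X t \<omega>)) I"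
proof -
  have fm: "f \<in> borel_measurable (lebesgue_on {0..T})" using f by (simp add: L2_fun_def)
  define d :: "nat \<Rightarrow> real" where "d k = (1/8) ^ k" for k
  have d: "0 < d k" "d k \<le> 1" "d (Suc k) \<le> d k" for k by (auto simp: d_def power_le_one)
  have "\<forall>k. \<exists>H. \<exists>J. elementary_integral FX T Y H J \<and> trunc_energy (\<lambda>t \<omega>. H t \<omega> * s (X t \<omega>) - f t) < d k * d k"
    by (rule allI, rule observed_approximation[OF f]) (use d in simp)
  from choice[OF this] obtain H where
    "\<forall>k. \<exists>J. elementary_integral FX T Y (H k) J \<and> trunc_energy (\<lambda>t \<omega>. H k t \<omega> * s (X t \<omega>) - f t) < d k * d k" ..
  from choice[OF this] obtain J where HJ: "\<And>k. elementary_integral FX T Y (H k) (J k)"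
    and Hf: "\<And>k. trunc_energy (\<lambda>t \<omega>. H k t \<omega> * s (X t \<omega>) - f t) < d k * d k" by blast
  have "\<forall>k. \<exists>n. \<exists>\<tau> \<xi>. simple_integrand FX T n \<tau> \<xi> \<and> H k = simple_process n \<tau> \<xi> \<and> J k = simple_integral Y n \<tau> \<xi>"
  proof
    fix k
    obtain n \<tau> \<xi> where "simple_integrand FX T n \<tau> \<xi>" "H k = simple_process n \<tau> \<xi>" "J k = simple_integral Y n \<tau> \<xi>"
      by (rule elementary_integral_obtain_simple[OF filtration_natural less_imp_le[OF T_pos] HJ[of k]])
    then show "\<exists>n. \<exists>\<tau> \<xi>. simple_integrand FX T n \<tau> \<xi> \<and> H k = simple_process n \<tau> \<xi> \<and> J k = simple_integral Y n \<tau> \<xi>"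
      by (intro exI conjI)
  qed
  from choice[OF this] obtain n where
    "\<forall>k. \<exists>\<tau>. \<exists>\<xi>. simple_integrand FX T (n k) \<tau> \<xi> \<and> H k = simple_process (n k) \<tau> \<xi> \<and> J k = simple_integral Y (n k) \<tau> \<xi>" ..
  from choice[OF this] obtain \<tau> where
    "\<forall>k. \<exists>\<xi>. simple_integrand FX T (n k) (\<tau> k) \<xi> \<and> H k = simple_process (n k) (\<tau> k) \<xi> \<and> J k = simple_integral Y (n k) (\<tau> k) \<xi>" ..
  from choice[OF this] obtain \<xi> where si: "\<And>k. simple_integrand FX T (n k) (\<tau> k) (\<xi> k)"
    and H: "\<And>k. H k = simple_process (n k) (\<tau> k) (\<xi> k)" and J: "\<And>k. J k = simple_integral Y (n k) (\<tau> k) (\<xi> k)"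
    by blast
  have JF: "J k \<in> borel_measurable (FX T)" for k
  proof -
    have up: "g \<in> borel_measurable (FX T)" if "g \<in> borel_measurable (FX r)" "r \<le> T" for g r
      by (rule filtration_measurable_mono[OF filtration_natural that(2,1)])
    have "\<tau> k i \<in> {0..T}" if "i \<le> n k" for i
      using simple_integrandD(2,3)[OF si that] by simp
    then have "Y (\<tau> k i) \<in> borel_measurable (FX T)" if "i \<le> n k" for i
      using that up[OF Y_measurable_FX[of "\<tau> k i"]] by auto
    moreover have "\<xi> k i \<in> borel_measurable (FX T)" if "i < n k" for i
      using si[of k] that up[of "\<xi> k i" "\<tau> k i"] \<open>\<And>i. i \<le> n k \<Longrightarrow> \<tau> k i \<in> {0..T}\<close>[of i]
      by (auto simp: simple_integrand_def)
    ultimately show ?thesis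
      unfolding J simple_integral_def[abs_def]
      by (intro borel_measurable_sum borel_measurable_times borel_measurable_diff) auto
  qed
  note wi = has_W_integral_of_elementary_Y[OF HJ]
  have jm: "jointly_measurable (\<lambda>t \<omega>. H k t \<omega> * s (X t \<omega>) - f t)" for k
    by (intro jointly_measurable_diff has_W_integral_measurable(1)[OF wi] jointly_measurable_time fm)
  have step: "trunc_sq (\<lambda>\<omega>. J (Suc k) \<omega> - J k \<omega>) \<le> 18 * (1/8) ^ k" for k
  proof -
    let ?A = "\<lambda>k. trunc_energy (\<lambda>t \<omega>. H k t \<omega> * s (X t \<omega>) - f t)"
    have "d (Suc k) * d (Suc k) \<le> d k * d k" by (intro mult_mono d) (use d in \<open>auto intro: less_imp_le\<close>)
    then have "?A (Suc k) \<le> d k * d k" "?A k \<le> d k * d k" using Hf[of "Suc k"] Hf[of k] by linarith+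
    moreover have "trunc_energy (\<lambda>t \<omega>. f t - H k t \<omega> * s (X t \<omega>)) = ?A k"
      by (rule trunc_energy_diff_commute)
    moreover have "trunc_energy (\<lambda>t \<omega>. H (Suc k) t \<omega> * s (X t \<omega>) - H k t \<omega> * s (X t \<omega>))
        \<le> 2 * ?A (Suc k) + 2 * trunc_energy (\<lambda>t \<omega>. f t - H k t \<omega> * s (X t \<omega>))"
      by (rule trunc_energy_add)
        (auto intro!: jm jointly_measurable_diff has_W_integral_measurable(1)[OF wi] jointly_measurable_time fm)
    ultimately have m: "trunc_energy (\<lambda>t \<omega>. H (Suc k) t \<omega> * s (X t \<omega>) - H k t \<omega> * s (X t \<omega>)) \<le> 4 * (d k * d k)"
      by linarith
    have "trunc_sq (\<lambda>\<omega>. J (Suc k) \<omega> - J k \<omega>)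
        \<le> 4 * trunc_energy (\<lambda>t \<omega>. H (Suc k) t \<omega> * s (X t \<omega>) - H k t \<omega> * s (X t \<omega>)) / d k + 2 * d k"
      by (rule has_W_integral_bound[OF has_W_integral_diff[OF wi wi]]) (use d in auto)
    also have "\<dots> \<le> 4 * (4 * (d k * d k)) / d k + 2 * d k"
      using m d[of k] by (intro add_right_mono divide_right_mono mult_left_mono) auto
    also have "\<dots> = 18 * d k" using d(1)[of k] by simp
    finally show ?thesis by (simp add: d_def)
  qed
  have "sets (FX T) \<subseteq> sets M"
    using FX_subset_F[of T] wiener by (auto simp: wiener_process_def subalgebra_def)
  from AE_limit_of_fast_Cauchy[OF JF this _ step] obtain I where
    IF: "I \<in> borel_measurable (FX T)" and lim: "AE \<omega> in M. (\<lambda>k. J k \<omega>) \<longlonglongrightarrow> I \<omega>" by auto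
  note [measurable] = measurable_FX_imp_M[OF IF] measurable_FX_imp_M[OF JF]
  have "null_in_prob M (\<lambda>k \<omega>. \<integral>\<^sup>+ t. ennreal ((simple_process (n k) (\<tau> k) (\<xi> k) t \<omega> - f t / s (X t \<omega>))\<^sup>2 * (s (X t \<omega>))\<^sup>2) \<partial>lebesgue_on {0..T})"
    unfolding null_in_prob_iff_trunc_mean weighted_square_eq H[symmetric]
  proof (intro conjI allI)
    show "(\<lambda>\<omega>. energy T (\<lambda>t. H k t \<omega> * s (X t \<omega>) - f t)) \<in> borel_measurable M" for k
      by (rule measurable_square_time_integral[OF jm])
    show "(\<lambda>k. trunc_mean M (\<lambda>\<omega>. energy T (\<lambda>t. H k t \<omega> * s (X t \<omega>) - f t))) \<longlonglongrightarrow> 0"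
      unfolding trunc_energy_def[symmetric]
    proof (rule tendsto_sandwich[OF _ _ tendsto_const])
      show "(\<lambda>k. d k * d k) \<longlonglongrightarrow> 0"
        unfolding d_def power_mult_distrib[symmetric] by (rule LIMSEQ_power_zero) simp
      show "\<forall>\<^sub>F k in sequentially. trunc_energy (\<lambda>t \<omega>. H k t \<omega> * s (X t \<omega>) - f t) \<le> d k * d k"
        by (intro always_eventually allI less_imp_le Hf)
    qed (simp add: trunc_energy_nonneg)
  qed
  moreover have "null_in_prob M (\<lambda>k \<omega>. ennreal \<bar>simple_integral Y (n k) (\<tau> k) (\<xi> k) \<omega> - I \<omega>\<bar>)"
    unfolding null_in_prob_iff_trunc_mean J[symmetric]
  proof (intro conjI allI trunc_mean_AE_limit)
    show "AE \<omega> in M. (\<lambda>k. \<bar>J k \<omega> - I \<omega>\<bar>) \<longlonglongrightarrow> 0"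
      using lim by eventually_elim (simp add: LIM_zero_iff tendsto_rabs_zero)
  qed auto
  moreover have "(\<lambda>(t, \<omega>). f t / s (X t \<omega>)) \<in> borel_measurable (lebesgue_on {0..T} \<Otimes>\<^sub>M M)"
  proof -
    have [measurable]: "(\<lambda>p. s (X (fst p) (snd p))) \<in> borel_measurable (lebesgue_on {0..T} \<Otimes>\<^sub>M M)"
      using jointly_measurable_X[OF s_cont] by (simp add: jointly_measurable_def split_beta')
    have [measurable]: "f \<in> borel_measurable (lebesgue_on {0..T})" by (rule fm)
    have "(\<lambda>p. f (fst p) / s (X (fst p) (snd p))) \<in> borel_measurable (lebesgue_on {0..T} \<Otimes>\<^sub>M M)"
      by measurable
    then show ?thesis by (simp add: split_beta')
  qed
  ultimately show ?thesis
    unfolding has_ito_integral_def using IF si by blast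
qed

lemma observed_integral_props:
  assumes f: "L2_fun T f"
  shows "observed_integral M b s T X (\<lambda>t \<omega>. f t / s (X t \<omega>)) \<in> borel_measurable (FX T)"
    and "has_W_integral (\<lambda>t \<omega>. f t) (observed_integral M b s T X (\<lambda>t \<omega>. f t / s (X t \<omega>)))"
proof -
  have *: "has_ito_integral M FX Y (\<lambda>t \<omega>. (s (X t \<omega>))\<^sup>2) T (\<lambda>t \<omega>. f t / s (X t \<omega>))
      (observed_integral M b s T X (\<lambda>t \<omega>. f t / s (X t \<omega>)))"
    unfolding observed_integral_def ito_integral_def by (rule someI_ex[OF observed_integral_exists[OF f]])
  then show "observed_integral M b s T X (\<lambda>t \<omega>. f t / s (X t \<omega>)) \<in> borel_measurable (FX T)"
    by (simp add: has_ito_integral_def)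
  show "has_W_integral (\<lambda>t \<omega>. f t) (observed_integral M b s T X (\<lambda>t \<omega>. f t / s (X t \<omega>)))"
    by (rule has_W_integral_observed_integral[OF _ *]) (use f in \<open>simp add: L2_fun_def\<close>)
qed

end

section \<open>The Gaussian law of integrals of deterministic functions\<close>

context wiener_space
begin

lemma char_simple_integral_deterministic:
  assumes "simple_integrand F T n \<tau> (\<lambda>i \<omega>. c i)"
  shows "expectation (\<lambda>\<omega>. iexp (simple_integral W n \<tau> (\<lambda>i \<omega>. c i) \<omega>))
     = complex_of_real (exp (- (\<Sum>i<n. (c i)\<^sup>2 * (\<tau> (Suc i) - \<tau> i)) / 2))"
  using assms
proof (induction n)
  case 0
  then show ?case by (simp add: simple_integral_def prob_space)
next
  case (Suc n)
  note D = simple_integrandD[OF Suc.prems]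
  define A where "A = simple_integral W n \<tau> (\<lambda>i \<omega>. c i)"
  define u where "u = \<tau> n"
  define v where "v = \<tau> (Suc n)"
  have uv: "0 \<le> u" "u \<le> v" "v \<le> T" using D(1)[of n "Suc n"] D(2)[of n] D(3)[of "Suc n"] by (auto simp: u_def v_def)
  have IH: "expectation (\<lambda>\<omega>. iexp (A \<omega>)) = complex_of_real (exp (- (\<Sum>i<n. (c i)\<^sup>2 * (\<tau> (Suc i) - \<tau> i)) / 2))"
    using Suc.IH simple_integrand_Suc[OF Suc.prems] by (simp add: A_def)
  have S: "simple_integral W (Suc n) \<tau> (\<lambda>i \<omega>. c i) \<omega> = A \<omega> + c n * (W v \<omega> - W u \<omega>)" for \<omega>
    by (simp add: simple_integral_def A_def u_def v_def)
  have AF: "A \<in> borel_measurable (F u)"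
    unfolding A_def u_def by (rule simple_integral_measurable[OF simple_integrand_Suc[OF Suc.prems]])
  have SS: "(\<Sum>i<Suc n. (c i)\<^sup>2 * (\<tau> (Suc i) - \<tau> i)) = (\<Sum>i<n. (c i)\<^sup>2 * (\<tau> (Suc i) - \<tau> i)) + (c n)\<^sup>2 * (v - u)"
    by (simp add: u_def v_def)
  show ?case
  proof (cases "u = v")
    case True
    then show ?thesis using IH by (auto simp: S SS u_def v_def)
  next
    case False
    then have "u < v" using uv by simp
    let ?D = "\<lambda>\<omega>. W v \<omega> - W u \<omega>"
    have [measurable]: "A \<in> borel_measurable M" "W u \<in> borel_measurable M" "W v \<in> borel_measurable M"
      using measurable_F_imp[OF AF] W_measurable uv by auto
    have "indep_var borel (\<lambda>\<omega>. iexp (A \<omega>)) borel (\<lambda>\<omega>. iexp (c n * ?D \<omega>))"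
      using indep_var_compose[OF indep_increment[OF uv(1) \<open>u < v\<close> uv(3) AF], of iexp borel "\<lambda>y. iexp (c n * y)" borel]
      unfolding comp_def by simp
    then have "expectation (\<lambda>\<omega>. iexp (A \<omega>) * iexp (c n * ?D \<omega>)) = expectation (\<lambda>\<omega>. iexp (A \<omega>)) * expectation (\<lambda>\<omega>. iexp (c n * ?D \<omega>))"
      by (rule indep_var_lebesgue_integral)
        (rule integrable_iexp[of "\<lambda>\<omega>. complex_of_real (A \<omega>)"] integrable_iexp[of "\<lambda>\<omega>. complex_of_real (c n * ?D \<omega>)"];
         measurable; simp)+
    also have "\<dots> = complex_of_real (exp (- (\<Sum>i<Suc n. (c i)\<^sup>2 * (\<tau> (Suc i) - \<tau> i)) / 2))"
      unfolding IH increment_moments(5)[OF uv(1) \<open>u < v\<close> uv(3)] SS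
      by (simp only: of_real_mult[symmetric] exp_add[symmetric] minus_add_distrib add_divide_distrib)
    also have "(\<lambda>\<omega>. iexp (A \<omega>) * iexp (c n * ?D \<omega>)) = (\<lambda>\<omega>. iexp (simple_integral W (Suc n) \<tau> (\<lambda>i \<omega>. c i) \<omega>))"
      by (simp add: S distrib_left exp_add)
    finally show ?thesis .
  qed
qed

text \<open>
\<open>\<bar>exp(ia) - exp(ib)\<bar> \<le> 2 min(1, \<bar>a - b\<bar>)\<close>, and \<open>z \<le> e + z\<^sup>2 / e\<close> turns the first power into the
truncated square.
\<close>

lemma char_diff_le:
  assumes [measurable]: "A \<in> borel_measurable M" "B \<in> borel_measurable M" and "0 < e"
  shows "cmod (expectation (\<lambda>\<omega>. iexp (A \<omega>)) - expectation (\<lambda>\<omega>. iexp (B \<omega>)))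
     \<le> 2 * e + 2 * trunc_sq (\<lambda>\<omega>. A \<omega> - B \<omega>) / e"
proof -
  have pw: "cmod (iexp a - iexp b) \<le> 2 * e + 2 * min 1 ((a - b)\<^sup>2) / e" for a b :: real
  proof -
    have "iexp a - iexp b = iexp b * (iexp (a - b) - 1)"
      by (simp add: right_diff_distrib flip: exp_add)
    then have "cmod (iexp a - iexp b) = cmod (iexp (a - b) - 1)" by (simp add: norm_mult)
    moreover have "cmod (iexp (a - b) - 1) \<le> \<bar>a - b\<bar>" using iexp_approx1[of "a - b" 0] by simp
    moreover have "cmod (iexp (a - b) - 1) \<le> 2" using iexp_approx2[of "a - b" 0] by simp
    ultimately have "cmod (iexp a - iexp b) \<le> min 2 \<bar>a - b\<bar>" by simp
    also have "\<dots> \<le> 2 * min 1 \<bar>a - b\<bar>" by (simp add: min_def)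
    also have "min 1 \<bar>a - b\<bar> \<le> e + min 1 ((a - b)\<^sup>2) / e"
    proof -
      let ?z = "min 1 \<bar>a - b\<bar>"
      have "?z\<^sup>2 \<le> min 1 ((a - b)\<^sup>2)" using power_mono[of ?z 1 2] power_mono[of ?z "\<bar>a - b\<bar>" 2] by simp
      moreover have "?z \<le> e + ?z\<^sup>2 / e"
      proof -
        have "?z * e \<le> e\<^sup>2 + ?z\<^sup>2"
        proof -
          have "0 \<le> ?z * e" using \<open>0 < e\<close> by (intro mult_nonneg_nonneg) auto
          moreover have "2 * (?z * e) \<le> ?z\<^sup>2 + e\<^sup>2" using sum_squares_bound[of ?z e] by (simp only: mult.assoc)
          ultimately show ?thesis by linarith
        qed
        then show ?thesis using \<open>0 < e\<close> by (simp add: field_simps power2_eq_square)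
      qed
      ultimately show ?thesis using \<open>0 < e\<close> by (meson add_left_mono divide_right_mono less_imp_le order_trans)
    qed
    finally show ?thesis by simp
  qed
  have i: "integrable M (\<lambda>\<omega>. min 1 ((A \<omega> - B \<omega>)\<^sup>2))"
    by (rule integrable_const_bound[where B=1]) auto
  have ie: "integrable M (\<lambda>\<omega>. iexp (A \<omega>))" "integrable M (\<lambda>\<omega>. iexp (B \<omega>))"
    by (auto intro!: integrable_iexp)
  have "expectation (\<lambda>\<omega>. iexp (A \<omega>)) - expectation (\<lambda>\<omega>. iexp (B \<omega>)) = expectation (\<lambda>\<omega>. iexp (A \<omega>) - iexp (B \<omega>))"
    using ie by simp
  also have "cmod \<dots> \<le> expectation (\<lambda>\<omega>. cmod (iexp (A \<omega>) - iexp (B \<omega>)))"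
    by (rule integral_norm_bound)
  also have "\<dots> \<le> expectation (\<lambda>\<omega>. 2 * e + 2 * min 1 ((A \<omega> - B \<omega>)\<^sup>2) / e)"
    using ie i pw by (intro integral_mono integrable_norm Bochner_Integration.integrable_diff Bochner_Integration.integrable_add
      integrable_divide integrable_mult_right) auto
  also have "\<dots> = 2 * e + 2 * expectation (\<lambda>\<omega>. min 1 ((A \<omega> - B \<omega>)\<^sup>2)) / e"
    using i by (simp add: prob_space)
  also have "expectation (\<lambda>\<omega>. min 1 ((A \<omega> - B \<omega>)\<^sup>2)) = trunc_sq (\<lambda>\<omega>. A \<omega> - B \<omega>)"
    by (rule trunc_mean_eq_expectation[symmetric]) auto
  finally show ?thesis .
qed

text \<open>
The Riemann processes of a deterministic continuous function have deterministic weights, which is what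
makes their integrals Gaussian.
\<close>

lemma deterministic_step_approximation:
  assumes f: "L2_fun T f" and e: "0 < e"
  shows "\<exists>n \<tau> c h. simple_integrand F T n \<tau> (\<lambda>i \<omega>. c i) \<and>
     simple_process n \<tau> (\<lambda>i \<omega>. c i) = (\<lambda>t (\<omega>::'a). h t) \<and> h \<in> borel_measurable (lebesgue_on {0..T}) \<and>
     energy T (\<lambda>t. h t - f t) < ennreal e"
proof -
  have fm: "f \<in> borel_measurable (lebesgue_on {0..T})" using f by (simp add: L2_fun_def)
  obtain g where g: "continuous_on UNIV g" "energy T (\<lambda>t. g t - f t) < ennreal (e / 4)"
    using continuous_dense_L2[OF f, of "ennreal (e / 4)"] e by auto
  have gm: "g \<in> borel_measurable (lebesgue_on {0..T})"
    by (rule continuous_measurable_lebesgue_on[OF g(1)])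
  define w where "w n i = clip (real n) (g (T * real i / real n))" for n i
  let ?p = "\<lambda>n i. T * real i / real n"
  have w: "riemann_weights T n (\<lambda>t \<omega>. g t) = (\<lambda>i (\<omega>::'a). w n i)" for n
    by (intro ext) (simp add: riemann_weights_def w_def)
  have si: "simple_integrand F T n (?p n) (\<lambda>i \<omega>. w n i)" for n
    unfolding w[symmetric] by (rule riemann_simple_integrand[OF T_pos]) simp
  define h where "h n t = (\<Sum>i<n. w n i * indicator {?p n i<..?p n (Suc i)} t)" for n t
  have h: "simple_process n (?p n) (\<lambda>i (\<omega>::'a). w n i) t \<omega> = h n t" for n t \<omega>
    by (simp add: simple_process_def h_def)
  have gc: "continuous_on {0..T} (\<lambda>t. g t)" by (rule continuous_on_subset[OF g(1)]) simp
  note lim = riemann_process_limit[where V="\<lambda>t (\<omega>::'a). g t", OF T_pos gc, unfolded w h]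
  obtain B where B: "\<And>n t. t \<in> {0..T} \<Longrightarrow> \<bar>h n t\<bar> \<le> B" using lim(2) by blast
  have hm: "h n \<in> borel_measurable (lebesgue_on {0..T})" for n
  proof -
    have "jointly_measurable (\<lambda>t \<omega>. h n t)"
      using elementary_integral_measurable(1)[OF elementary_integral_simple[OF si, of W n]] by (simp add: h[abs_def])
    moreover obtain \<omega> where "\<omega> \<in> space M" using not_empty by blast
    ultimately show ?thesis by (rule jointly_measurable_section)
  qed
  have "(\<lambda>n. energy T (\<lambda>t. h n t - g t)) \<longlonglongrightarrow> 0"
  proof (rule bounded_L2_limit[OF hm gm B])
    show "AE t in lebesgue_on {0..T}. (\<lambda>n. h n t) \<longlonglongrightarrow> g t"
      using AE_lebesgue_on_nonzero AE_space by eventually_elim (use lim(1) in auto)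
  qed
  from eventually_happens[OF order_tendstoD(2)[OF this, of "ennreal (e / 4)"]] e obtain n where
    n: "energy T (\<lambda>t. h n t - g t) < ennreal (e / 4)" by auto
  have "energy T (\<lambda>t. h n t - f t)
     \<le> 2 * energy T (\<lambda>t. h n t - g t) + 2 * energy T (\<lambda>t. g t - f t)"
    by (rule nn_integral_square_triangle[OF hm gm fm])
  also have "\<dots> < 2 * ennreal (e / 4) + 2 * ennreal (e / 4)"
    using n g(2) by (intro add_strict_mono) (auto simp: ennreal_mult_strict_left_mono)
  also have "\<dots> = ennreal (2 * (e / 4) + 2 * (e / 4))"
    using e by (intro ennreal_twice_add_twice[symmetric]) auto
  also have "2 * (e / 4) + 2 * (e / 4) = e" by simp
  finally show ?thesis
    using si[of n] hm[of n] h[of n]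
    by - (rule exI[of _ n], rule exI[of _ "?p n"], rule exI[of _ "w n"], rule exI[of _ "h n"], auto)
qed

text \<open>
Young's inequality \<open>2 \<bar>(g - f) f\<bar> \<le> (g - f)\<^sup>2 / \<eta> + \<eta> f\<^sup>2\<close>, integrated.
\<close>

lemma L2_norm_diff_bound:
  fixes f g :: "real \<Rightarrow> real"
  assumes f: "L2_fun T f" and g: "g \<in> borel_measurable (lebesgue_on {0..T})"
    and near: "energy T (\<lambda>t. g t - f t) < ennreal (\<eta>\<^sup>2)" and \<eta>: "0 < \<eta>" "\<eta> \<le> 1"
    and Q: "energy T (\<lambda>t. g t) = ennreal Q" "0 \<le> Q"
  shows "\<bar>Q - (LINT t|lebesgue_on {0..T}. (f t)\<^sup>2)\<bar> \<le> \<eta> * (2 + (LINT t|lebesgue_on {0..T}. (f t)\<^sup>2))"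
proof -
  let ?L = "lebesgue_on {0..T}"
  note [measurable] = g
  have [measurable]: "f \<in> borel_measurable ?L" and fi: "integrable ?L (\<lambda>t. (f t)\<^sup>2)"
    using f by (auto simp: L2_fun_def)
  have gi: "integrable ?L (\<lambda>t. (g t)\<^sup>2)" and gQ: "(LINT t|?L. (g t)\<^sup>2) = Q"
    using Q by (auto intro!: integrableI_nonneg simp: integral_eq_nn_integral)
  have di: "integrable ?L (\<lambda>t. (g t - f t)\<^sup>2)"
    using near by (intro integrableI_nonneg) (auto intro: less_trans)
  have "ennreal (LINT t|?L. (g t - f t)\<^sup>2) < ennreal (\<eta>\<^sup>2)"
    unfolding nn_integral_eq_integral[OF di, symmetric, simplified] by (rule near)
  then have dl: "(LINT t|?L. (g t - f t)\<^sup>2) \<le> \<eta>\<^sup>2"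
    using \<eta> by (simp add: ennreal_less_iff integral_nonneg_AE)
  have pw: "\<bar>(g t)\<^sup>2 - (f t)\<^sup>2\<bar> \<le> (1 + 1 / \<eta>) * (g t - f t)\<^sup>2 + \<eta> * (f t)\<^sup>2" for t
  proof -
    have "0 \<le> (\<bar>g t - f t\<bar> - \<eta> * \<bar>f t\<bar>)\<^sup>2 / \<eta>" using \<eta> by simp
    also have "\<dots> = (g t - f t)\<^sup>2 / \<eta> + \<eta> * (f t)\<^sup>2 - 2 * \<bar>(g t - f t) * f t\<bar>"
      using \<eta> by (simp add: power2_diff power_mult_distrib abs_mult diff_divide_distrib add_divide_distrib power2_eq_square[of \<eta>])
    finally have "2 * \<bar>(g t - f t) * f t\<bar> \<le> (g t - f t)\<^sup>2 / \<eta> + \<eta> * (f t)\<^sup>2" by simp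
    moreover have "(g t)\<^sup>2 - (f t)\<^sup>2 = (g t - f t)\<^sup>2 + 2 * ((g t - f t) * f t)"
      by (simp add: power2_eq_square algebra_simps)
    moreover have "0 \<le> (g t - f t)\<^sup>2" by simp
    ultimately have "\<bar>(g t)\<^sup>2 - (f t)\<^sup>2\<bar> \<le> (g t - f t)\<^sup>2 + (g t - f t)\<^sup>2 / \<eta> + \<eta> * (f t)\<^sup>2" by linarith
    then show ?thesis by (simp add: distrib_right)
  qed
  let ?N = "LINT t|?L. (f t)\<^sup>2"
  have "\<bar>Q - ?N\<bar> = \<bar>LINT t|?L. (g t)\<^sup>2 - (f t)\<^sup>2\<bar>" using fi gi gQ by simp
  also have "\<dots> \<le> (LINT t|?L. \<bar>(g t)\<^sup>2 - (f t)\<^sup>2\<bar>)" by (rule integral_abs_bound)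
  also have "\<dots> \<le> (LINT t|?L. (1 + 1 / \<eta>) * (g t - f t)\<^sup>2 + \<eta> * (f t)\<^sup>2)"
    using fi gi di pw
    by (intro integral_mono integrable_abs Bochner_Integration.integrable_diff Bochner_Integration.integrable_add
        integrable_mult_right) auto
  also have "\<dots> = (1 + 1 / \<eta>) * (LINT t|?L. (g t - f t)\<^sup>2) + \<eta> * ?N"
    using fi di by simp
  also have "\<dots> \<le> (1 + 1 / \<eta>) * \<eta>\<^sup>2 + \<eta> * ?N"
    using dl \<eta> by (intro add_right_mono mult_left_mono) auto
  also have "(1 + 1 / \<eta>) * \<eta>\<^sup>2 = \<eta> * \<eta> + \<eta>" using \<eta> by (simp add: power2_eq_square field_simps)
  also have "\<eta> * \<eta> \<le> \<eta>" using \<eta> by (simp add: mult_left_le)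
  finally show ?thesis by (simp add: distrib_left)
qed

lemma char_has_W_integral_deterministic:
  assumes f: "L2_fun T f" and I: "has_W_integral (\<lambda>t \<omega>. f t) I"
  shows "expectation (\<lambda>\<omega>. iexp (I \<omega>)) = complex_of_real (exp (- (LINT t|lebesgue_on {0..T}. (f t)\<^sup>2) / 2))"
proof -
  let ?N = "LINT t|lebesgue_on {0..T}. (f t)\<^sup>2"
  have close: "\<exists>Q. \<bar>Q - ?N\<bar> \<le> (\<eta>\<^sup>2) * (2 + ?N) \<and>
      cmod (complex_of_real (exp (- Q / 2)) - expectation (\<lambda>\<omega>. iexp (I \<omega>))) \<le> 14 * \<eta>"
    if \<eta>: "0 < \<eta>" "\<eta> \<le> 1" for \<eta>
  proof -
    (* A step function h with ||h - f|| < \<eta>^2 has an integral J whose truncated squared distance from I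
       is at most 6 \<eta>^2; the characteristic functions then differ by at most 14 \<eta>. *)
    have \<eta>2: "0 < \<eta>\<^sup>2" "\<eta>\<^sup>2 \<le> 1" using \<eta> by (auto simp: power_le_one)
    obtain n \<tau> c h where si: "simple_integrand F T n \<tau> (\<lambda>i \<omega>. c i)"
      and h: "simple_process n \<tau> (\<lambda>i \<omega>. c i) = (\<lambda>t (\<omega>::'a). h t)" and hm: "h \<in> borel_measurable (lebesgue_on {0..T})"
      and near: "energy T (\<lambda>t. h t - f t) < ennreal ((\<eta>\<^sup>2)\<^sup>2)"
      using deterministic_step_approximation[OF f, of "(\<eta>\<^sup>2)\<^sup>2"] \<eta> by auto
    define J where "J = simple_integral W n \<tau> (\<lambda>i \<omega>. c i)"
    define Q where "Q = (\<Sum>i<n. (c i)\<^sup>2 * (\<tau> (Suc i) - \<tau> i))"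
    have "0 \<le> Q" unfolding Q_def using si by (auto intro!: sum_nonneg mult_nonneg_nonneg simp: simple_integrand_def)
    moreover have "energy T (\<lambda>t. h t) = ennreal Q"
      using nn_integral_simple_process_square[OF si] by (simp add: h Q_def)
    ultimately have QN: "\<bar>Q - ?N\<bar> \<le> \<eta>\<^sup>2 * (2 + ?N)"
      by (intro L2_norm_diff_bound[OF f hm near \<eta>2])
    have el: "elementary_integral F T W (\<lambda>t \<omega>. h t) J"
      using elementary_integral_simple[OF si, of W] by (simp add: h J_def)
    have ms: "trunc_energy (\<lambda>t \<omega>. h t - f t) < (\<eta>\<^sup>2)\<^sup>2"
      by (rule trunc_energy_deterministic_le[OF near]) (use \<eta> in simp)
    have "trunc_sq (\<lambda>\<omega>. J \<omega> - I \<omega>) \<le> 4 * trunc_energy (\<lambda>t \<omega>. h t - f t) / \<eta>\<^sup>2 + 2 * \<eta>\<^sup>2"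
      by (rule has_W_integral_bound[OF has_W_integral_diff[OF has_W_integral_elementary[OF el] I] \<eta>2])
    also have "\<dots> \<le> 4 * (\<eta>\<^sup>2)\<^sup>2 / \<eta>\<^sup>2 + 2 * \<eta>\<^sup>2"
      using ms \<eta>2 by (intro add_right_mono divide_right_mono) auto
    also have "\<dots> = 6 * \<eta>\<^sup>2" using \<eta> by (simp add: power2_eq_square)
    finally have sq: "trunc_sq (\<lambda>\<omega>. J \<omega> - I \<omega>) \<le> 6 * \<eta>\<^sup>2" .
    have "cmod (expectation (\<lambda>\<omega>. iexp (J \<omega>)) - expectation (\<lambda>\<omega>. iexp (I \<omega>))) \<le> 2 * \<eta> + 2 * trunc_sq (\<lambda>\<omega>. J \<omega> - I \<omega>) / \<eta>"
      by (rule char_diff_le[OF elementary_integral_measurable(2)[OF el] has_W_integral_measurable(2)[OF I] \<eta>(1)])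
    also have "\<dots> \<le> 2 * \<eta> + 2 * (6 * \<eta>\<^sup>2) / \<eta>"
      using sq \<eta> by (intro add_left_mono divide_right_mono) auto
    also have "\<dots> = 14 * \<eta>" using \<eta> by (simp add: power2_eq_square)
    also have "expectation (\<lambda>\<omega>. iexp (J \<omega>)) = complex_of_real (exp (- Q / 2))"
      unfolding J_def Q_def by (rule char_simple_integral_deterministic[OF si])
    finally show ?thesis using QN by blast
  qed
  have "\<forall>k. \<exists>Q. \<bar>Q - ?N\<bar> \<le> ((1 / real (Suc k))\<^sup>2) * (2 + ?N) \<and>
      cmod (complex_of_real (exp (- Q / 2)) - expectation (\<lambda>\<omega>. iexp (I \<omega>))) \<le> 14 * (1 / real (Suc k))"
    by (intro allI close) auto
  from choice[OF this] obtain Q where Q: "\<And>k. \<bar>Q k - ?N\<bar> \<le> ((1 / real (Suc k))\<^sup>2) * (2 + ?N)"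
    "\<And>k. cmod (complex_of_real (exp (- Q k / 2)) - expectation (\<lambda>\<omega>. iexp (I \<omega>))) \<le> 14 * (1 / real (Suc k))"
    by blast
  have inv: "(\<lambda>k. 1 / real (Suc k)) \<longlonglongrightarrow> 0"
    using LIMSEQ_inverse_real_of_nat by (simp add: inverse_eq_divide)
  have "(\<lambda>k. Q k - ?N) \<longlonglongrightarrow> 0"
  proof (rule Lim_null_comparison)
    show "\<forall>\<^sub>F k in sequentially. norm (Q k - ?N) \<le> (1 / real (Suc k))\<^sup>2 * (2 + ?N)" using Q(1) by simp
    show "(\<lambda>k. (1 / real (Suc k))\<^sup>2 * (2 + ?N)) \<longlonglongrightarrow> 0"
      using tendsto_mult[OF tendsto_power[OF inv, of 2] tendsto_const[of "2 + ?N"]] by simp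
  qed
  then have "Q \<longlonglongrightarrow> ?N" by (simp add: LIM_zero_iff)
  then have "(\<lambda>k. complex_of_real (exp (- Q k / 2))) \<longlonglongrightarrow> complex_of_real (exp (- ?N / 2))"
    by (intro tendsto_intros) auto
  moreover have "(\<lambda>k. complex_of_real (exp (- Q k / 2)) - expectation (\<lambda>\<omega>. iexp (I \<omega>))) \<longlonglongrightarrow> 0"
  proof (rule Lim_null_comparison)
    show "\<forall>\<^sub>F k in sequentially. norm (complex_of_real (exp (- Q k / 2)) - expectation (\<lambda>\<omega>. iexp (I \<omega>))) \<le> 14 * (1 / real (Suc k))"
      using Q(2) by simp
    show "(\<lambda>k. 14 * (1 / real (Suc k))) \<longlonglongrightarrow> 0" using tendsto_mult[OF tendsto_const[of 14] inv] by simp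
  qed
  then have "(\<lambda>k. complex_of_real (exp (- Q k / 2))) \<longlonglongrightarrow> expectation (\<lambda>\<omega>. iexp (I \<omega>))"
    by (simp add: LIM_zero_iff)
  ultimately show ?thesis using LIMSEQ_unique by blast
qed

text \<open>
By orthonormality the linear combination with coefficients \<open>c\<close> is an integral of a function of squared
norm \<open>\<Sum> (c j)\<^sup>2\<close>, which determines the joint characteristic function.
\<close>

lemma has_W_integral_orthonormal_law:
  fixes \<phi> :: "'j \<Rightarrow> real \<Rightarrow> real"
  assumes J: "finite J" and \<phi>: "\<And>j. j \<in> J \<Longrightarrow> L2_fun T (\<phi> j)"
    and orth: "\<And>i j. i \<in> J \<Longrightarrow> j \<in> J \<Longrightarrow> (LINT t|lebesgue_on {0..T}. \<phi> i t * \<phi> j t) = (if i = j then 1 else 0)"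
    and I: "\<And>j. j \<in> J \<Longrightarrow> has_W_integral (\<lambda>t \<omega>. \<phi> j t) (I j)"
  shows "indep_vars (\<lambda>_. borel) I J" and "\<And>j. j \<in> J \<Longrightarrow> distr M borel (I j) = std_normal_distribution"
proof -
  let ?L = "lebesgue_on {0..T}"
  have m: "\<phi> j \<in> borel_measurable ?L" "integrable ?L (\<lambda>t. (\<phi> j t)\<^sup>2)" if "j \<in> J" for j
    using \<phi>[OF that] by (auto simp: L2_fun_def)
  have ii: "integrable ?L (\<lambda>t. \<phi> i t * \<phi> j t)" if "i \<in> J" "j \<in> J" for i j
    using m that by (intro integrable_mult_of_squares) auto
  have char: "expectation (\<lambda>\<omega>. iexp (\<Sum>j\<in>J. c j * I j \<omega>)) = complex_of_real (exp (- (\<Sum>j\<in>J. (c j)\<^sup>2) / 2))" for c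
  proof -
    let ?f = "\<lambda>t. \<Sum>j\<in>J. c j * \<phi> j t"
    have sq: "(?f t)\<^sup>2 = (\<Sum>i\<in>J. \<Sum>j\<in>J. c i * c j * (\<phi> i t * \<phi> j t))" for t
      by (simp add: power2_eq_square sum_product mult_ac)
    have int: "integrable ?L (\<lambda>t. (?f t)\<^sup>2)"
      unfolding sq using ii by (intro Bochner_Integration.integrable_sum integrable_mult_right) auto
    have L2: "L2_fun T ?f"
      unfolding L2_fun_def using int m by (auto intro!: borel_measurable_sum borel_measurable_times)
    have "(LINT t|?L. (?f t)\<^sup>2) = (\<Sum>i\<in>J. \<Sum>j\<in>J. c i * c j * (LINT t|?L. \<phi> i t * \<phi> j t))"
      unfolding sq using ii by (subst Bochner_Integration.integral_sum | auto)+
    also have "\<dots> = (\<Sum>i\<in>J. (c i)\<^sup>2)"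
      using J by (intro sum.cong refl) (simp add: orth if_distrib power2_eq_square cong: if_cong)
    finally have N: "(LINT t|?L. (?f t)\<^sup>2) = (\<Sum>i\<in>J. (c i)\<^sup>2)" .
    have "has_W_integral (\<lambda>t \<omega>. ?f t) (\<lambda>\<omega>. \<Sum>j\<in>J. c j * I j \<omega>)"
      by (intro has_W_integral_sum J has_W_integral_cmult I)
    from char_has_W_integral_deterministic[OF L2 this] show ?thesis unfolding N .
  qed
  have mI: "I j \<in> borel_measurable M" if "j \<in> J" for j by (rule has_W_integral_measurable(2)[OF I[OF that]])
  show "indep_vars (\<lambda>_. borel) I J" "\<And>j. j \<in> J \<Longrightarrow> distr M borel (I j) = std_normal_distribution"
    using joint_std_normal_char_imp_indep[OF prob_space_axioms J mI char] by auto
qed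

end

section \<open>The size of the test\<close>

lemma card_int_abs_less: "0 < m \<Longrightarrow> card {j::int. \<bar>j\<bar> < int m} = 2 * m - 1"
proof -
  assume "0 < m"
  have "{j::int. \<bar>j\<bar> < int m} = {- int m<..<int m}" by auto
  then show ?thesis using \<open>0 < m\<close> by simp
qed

theorem proposition3:
  fixes T x0 L \<alpha> :: real
    and S0 \<sigma> :: "real \<Rightarrow> real"
    and M :: "real \<Rightarrow> 'a measure"
    and F :: "real \<Rightarrow> real \<Rightarrow> 'a measure"
    and W X :: "real \<Rightarrow> real \<Rightarrow> 'a \<Rightarrow> real"
    and \<phi> :: "int \<Rightarrow> real \<Rightarrow> real"
    and m :: "real \<Rightarrow> nat"
    and y :: "int \<Rightarrow> real \<Rightarrow> 'a \<Rightarrow> real"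
    and \<delta> :: "real \<Rightarrow> 'a \<Rightarrow> real"
  assumes "T > 0"
    and "L > 0" "\<And>x y. \<bar>S0 x - S0 y\<bar> + \<bar>\<sigma> x - \<sigma> y\<bar> \<le> L * \<bar>x - y\<bar>"
    and "0 < \<alpha>" "\<alpha> < 1"
    and "\<And>x. (\<sigma> x)\<^sup>2 > 0"
    and "\<And>\<epsilon>. \<epsilon> > 0 \<Longrightarrow> wiener_process (M \<epsilon>) (F \<epsilon>) T (W \<epsilon>)"
    and "\<And>\<epsilon>. \<epsilon> > 0 \<Longrightarrow> sde_solution (M \<epsilon>) (F \<epsilon>) (W \<epsilon>) S0 (\<lambda>x. \<epsilon> * \<sigma> x) x0 T (X \<epsilon>)"
    and "orthonormal_basis_L2 T \<phi>"
    and "\<And>\<epsilon>. \<epsilon> > 0 \<Longrightarrow> m \<epsilon> > 0" "filterlim m at_top (at_right 0)"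
    and "\<And>j \<epsilon>. \<epsilon> > 0 \<Longrightarrow>
           y j \<epsilon> = observed_integral (M \<epsilon>) S0 (\<lambda>x. \<epsilon> * \<sigma> x) T (X \<epsilon>)
                     (\<lambda>t \<omega>. \<phi> j t / (\<epsilon> * \<sigma> (X \<epsilon> t \<omega>)))"
    and "\<And>\<epsilon> \<omega>. \<epsilon> > 0 \<Longrightarrow>
           \<delta> \<epsilon> \<omega> = 1 / sqrt (4 * real (m \<epsilon>)) * (\<Sum>j | \<bar>j\<bar> < int (m \<epsilon>). (y j \<epsilon> \<omega>)\<^sup>2 - 1)"
  shows "(\<lambda>\<epsilon> \<omega>. if \<delta> \<epsilon> \<omega> > quantile std_normal_distribution (1 - \<alpha>) then 1 else 0)
           \<in> tests_of_asymptotic_size \<alpha> T M X"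
proof -
  let ?z = "quantile std_normal_distribution (1 - \<alpha>)"
  let ?\<psi> = "\<lambda>\<epsilon> \<omega>. if \<delta> \<epsilon> \<omega> > ?z then 1 else 0 :: real"
  let ?J = "\<lambda>\<epsilon>. {j::int. \<bar>j\<bar> < int (m \<epsilon>)}"
  (* There are 2 m - 1 indices j with |j| < m, so the sum has standard deviation sqrt (2 (2 m - 1))
     and c (m \<epsilon>) is the ratio of the norming constant sqrt (4 m) to it. *)
  define c where "c k = sqrt (4 * real k) / sqrt (real (2 * k - 1) * 2)" for k
  have Lip: "\<bar>S0 x - S0 y\<bar> \<le> L * \<bar>x - y\<bar>" "\<bar>\<sigma> x - \<sigma> y\<bar> \<le> L * \<bar>x - y\<bar>" for x y
    using assms(3)[of x y] abs_ge_zero[of "S0 x - S0 y"] abs_ge_zero[of "\<sigma> x - \<sigma> y"] by linarith+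
  have cont: "continuous_on UNIV g" if "\<And>x y. \<bar>g x - g y\<bar> \<le> L * \<bar>x - y\<bar>" for g :: "real \<Rightarrow> real"
    by (rule lipschitz_on_continuous_on[of L], rule lipschitz_onI) (use that assms(2) in \<open>auto simp: dist_real_def\<close>)
  have diffusion: "diffusion (M \<epsilon>) (F \<epsilon>) T (W \<epsilon>) S0 (\<lambda>x. \<epsilon> * \<sigma> x) x0 (X \<epsilon>)" if "0 < \<epsilon>" for \<epsilon>
  proof
    show "continuous_on UNIV (\<lambda>x. \<epsilon> * \<sigma> x)" by (intro continuous_intros cont Lip)
    show "continuous_on UNIV S0" by (intro cont Lip)
    show "\<epsilon> * \<sigma> x \<noteq> 0" for x using assms(6)[of x] that by auto
  qed (use assms that in auto)
  have \<phi>: "L2_fun T (\<phi> j)" "(LINT t|lebesgue_on {0..T}. \<phi> i t * \<phi> j t) = (if i = j then 1 else 0)" for i j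
    using assms(9) by (auto simp: orthonormal_basis_L2_def)
  have test: "?\<psi> \<epsilon> \<in> borel_measurable (natural_filtration (M \<epsilon>) (X \<epsilon>) T)" if "0 < \<epsilon>" for \<epsilon>
  proof -
    interpret diffusion "M \<epsilon>" "F \<epsilon>" T "W \<epsilon>" S0 "\<lambda>x. \<epsilon> * \<sigma> x" x0 "X \<epsilon>" by (rule diffusion[OF that])
    have [measurable]: "y j \<epsilon> \<in> borel_measurable (natural_filtration (M \<epsilon>) (X \<epsilon>) T)" for j
      unfolding assms(12)[OF that] by (rule observed_integral_props(1)[OF \<phi>(1)])
    show ?thesis unfolding assms(13)[OF that] by measurable
  qed
  have size: "(LINT \<omega>|M \<epsilon>. ?\<psi> \<epsilon> \<omega>) = 1 - cdf (chi_square_law (2 * m \<epsilon> - 1)) (c (m \<epsilon>) * ?z)" if \<epsilon>: "0 < \<epsilon>" for \<epsilon>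
  proof -
    interpret diffusion "M \<epsilon>" "F \<epsilon>" T "W \<epsilon>" S0 "\<lambda>x. \<epsilon> * \<sigma> x" x0 "X \<epsilon>" by (rule diffusion[OF \<epsilon>])
    have fin: "finite (?J \<epsilon>)" by (rule finite_subset[of _ "{- int (m \<epsilon>)..int (m \<epsilon>)}"]) auto
    have card: "card (?J \<epsilon>) = 2 * m \<epsilon> - 1" by (rule card_int_abs_less[OF assms(10)[OF \<epsilon>]])
    have w: "has_W_integral (\<lambda>t \<omega>. \<phi> j t) (y j \<epsilon>)" for j
      unfolding assms(12)[OF \<epsilon>] by (rule observed_integral_props(2)[OF \<phi>(1)])
    have [measurable]: "y j \<epsilon> \<in> borel_measurable (M \<epsilon>)" for j by (rule has_W_integral_measurable(2)[OF w])
    have law: "distr (M \<epsilon>) borel (\<lambda>\<omega>. (\<Sum>j\<in>?J \<epsilon>. (y j \<epsilon> \<omega>)\<^sup>2 - 1) / sqrt (real (2 * m \<epsilon> - 1) * 2)) = chi_square_law (2 * m \<epsilon> - 1)"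
      unfolding card[symmetric]
      by (rule distr_standardized_square_sum[OF prob_space_axioms fin])
        (rule has_W_integral_orthonormal_law[OF fin \<phi>(1) \<phi>(2) w])+
    have pos: "0 < sqrt (4 * real (m \<epsilon>))" "0 < sqrt (real (2 * m \<epsilon> - 1) * 2)"
      using assms(10)[OF \<epsilon>] by auto
    have le: "\<delta> \<epsilon> \<omega> \<le> ?z \<longleftrightarrow> (\<Sum>j\<in>?J \<epsilon>. (y j \<epsilon> \<omega>)\<^sup>2 - 1) / sqrt (real (2 * m \<epsilon> - 1) * 2) \<le> c (m \<epsilon>) * ?z" for \<omega>
      unfolding assms(13)[OF \<epsilon>] c_def using pos by (simp add: field_simps)
    have [measurable]: "\<delta> \<epsilon> \<in> borel_measurable (M \<epsilon>)" unfolding assms(13)[OF \<epsilon>, abs_def] by measurable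
    have "cdf (chi_square_law (2 * m \<epsilon> - 1)) (c (m \<epsilon>) * ?z) = prob {\<omega>\<in>space (M \<epsilon>). \<delta> \<epsilon> \<omega> \<le> ?z}"
      unfolding law[symmetric] cdf_def le by (subst measure_distr) (auto intro!: arg_cong[where f=prob])
    moreover have "(LINT \<omega>|M \<epsilon>. ?\<psi> \<epsilon> \<omega>) = (LINT \<omega>|M \<epsilon>. 1 - indicator {\<omega>\<in>space (M \<epsilon>). \<delta> \<epsilon> \<omega> \<le> ?z} \<omega>)"
      by (rule Bochner_Integration.integral_cong) (auto simp: indicator_def)
    moreover have "integrable (M \<epsilon>) (indicator {\<omega>\<in>space (M \<epsilon>). \<delta> \<epsilon> \<omega> \<le> ?z} :: 'a \<Rightarrow> real)"
      by (rule integrable_const_bound[where B=1]) (auto simp: indicator_def)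
    then have "(LINT \<omega>|M \<epsilon>. 1 - indicator {\<omega>\<in>space (M \<epsilon>). \<delta> \<epsilon> \<omega> \<le> ?z} \<omega>) = 1 - prob {\<omega>\<in>space (M \<epsilon>). \<delta> \<epsilon> \<omega> \<le> ?z}"
      by (subst Bochner_Integration.integral_diff) (auto simp: prob_space intro!: arg_cong[where f=prob])
    ultimately show ?thesis by simp
  qed
  have sub: "filterlim (\<lambda>k. 2 * k - 1 :: nat) sequentially sequentially"
    by (rule filterlim_subseq) (auto intro!: strict_monoI)
  have c: "c \<longlonglongrightarrow> 1"
    unfolding c_def by real_asymp
  have "(\<lambda>k. 1 - cdf (chi_square_law (2 * k - 1)) (c k * ?z)) \<longlonglongrightarrow> 1 - cdf std_normal_distribution ?z"
  proof (intro tendsto_intros weak_conv_scaled_cdf c)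
    show "weak_conv_m (\<lambda>k. chi_square_law (2 * k - 1)) std_normal_distribution"
      using weak_conv_chi_square_law filterlim_compose[OF _ sub]
      unfolding weak_conv_m_def weak_conv_def by fast
    show "real_distribution (chi_square_law (2 * k - 1))" for k
      by (rule real_distribution_chi_square_law)
  qed
  also have "1 - cdf std_normal_distribution ?z = \<alpha>"
    using cdf_std_normal_quantile[of "1 - \<alpha>"] assms(4,5) by simp
  finally have "((\<lambda>\<epsilon>. 1 - cdf (chi_square_law (2 * m \<epsilon> - 1)) (c (m \<epsilon>) * ?z)) \<longlongrightarrow> \<alpha>) (at_right 0)"
    by (rule filterlim_compose[OF _ assms(11)])
  moreover have "\<forall>\<^sub>F \<epsilon> in at_right 0. 1 - cdf (chi_square_law (2 * m \<epsilon> - 1)) (c (m \<epsilon>) * ?z) = (LINT \<omega>|M \<epsilon>. ?\<psi> \<epsilon> \<omega>)"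
    using eventually_at_right_less[of 0] by eventually_elim (simp only: size)
  ultimately have "((\<lambda>\<epsilon>. LINT \<omega>|M \<epsilon>. ?\<psi> \<epsilon> \<omega>) \<longlongrightarrow> \<alpha>) (at_right 0)"
    by (rule Lim_transform_eventually)
  with test show ?thesis
    unfolding tests_of_asymptotic_size_def by simp
qed

end
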